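(* Let $X$ be a linear diffusion on $I=(\ell,+\infty[$ as described in the context, and let $f:[0,+\infty[\to[\ell,+\infty[$ be a continuous function with $\zeta(f):=\inf\{t\ge0:f(t)=\ell\}\in\,]0,+\infty]$. If $\zeta(f)=+\infty$, assume that $\lim_{t\to+\infty}X_t=+\infty$ a.s. and that $\mathbb{P}_x\left(\lim_{t\to+\infty}(X_t-f(t))>0\right)=1$ for all $x\in I$. Let $$\mathcal{D}=\{(t,y)\in\,]0,\zeta(f)[\times]\ell,+\infty[\,:\ y\ge f(t)\},\qquad \partial\mathcal{D}=\{(t,y)\in\,]0,\zeta(f)[\times]\ell,+\infty[\,:\ y=f(t)\}.$$ Assume that there exists a function $\overline{H}:\mathcal{D}\to[0,1]$, of class $\mathcal{C}^{1,2}$ on $\mathcal{D}$, such that: (1) $\mathcal{G}\overline{H}+\dfrac{\partial\overline{H}}{\partial t}=0$ (with $\mathcal{G}$ acting on the variable $y$), with the boundary condition $\overline{H}(t,y)=1$ on $\partial\mathcal{D}$; (2) $\overline{H}$ is decreasing in $y$; (3) if $\zeta(f)=+\infty$: $\lim_{t,y\to+\infty}\overline{H}(t,y)=0$ (joint limit as $t\to+\infty$ and $y\to+\infty$); if $\zeta(f)<+\infty$: for every $y\in\,]\ell,+\infty[$, $\lim_{t\to\zeta(f)}\overline{H}(t,y)=0$. Then, for $(t,y)\in\mathcal{D}$, $$\overline{H}(t,y)=\mathbb{P}_y(T_{f\circ\theta_t}<+\infty).$$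
   Context: Setting: $\ell\in[-\infty,+\infty[$, and $(X_t,t\ge 0)$ is a linear regular conservative (infinite life-time) diffusion with values in $I=(\ell,+\infty[$ (the point $\ell$ may or may not belong to $I$), with $+\infty$ a natural boundary; $\mathbb{P}_x$ is its law started from $x$. Its speed measure is $m(dx)=\rho(x)dx$ (absolutely continuous), its scale function $s$ is of class $\mathcal{C}^2$, and its generator is $\mathcal{G}=\frac{1}{\rho(y)}\frac{\partial}{\partial y}\left(\frac{1}{s'(y)}\frac{\partial}{\partial y}\right)$. $X$ has a transition density $q(t,x,y)$ with respect to $m$, jointly continuous, symmetric in $(x,y)$, assumed of class $\mathcal{C}^{1,2,2}$ on $]0,+\infty[\times I\times I$. Shift: $(f\circ\theta_t)(u)=f(t+u)$. Hitting time: $T_{f\circ\theta_t}:=\inf\{u\ge 0: X_u=f(t+u)\}$, where only times $u<\zeta(f)-t$ are considered, and $T_{f\circ\theta_t}=+\infty$ if there is no such $u$. *)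

theory Defs
  imports "HOL-Probability.Probability"
begin

section \<open>Classes of differentiable functions\<close>

text \<open>Derivatives are taken within the set, hence one-sided at an endpoint contained in it.\<close>

definition C2_on :: "real set \<Rightarrow> (real \<Rightarrow> real) \<Rightarrow> bool" where
  "C2_on S g \<longleftrightarrow> (\<exists>g' g''.
     (\<forall>x\<in>S. (g has_real_derivative g' x) (at x within S)) \<and>
     (\<forall>x\<in>S. (g' has_real_derivative g'' x) (at x within S)) \<and>
     continuous_on S g' \<and> continuous_on S g'')"

definition C122_on :: "real set \<Rightarrow> real set \<Rightarrow> real set \<Rightarrow> (real \<Rightarrow> real \<Rightarrow> real \<Rightarrow> real) \<Rightarrow> bool" where
  "C122_on R S U q \<longleftrightarrow>
     continuous_on (R \<times> S \<times> U) (\<lambda>(t, x, y). q t x y) \<and>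
     (\<exists>qt qx qxx qy qyy.
       (\<forall>t\<in>R. \<forall>x\<in>S. \<forall>y\<in>U.
          ((\<lambda>r. q r x y) has_real_derivative qt t x y) (at t within R) \<and>
          ((\<lambda>z. q t z y) has_real_derivative qx t x y) (at x within S) \<and>
          ((\<lambda>z. qx t z y) has_real_derivative qxx t x y) (at x within S) \<and>
          ((\<lambda>z. q t x z) has_real_derivative qy t x y) (at y within U) \<and>
          ((\<lambda>z. qy t x z) has_real_derivative qyy t x y) (at y within U)) \<and>
       (\<forall>g\<in>{qt, qx, qxx, qy, qyy}. continuous_on (R \<times> S \<times> U) (\<lambda>(t, x, y). g t x y)))"

text \<open>On a set \<open>D\<close> that is not open, a function is of class \<open>C\<close>\<open>1,2\<close> when it is continuous on
  \<open>D\<close> and its partial derivatives in the interior extend continuously to all of \<open>D\<close>. (The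
  sections of \<open>D\<close> in direction \<open>t\<close> may have isolated points on the boundary, where no
  one-sided derivative in \<open>t\<close> makes sense.)\<close>

definition C12_on :: "(real \<times> real) set \<Rightarrow> (real \<Rightarrow> real \<Rightarrow> real) \<Rightarrow> bool" where
  "C12_on D H \<longleftrightarrow>
     continuous_on D (\<lambda>(t, y). H t y) \<and>
     (\<exists>Ht Hy Hyy.
       (\<forall>(t, y)\<in>interior D.
          ((\<lambda>r. H r y) has_real_derivative Ht t y) (at t) \<and>
          ((\<lambda>z. H t z) has_real_derivative Hy t y) (at y) \<and>
          ((\<lambda>z. Hy t z) has_real_derivative Hyy t y) (at y)) \<and>
       (\<forall>g\<in>{Ht, Hy, Hyy}. continuous_on D (\<lambda>(t, y). g t y)))"


section \<open>Hitting times and filtrations\<close>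

text \<open>First time at which \<open>X\<close> meets the curve \<open>g\<close>, among times \<open>u < z\<close> only. Curves take
  extended real values since the left endpoint of the state space may be \<open>-\<infinity>\<close>.\<close>

definition curve_hitting_time ::
    "(real \<Rightarrow> 'w \<Rightarrow> real) \<Rightarrow> (real \<Rightarrow> ereal) \<Rightarrow> ereal \<Rightarrow> 'w \<Rightarrow> ennreal" where
  "curve_hitting_time X g z \<omega> =
     (INF u\<in>{u. 0 \<le> u \<and> ereal u < z \<and> ereal (X u \<omega>) = g u}. ennreal u)"

definition hitting_time :: "(real \<Rightarrow> 'w \<Rightarrow> real) \<Rightarrow> real \<Rightarrow> 'w \<Rightarrow> ennreal" where
  "hitting_time X y \<omega> = (INF u\<in>{u. 0 \<le> u \<and> X u \<omega> = y}. ennreal u)"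

definition natural_filtration ::
    "'w measure \<Rightarrow> (real \<Rightarrow> 'w \<Rightarrow> real) \<Rightarrow> real \<Rightarrow> 'w measure" where
  "natural_filtration M X t =
     sigma (space M) {X r -` B \<inter> space M | r B. 0 \<le> r \<and> r \<le> t \<and> B \<in> sets borel}"

text \<open>Stopping times of the right-continuous filtration \<open>F\<close>\<open>t+\<close>, and the events prior to
  them.\<close>

definition optional_time ::
    "'w measure \<Rightarrow> (real \<Rightarrow> 'w \<Rightarrow> real) \<Rightarrow> ('w \<Rightarrow> ennreal) \<Rightarrow> bool" where
  "optional_time M X \<tau> \<longleftrightarrow>
     (\<forall>t>0. {\<omega>\<in>space M. \<tau> \<omega> < ennreal t} \<in> sets (natural_filtration M X t))"

definition optional_events ::
    "'w measure \<Rightarrow> (real \<Rightarrow> 'w \<Rightarrow> real) \<Rightarrow> ('w \<Rightarrow> ennreal) \<Rightarrow> 'w set set" where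
  "optional_events M X \<tau> = {A. A \<subseteq> space M \<and>
     (\<forall>t>0. {\<omega>\<in>A. \<tau> \<omega> < ennreal t} \<in> sets (natural_filtration M X t))}"


section \<open>Scale, speed and generator\<close>

definition speed_measure :: "real set \<Rightarrow> (real \<Rightarrow> real) \<Rightarrow> real measure" where
  "speed_measure I \<rho> = density lborel (\<lambda>y. ennreal (\<rho> y) * indicator I y)"

definition generator :: "(real \<Rightarrow> real) \<Rightarrow> (real \<Rightarrow> real) \<Rightarrow> (real \<Rightarrow> real) \<Rightarrow> real \<Rightarrow> real" where
  "generator \<rho> s g y = 1 / \<rho> y * deriv (\<lambda>z. 1 / deriv s z * deriv g z) y"

text \<open>Green function, with respect to the speed measure, of the diffusion killed when it
  leaves the interval from \<open>a\<close> to \<open>b\<close>. The normalisation is the one for which the generator is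
  \<open>d/dm d/ds\<close>.\<close>

definition green :: "(real \<Rightarrow> real) \<Rightarrow> real \<Rightarrow> real \<Rightarrow> real \<Rightarrow> real \<Rightarrow> real" where
  "green s a b x y = (s (min x y) - s a) * (s b - s (max x y)) / (s b - s a)"

text \<open>Feller's test: \<open>+\<infinity>\<close> is natural if it is neither an exit nor an entrance boundary.\<close>

definition natural_at_infinity :: "real set \<Rightarrow> (real \<Rightarrow> real) \<Rightarrow> (real \<Rightarrow> real) \<Rightarrow> bool" where
  "natural_at_infinity I \<rho> s \<longleftrightarrow> (\<forall>z\<in>interior I.
     (\<integral>\<^sup>+y\<in>{z<..}. emeasure (speed_measure I \<rho>) {z<..<y} * ennreal (deriv s y) \<partial>lborel) = \<infinity> \<and>
     (\<integral>\<^sup>+y\<in>{z<..}. ennreal (s y - s z) \<partial>speed_measure I \<rho>) = \<infinity>)"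


section \<open>Linear diffusions\<close>

text \<open>Of the measure \<open>M\<close> only the space and the sigma-algebra are used. The values of \<open>P x\<close> for
  \<open>x\<close> outside \<open>I\<close>, and of \<open>s\<close> and \<open>\<rho>\<close> outside the interior of \<open>I\<close>, play no role.\<close>

locale linear_diffusion =
  fixes l :: ereal
    and I :: "real set"
    and M :: "'w measure"
    and X :: "real \<Rightarrow> 'w \<Rightarrow> real"
    and P :: "real \<Rightarrow> 'w measure"
    and \<rho> s :: "real \<Rightarrow> real"
    and q :: "real \<Rightarrow> real \<Rightarrow> real \<Rightarrow> real"
  assumes left_endpoint: "l < \<infinity>"
    and state_space: "I = {x. l < ereal x} \<or> I = {x. l \<le> ereal x}"
    \<comment> \<open>strong Markov family with continuous paths and infinite life-time\<close>
    and prob_space_P: "x \<in> I \<Longrightarrow> prob_space (P x)"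
    and sets_P: "x \<in> I \<Longrightarrow> sets (P x) = sets M"
    and measurable_X: "0 \<le> t \<Longrightarrow> X t \<in> borel_measurable M"
    and X_in_I: "\<omega> \<in> space M \<Longrightarrow> 0 \<le> t \<Longrightarrow> X t \<omega> \<in> I"
    and continuous_paths: "\<omega> \<in> space M \<Longrightarrow> continuous_on {0..} (\<lambda>t. X t \<omega>)"
    and start: "x \<in> I \<Longrightarrow> AE \<omega> in P x. X 0 \<omega> = x"
    and measurable_P: "0 \<le> t \<Longrightarrow> B \<in> sets borel \<Longrightarrow>
      (\<lambda>x. emeasure (P x) {\<omega>\<in>space M. X t \<omega> \<in> B}) \<in> borel_measurable (restrict_space borel I)"
    and strong_Markov: "x \<in> I \<Longrightarrow> optional_time M X \<tau> \<Longrightarrow> A \<in> optional_events M X \<tau> \<Longrightarrow>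
      0 \<le> u \<Longrightarrow> B \<in> sets borel \<Longrightarrow>
      emeasure (P x) {\<omega>\<in>A. \<tau> \<omega> < \<infinity> \<and> X (enn2real (\<tau> \<omega>) + u) \<omega> \<in> B} =
      (\<integral>\<^sup>+\<omega>\<in>{\<omega>\<in>A. \<tau> \<omega> < \<infinity>}.
         emeasure (P (X (enn2real (\<tau> \<omega>)) \<omega>)) {\<omega>'\<in>space M. X u \<omega>' \<in> B} \<partial>P x)"
    and regular: "x \<in> interior I \<Longrightarrow> y \<in> I \<Longrightarrow>
      emeasure (P x) {\<omega>\<in>space M. hitting_time X y \<omega> < \<infinity>} > 0"
    \<comment> \<open>scale function\<close>
    and scale_C2: "C2_on (interior I) s"
    and scale_deriv_pos: "x \<in> interior I \<Longrightarrow> deriv s x > 0"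
    and scale: "a \<in> interior I \<Longrightarrow> a < x \<Longrightarrow> x < b \<Longrightarrow>
      measure (P x) {\<omega>\<in>space M. hitting_time X b \<omega> < hitting_time X a \<omega>} =
      (s x - s a) / (s b - s a)"
    \<comment> \<open>speed measure\<close>
    and speed_measurable: "\<rho> \<in> borel_measurable (restrict_space borel I)"
    and speed_pos: "x \<in> interior I \<Longrightarrow> \<rho> x > 0"
    and speed_finite: "a \<in> interior I \<Longrightarrow> emeasure (speed_measure I \<rho>) {a..b} < \<infinity>"
    and speed: "a \<in> interior I \<Longrightarrow> a < x \<Longrightarrow> x < b \<Longrightarrow>
      (\<integral>\<^sup>+\<omega>. min (hitting_time X a \<omega>) (hitting_time X b \<omega>) \<partial>P x) =
      (\<integral>\<^sup>+y\<in>{a<..<b}. ennreal (green s a b x y) \<partial>speed_measure I \<rho>)"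
    \<comment> \<open>the generator, through Dynkin's formula on \<open>C\<close>\<open>2\<close> functions with compact support\<close>
    and generator: "x \<in> I \<Longrightarrow> 0 \<le> t \<Longrightarrow> C2_on UNIV g \<Longrightarrow> compact K \<Longrightarrow> K \<subseteq> interior I \<Longrightarrow>
      (\<And>z. z \<notin> K \<Longrightarrow> g z = 0) \<Longrightarrow>
      (\<integral>\<omega>. g (X t \<omega>) \<partial>P x) =
      g x + (LINT r:{0..t}|lborel. (\<integral>\<omega>. generator \<rho> s g (X r \<omega>) \<partial>P x))"
    and natural_boundary: "natural_at_infinity I \<rho> s"
    \<comment> \<open>transition density with respect to the speed measure\<close>
    and density_nonneg: "0 < t \<Longrightarrow> x \<in> I \<Longrightarrow> y \<in> I \<Longrightarrow> q t x y \<ge> 0"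
    and density: "0 < t \<Longrightarrow> x \<in> I \<Longrightarrow> B \<in> sets borel \<Longrightarrow>
      emeasure (P x) {\<omega>\<in>space M. X t \<omega> \<in> B} =
      (\<integral>\<^sup>+y\<in>B. ennreal (q t x y) \<partial>speed_measure I \<rho>)"
    and density_symmetric: "0 < t \<Longrightarrow> x \<in> I \<Longrightarrow> y \<in> I \<Longrightarrow> q t x y = q t y x"
    and density_C122: "C122_on {0<..} I I q"


section \<open>The region above a curve\<close>

definition life_time :: "ereal \<Rightarrow> (real \<Rightarrow> ereal) \<Rightarrow> ereal" where
  "life_time l f = (INF t\<in>{t. 0 \<le> t \<and> f t = l}. ereal t)"

definition shift :: "real \<Rightarrow> (real \<Rightarrow> 'a) \<Rightarrow> real \<Rightarrow> 'a" where
  "shift t f u = f (t + u)"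

definition above_curve :: "ereal \<Rightarrow> (real \<Rightarrow> ereal) \<Rightarrow> (real \<times> real) set" where
  "above_curve l f =
     {(t, y). 0 < t \<and> ereal t < life_time l f \<and> l < ereal y \<and> f t \<le> ereal y}"

definition on_curve :: "ereal \<Rightarrow> (real \<Rightarrow> ereal) \<Rightarrow> (real \<times> real) set" where
  "on_curve l f =
     {(t, y). 0 < t \<and> ereal t < life_time l f \<and> l < ereal y \<and> ereal y = f t}"

end

theory Submission
  imports Defs
begin

text \<open>Fix \<open>(t, x)\<close> strictly above the curve, let \<open>T\<close> be the hitting time of the shifted curve and let
  \<open>\<sigma>\<^sub>n\<close> be the exit time of the space-time process \<open>(u, X u)\<close> from the set of points between a smooth
  curve slightly above \<open>f\<close> and a high level, up to a time \<open>U\<^sub>n\<close> below the life time. As \<open>H\<close> solves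
  the backward equation, the expectation of \<open>H\<close> at time \<open>\<sigma>\<^sub>n\<close> is \<open>H t x\<close>. As \<open>n\<close> grows, the value
  of \<open>H\<close> at time \<open>\<sigma>\<^sub>n\<close> tends to \<open>1\<close> where \<open>T\<close> is finite, by the boundary condition, and to \<open>0\<close> elsewhere,
  by the limit conditions: for a finite life time, \<open>H\<close> is bounded along the path by its values at a fixed
  level below the end point of the path, which almost surely is not \<open>l\<close> because the law of \<open>X\<close> has
  a density.

  The optional stopping needs only the Markov property at fixed times: stop \<open>H\<close>, multiplied by a
  cutoff function, at the first point of a finite grid that lies outside the region, telescope the
  increments along the grid, and refine the grid. The generator applied to a smooth function need not
  be bounded since \<open>1 / \<rho>\<close> may not be, but in the expectations \<open>\<rho>\<close> cancels against
  the density of the speed measure. This gives bounds that are uniform on time intervals away from \<open>0\<close>,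
  so the grid starts at a time \<open>a > 0\<close>, and \<open>a\<close> tends to \<open>0\<close> in the end.\<close>

section \<open>The law of the diffusion at a fixed time\<close>

text \<open>The equation for \<open>H\<close> and its derivatives are available only strictly above
  the curve, so a cutoff function has to act there, and it must be C1 in time although
  \<open>f\<close> is merely continuous. This is why the curve is first replaced by a polynomial
  lying between \<open>F + \<epsilon>\<close> and \<open>F + 3 * \<epsilon>\<close>. The stopping
  regions are closed because leaving a closed set is an open condition: a path that is outside at
  one time is outside during a whole interval of times, which fine grids cannot miss. The hitting
  time of the curve itself lacks this property and is only reached as a limit of such exit times. On
  a grid cell the increment is split into a change of the function at the final position and a move
  of the path under the function frozen at the initial time.\<close>

lemma compact_bounded_on:
  fixes c :: "'a::topological_space \<Rightarrow> real"
  assumes "compact K" "continuous_on K c"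
  obtains B where "0 \<le> B" "\<And>y. y \<in> K \<Longrightarrow> \<bar>c y\<bar> \<le> B"
proof -
  have "bounded (c ` K)" using assms by (intro compact_imp_bounded compact_continuous_image)
  then obtain B where "\<forall>z\<in>c ` K. norm z \<le> B" unfolding bounded_iff by blast
  then show thesis by (intro that[of "max B 0"]) force+
qed

context linear_diffusion
begin

section \<open>The state space and its left end point\<close>

lemma interior_I: "interior I = {x. l < ereal x}"
proof -
  have op: "open {x. l < ereal x}"
    by (intro open_Collect_less continuous_on_const continuous_on_ereal continuous_on_id)
  show ?thesis
    using state_space
  proof
    assume "I = {x. l < ereal x}"
    then show ?thesis using op by (simp add: interior_open)
  next
    assume I: "I = {x. l \<le> ereal x}"
    show ?thesis
    proof (cases l)
      case (real r)
      then have "I = {r..}" "{x. l < ereal x} = {r<..}" using I by auto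
      then show ?thesis by (simp add: interior_real_atLeast)
    next
      case PInf
      then show ?thesis using left_endpoint by simp
    next
      case MInf
      then show ?thesis using I by auto
    qed
  qed
qed

lemma I_borel [measurable]: "I \<in> sets borel"
  using state_space by (elim disjE) (simp_all)

lemma interior_subset_I: "x \<in> interior I \<Longrightarrow> x \<in> I"
  using interior_subset by auto

lemma AE_lborel_interior_I: "AE y in lborel. y \<in> I \<longrightarrow> y \<in> interior I"
\<comment> \<open>If \<open>l\<close> is -\<infinity>, \<open>real_of_ereal l\<close> is the default
  value 0; discarding this further null point does no harm.\<close>
proof (rule AE_mp[OF AE_lborel_singleton[of "real_of_ereal l"]], rule AE_I2, safe)
  fix y assume y: "y \<noteq> real_of_ereal l" "y \<in> I"
  have "l \<noteq> ereal y" using y(1) by auto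
  moreover have "l \<le> ereal y" using y(2) state_space by (auto simp: less_imp_le)
  ultimately show "y \<in> interior I" by (simp add: interior_I)
qed

lemma space_P: "x \<in> I \<Longrightarrow> space (P x) = space M"
  using sets_P sets_eq_imp_space_eq by blast

lemma measurable_X_P: "x \<in> I \<Longrightarrow> 0 \<le> t \<Longrightarrow> X t \<in> borel_measurable (P x)"
  using measurable_X[of t] measurable_cong_sets[OF sets_P refl] by blast

text \<open>Nothing is assumed about \<open>q\<close> and \<open>\<rho>\<close> off the state space, hence the truncations.\<close>

definition qI :: "real \<Rightarrow> real \<Rightarrow> real \<Rightarrow> real" where
  "qI u z y = (if 0 < u \<and> z \<in> I \<and> y \<in> I then q u z y else 0)"

definition rhoI :: "real \<Rightarrow> real" where
  "rhoI y = (if y \<in> I then \<rho> y else 0)"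

text \<open>The Lebesgue density of the law of \<open>X u\<close> under \<open>P z\<close>. The
  factors are converted to \<open>ennreal\<close> separately, as in the speed measure, because the
  sign of \<open>\<rho>\<close> is prescribed only in the interior of \<open>I\<close>.\<close>

definition dens :: "real \<Rightarrow> real \<Rightarrow> real \<Rightarrow> ennreal" where
  "dens u z y = ennreal (qI u z y) * ennreal (rhoI y)"

lemma qI_nonneg: "0 \<le> qI u z y"
  by (simp add: qI_def density_nonneg)

lemma q_continuous: "continuous_on ({0<..} \<times> I \<times> I) (\<lambda>(t, x, y). q t x y)"
  using density_C122 by (simp add: C122_on_def)

lemma qI_measurable3: "(\<lambda>(u, z, y). qI u z y) \<in> borel_measurable borel"
proof -
  have S: "{0<..} \<times> I \<times> I \<in> sets (borel :: (real \<times> real \<times> real) measure)"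
    by (metis I_borel borel_prod open_greaterThan borel_open pair_measureI)
  have "(\<lambda>p. indicator ({0<..} \<times> I \<times> I) p *\<^sub>R (case p of (t, x, y) \<Rightarrow> q t x y)) \<in> borel_measurable borel"
    using borel_measurable_continuous_on_indicator[OF S q_continuous] by simp
  also have "(\<lambda>p. indicator ({0<..} \<times> I \<times> I) p *\<^sub>R (case p of (t, x, y) \<Rightarrow> q t x y)) = (\<lambda>(u, z, y). qI u z y)"
    by (auto simp: fun_eq_iff qI_def indicator_def)
  finally show ?thesis .
qed

lemma qI_measurable [measurable]:
  assumes "f \<in> borel_measurable N" "g \<in> borel_measurable N" "h \<in> borel_measurable N"
  shows "(\<lambda>w. qI (f w) (g w) (h w)) \<in> borel_measurable N"
proof -
  have "(\<lambda>w. (f w, g w, h w)) \<in> N \<rightarrow>\<^sub>M borel"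
    using assms by (intro borel_measurable_Pair)
  from measurable_compose[OF this qI_measurable3] show ?thesis by simp
qed

lemma rhoI_measurable [measurable]: "rhoI \<in> borel_measurable borel"
proof -
  have "(\<lambda>y. indicator I y *\<^sub>R \<rho> y) \<in> borel_measurable borel"
    using speed_measurable by (simp add: borel_measurable_restrict_space_iff mult.commute)
  also have "(\<lambda>y. indicator I y *\<^sub>R \<rho> y) = rhoI"
    by (auto simp: fun_eq_iff rhoI_def indicator_def)
  finally show ?thesis .
qed

lemma dens_measurable [measurable]:
  assumes [measurable]: "f \<in> borel_measurable N" "g \<in> borel_measurable N" "h \<in> borel_measurable N"
  shows "(\<lambda>w. dens (f w) (g w) (h w)) \<in> borel_measurable N"
  unfolding dens_def by measurable

lemma rhoI_pos: "y \<in> interior I \<Longrightarrow> 0 < rhoI y"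
  using speed_pos interior_subset_I by (auto simp: rhoI_def)

lemma emeasure_law:
  assumes "0 < u" "z \<in> I" "B \<in> sets borel"
  shows "emeasure (P z) {\<omega>\<in>space M. X u \<omega> \<in> B} = (\<integral>\<^sup>+y\<in>B. dens u z y \<partial>lborel)"
proof -
  have sm: "speed_measure I \<rho> = density lborel (\<lambda>y. ennreal (rhoI y))"
    unfolding speed_measure_def
    by (rule arg_cong[where f="density lborel"]) (auto simp: rhoI_def fun_eq_iff indicator_def)
  have "emeasure (P z) {\<omega>\<in>space M. X u \<omega> \<in> B} = (\<integral>\<^sup>+y\<in>B. ennreal (q u z y) \<partial>speed_measure I \<rho>)"
    using density assms by blast
  \<comment> \<open>The speed measure does not charge the complement of \<open>I\<close>, so
    \<open>q\<close> may be truncated there.\<close>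
  also have "\<dots> = (\<integral>\<^sup>+y. ennreal (qI u z y) * indicator B y \<partial>speed_measure I \<rho>)"
  proof (rule nn_integral_cong_AE)
    have "AE y in speed_measure I \<rho>. y \<in> I"
      unfolding sm by (subst AE_density, measurable) (auto simp: rhoI_def)
    then show "AE y in speed_measure I \<rho>. ennreal (q u z y) * indicator B y = ennreal (qI u z y) * indicator B y"
      by eventually_elim (use assms in \<open>simp add: qI_def\<close>)
  qed
  also have "\<dots> = (\<integral>\<^sup>+y\<in>B. dens u z y \<partial>lborel)"
    unfolding sm using assms(3)
    by (subst nn_integral_density) (auto simp: dens_def mult_ac intro!: nn_integral_cong)
  finally show ?thesis .
qed

lemma law_X:
  assumes "0 < u" "z \<in> I"
  shows "distr (P z) borel (X u) = density lborel (dens u z)"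
proof (rule measure_eqI)
  fix B assume "B \<in> sets (distr (P z) borel (X u))"
  then have B: "B \<in> sets borel" by simp
  have "emeasure (distr (P z) borel (X u)) B = emeasure (P z) {\<omega>\<in>space M. X u \<omega> \<in> B}"
    using B assms measurable_X_P[of z u]
    by (subst emeasure_distr) (auto simp: space_P intro!: arg_cong[where f="emeasure (P z)"])
  also have "\<dots> = emeasure (density lborel (dens u z)) B"
    using B assms by (subst emeasure_law) (auto simp: emeasure_density)
  finally show "emeasure (distr (P z) borel (X u)) B = emeasure (density lborel (dens u z)) B" .
qed simp

lemma nn_integral_law:
  assumes "0 < u" "z \<in> I" and [measurable]: "h \<in> borel_measurable borel"
  shows "(\<integral>\<^sup>+\<omega>. h (X u \<omega>) \<partial>P z) = (\<integral>\<^sup>+y. dens u z y * h y \<partial>lborel)"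
proof -
  have "(\<integral>\<^sup>+\<omega>. h (X u \<omega>) \<partial>P z) = (\<integral>\<^sup>+y. h y \<partial>distr (P z) borel (X u))"
    using assms measurable_X_P[of z u] by (subst nn_integral_distr) auto
  also have "\<dots> = (\<integral>\<^sup>+y. dens u z y * h y \<partial>lborel)"
    by (simp add: law_X assms nn_integral_density)
  finally show ?thesis .
qed

text \<open>At a positive time the law has a Lebesgue density that vanishes off \<open>I\<close>,
  and \<open>I\<close> exceeds its interior by at most one point. At time 0 this would fail for a
  start at the end point.\<close>

lemma AE_interior_I:
  assumes "0 < u" "z \<in> I"
  shows "AE \<omega> in P z. X u \<omega> \<in> interior I"
proof -
  have "AE y in density lborel (dens u z). y \<in> interior I"
    by (subst AE_density, simp, rule AE_mp[OF AE_lborel_interior_I])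
      (auto simp: dens_def qI_def)
  then have "AE y in distr (P z) borel (X u). y \<in> interior I"
    unfolding law_X[OF assms] .
  then show ?thesis
    using assms measurable_X_P[of z u] by (subst (asm) AE_distr_iff) auto
qed

lemma integral_law:
  fixes h :: "real \<Rightarrow> real"
  assumes u: "0 < u" and z: "z \<in> I" and [measurable]: "h \<in> borel_measurable borel"
  shows "(\<integral>\<omega>. h (X u \<omega>) \<partial>P z) = (\<integral>y. h y * enn2real (dens u z y) \<partial>lborel)"
proof -
  have "(\<integral>\<omega>. h (X u \<omega>) \<partial>P z) = (\<integral>y. h y \<partial>distr (P z) borel (X u))"
    using measurable_X_P[OF z, of u] u by (subst integral_distr) auto
  also have "\<dots> = (\<integral>y. h y \<partial>density lborel (\<lambda>y. ennreal (enn2real (dens u z y))))"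
    by (subst law_X[OF u z], rule arg_cong[where f="\<lambda>N. integral\<^sup>L N h"],
        rule density_cong) (auto simp: dens_def ennreal_mult_less_top intro!: ennreal_enn2real[symmetric])
  also have "\<dots> = (\<integral>y. h y * enn2real (dens u z y) \<partial>lborel)"
    by (subst integral_density) (auto simp: mult.commute)
  finally show ?thesis .
qed

section \<open>The Markov property at a fixed time\<close>

lemma natural_filtration_sub:
  assumes "0 \<le> a"
  shows "sets (natural_filtration M X a) \<subseteq> sets M"
  unfolding natural_filtration_def
  by (rule order.trans[OF sets_measure_of[THEN equalityD1]])
    (auto intro!: sets.sigma_sets_subset measurable_sets[OF measurable_X])

lemma natural_filtration_mono:
  assumes "a \<le> b"
  shows "sets (natural_filtration M X a) \<subseteq> sets (natural_filtration M X b)"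
proof -
  have *: "{X r -` B \<inter> space M | r B. 0 \<le> r \<and> r \<le> c \<and> B \<in> sets borel} \<subseteq> Pow (space M)" for c
    by auto
  show ?thesis
    unfolding natural_filtration_def sets_measure_of[OF *]
    using assms by (intro sigma_sets_mono') (auto intro: order.trans)
qed

lemma natural_filtration_X:
  assumes "0 \<le> r" "r \<le> a" "B \<in> sets borel"
  shows "{\<omega>\<in>space M. X r \<omega> \<in> B} \<in> sets (natural_filtration M X a)"
proof -
  have "X r -` B \<inter> space M \<in> sets (natural_filtration M X a)"
    unfolding natural_filtration_def
    by (subst sets_measure_of) (use assms in \<open>auto intro!: sigma_sets.Basic\<close>)
  also have "X r -` B \<inter> space M = {\<omega>\<in>space M. X r \<omega> \<in> B}" by auto
  finally show ?thesis .
qed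

lemma space_natural_filtration: "space (natural_filtration M X a) = space M"
  unfolding natural_filtration_def by (subst space_measure_of) auto

text \<open>A constant is an optional time, and \<open>A\<close> is prior to it: the event that the
  constant is below \<open>t\<close> is either empty or everything, and in the latter case
  \<open>A\<close> lies in the larger sigma-algebra at time \<open>t\<close>.\<close>

lemma Markov_emeasure:
  assumes x: "x \<in> I" and a: "0 \<le> a" and A: "A \<in> sets (natural_filtration M X a)"
    and u: "0 \<le> u" and B: "B \<in> sets borel"
  shows "emeasure (P x) {\<omega>\<in>A. X (a + u) \<omega> \<in> B} =
    (\<integral>\<^sup>+\<omega>\<in>A. emeasure (P (X a \<omega>)) {\<omega>'\<in>space M. X u \<omega>' \<in> B} \<partial>P x)"
proof -
  have sp: "A \<subseteq> space M" using sets.sets_into_space[OF A] by (simp add: space_natural_filtration)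
  have ot: "optional_time M X (\<lambda>_. ennreal a)"
    unfolding optional_time_def
  proof safe
    fix t :: real
    have "{\<omega> \<in> space M. ennreal a < ennreal t} = (if ennreal a < ennreal t then space (natural_filtration M X t) else {})"
      by (auto simp: space_natural_filtration)
    then show "{\<omega> \<in> space M. ennreal a < ennreal t} \<in> sets (natural_filtration M X t)"
      by (metis sets.empty_sets sets.top)
  qed
  have oe: "A \<in> optional_events M X (\<lambda>_. ennreal a)"
    unfolding optional_events_def
  proof (intro CollectI conjI allI impI sp)
    fix t :: real assume t: "0 < t"
    show "{\<omega> \<in> A. ennreal a < ennreal t} \<in> sets (natural_filtration M X t)"
    proof (cases "a < t")
      case True
      then show ?thesis using A natural_filtration_mono[of a t] t a by (auto simp: ennreal_less_iff)
    next
      case False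
      then show ?thesis using t a by (auto simp: ennreal_less_iff)
    qed
  qed
  show ?thesis
    using strong_Markov[OF x ot oe u B] a by (simp add: ennreal_less_top less_top[symmetric])
qed

text \<open>Instead of approximating \<open>h\<close> by simple functions, the law of
  \<open>X (a + u)\<close> on \<open>A\<close> is identified: its Lebesgue density \<open>d\<close>
  averages \<open>dens u (X a \<omega>)\<close> over \<open>A\<close>. Both measures agree on Borel
  sets by \<open>Markov_emeasure\<close>, and integrating \<open>h\<close> against either gives the
  claim by Tonelli, thanks to the joint measurability of \<open>dens\<close>.\<close>

lemma Markov_nn_integral:
  assumes x: "x \<in> I" and a: "0 \<le> a" and A: "A \<in> sets (natural_filtration M X a)"
    and u: "0 < u" and h [measurable]: "h \<in> borel_measurable borel"
  shows "(\<integral>\<^sup>+\<omega>\<in>A. h (X (a + u) \<omega>) \<partial>P x) =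
    (\<integral>\<^sup>+\<omega>\<in>A. (\<integral>\<^sup>+\<omega>'. h (X u \<omega>') \<partial>P (X a \<omega>)) \<partial>P x)"
proof -
  interpret prob_space "P x" using prob_space_P x .
  have sp: "A \<subseteq> space M" using sets.sets_into_space[OF A] by (simp add: space_natural_filtration)
  have A' [measurable]: "A \<in> sets (P x)"
    using A natural_filtration_sub[OF a] sets_P[OF x] by auto
  have Xa [measurable]: "X a \<in> borel_measurable (P x)" and Xu [measurable]: "X (a + u) \<in> borel_measurable (P x)"
    using measurable_X_P x a u by auto
  interpret pair_sigma_finite "P x" lborel ..
  define N1 where "N1 = distr (density (P x) (indicator A)) borel (X (a + u))"
  define d where "d y = (\<integral>\<^sup>+\<omega>. dens u (X a \<omega>) y * indicator A \<omega> \<partial>P x)" for y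
  have d [measurable]: "d \<in> borel_measurable borel"
    unfolding d_def by measurable
  have XaI: "X a \<omega> \<in> I" if "\<omega> \<in> space (P x)" for \<omega>
    using that X_in_I a x by (simp add: space_P)
  have swap: "(\<integral>\<^sup>+y. d y * k y \<partial>lborel) =
      (\<integral>\<^sup>+\<omega>\<in>A. (\<integral>\<^sup>+y. dens u (X a \<omega>) y * k y \<partial>lborel) \<partial>P x)"
    if [measurable]: "k \<in> borel_measurable borel" for k
  proof -
    have "(\<integral>\<^sup>+y. d y * k y \<partial>lborel) =
        (\<integral>\<^sup>+y. (\<integral>\<^sup>+\<omega>. dens u (X a \<omega>) y * indicator A \<omega> * k y \<partial>P x) \<partial>lborel)"
      unfolding d_def by (intro nn_integral_cong) (simp add: nn_integral_multc)
    also have "\<dots> = (\<integral>\<^sup>+\<omega>. (\<integral>\<^sup>+y. dens u (X a \<omega>) y * indicator A \<omega> * k y \<partial>lborel) \<partial>P x)"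
      by (rule Fubini') measurable
    also have "\<dots> = (\<integral>\<^sup>+\<omega>\<in>A. (\<integral>\<^sup>+y. dens u (X a \<omega>) y * k y \<partial>lborel) \<partial>P x)"
      by (intro nn_integral_cong) (auto simp: indicator_def)
    finally show ?thesis .
  qed
  have "N1 = density lborel d"
  proof (rule measure_eqI)
    fix B assume "B \<in> sets N1"
    then have B [measurable]: "B \<in> sets borel" by (simp add: N1_def)
    have "emeasure N1 B = emeasure (density (P x) (indicator A)) (X (a + u) -` B \<inter> space (P x))"
      unfolding N1_def by (subst emeasure_distr) auto
    also have "\<dots> = emeasure (P x) (A \<inter> (X (a + u) -` B \<inter> space (P x)))"
      by (subst emeasure_density)
         (auto simp: indicator_inter_arith[symmetric])
    also have "\<dots> = emeasure (P x) {\<omega>\<in>A. X (a + u) \<omega> \<in> B}"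
      using sp x by (intro arg_cong[where f="emeasure (P x)"]) (auto simp: space_P)
    also have "\<dots> = (\<integral>\<^sup>+\<omega>\<in>A. emeasure (P (X a \<omega>)) {\<omega>'\<in>space M. X u \<omega>' \<in> B} \<partial>P x)"
      by (rule Markov_emeasure[OF x a A _ B]) (use u in simp)
    also have "\<dots> = (\<integral>\<^sup>+\<omega>\<in>A. (\<integral>\<^sup>+y. dens u (X a \<omega>) y * indicator B y \<partial>lborel) \<partial>P x)"
      by (intro nn_integral_cong) (simp add: emeasure_law u XaI)
    also have "\<dots> = emeasure (density lborel d) B"
      by (subst swap[symmetric]) (auto simp: emeasure_density)
    finally show "emeasure N1 B = emeasure (density lborel d) B" .
  qed (simp add: N1_def)
  then have "(\<integral>\<^sup>+y. h y \<partial>N1) = (\<integral>\<^sup>+y. d y * h y \<partial>lborel)"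
    by (simp add: nn_integral_density)
  also have "\<dots> = (\<integral>\<^sup>+\<omega>\<in>A. (\<integral>\<^sup>+\<omega>'. h (X u \<omega>') \<partial>P (X a \<omega>)) \<partial>P x)"
    by (subst swap, simp, intro nn_integral_cong) (simp add: nn_integral_law u XaI)
  finally show ?thesis
    unfolding N1_def by (simp add: nn_integral_distr nn_integral_density mult.commute)
qed

text \<open>Positive and negative parts are treated separately. Each has a finite conditional
  expectation for almost every path in \<open>A\<close>, and only there is the inner Bochner
  integral known to be their difference.\<close>

lemma Markov_integral:
  fixes h :: "real \<Rightarrow> real"
  assumes x: "x \<in> I" and a: "0 \<le> a" and A: "A \<in> sets (natural_filtration M X a)"
    and u: "0 < u" and h [measurable]: "h \<in> borel_measurable borel"
    and int: "integrable (P x) (\<lambda>\<omega>. h (X (a + u) \<omega>))"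
  shows "integrable (P x) (\<lambda>\<omega>. indicator A \<omega> * (\<integral>\<omega>'. h (X u \<omega>') \<partial>P (X a \<omega>)))" (is ?int)
    and "(\<integral>\<omega>. indicator A \<omega> * h (X (a + u) \<omega>) \<partial>P x) =
      (\<integral>\<omega>. indicator A \<omega> * (\<integral>\<omega>'. h (X u \<omega>') \<partial>P (X a \<omega>)) \<partial>P x)" (is ?eq)
proof -
  have A' [measurable]: "A \<in> sets (P x)"
    using A natural_filtration_sub[OF a] sets_P[OF x] by auto
  have Xa [measurable]: "X a \<in> borel_measurable (P x)" and Xu [measurable]: "X (a + u) \<in> borel_measurable (P x)"
    using measurable_X_P x a u by auto
  have XaI: "X a \<omega> \<in> I" if "\<omega> \<in> space (P x)" for \<omega>
    using that X_in_I a x by (simp add: space_P)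
  \<comment> \<open>This will be applied to \<open>h\<close> and to \<open>- h\<close>: since
    \<open>ennreal\<close> sends negative numbers to 0, it sees only the positive part of
    \<open>k\<close>.\<close>
  have *: "\<exists>p. p \<in> borel_measurable (P x) \<and> (\<forall>\<omega>. 0 \<le> p \<omega>) \<and>
      integrable (P x) (\<lambda>\<omega>. indicator A \<omega> * p \<omega>) \<and>
      (\<integral>\<omega>. indicator A \<omega> * p \<omega> \<partial>P x) = enn2real (\<integral>\<^sup>+\<omega>\<in>A. ennreal (k (X (a + u) \<omega>)) \<partial>P x) \<and>
      (AE \<omega> in P x. \<omega> \<in> A \<longrightarrow> (\<integral>\<^sup>+\<omega>'. ennreal (k (X u \<omega>')) \<partial>P (X a \<omega>)) = ennreal (p \<omega>))"
    if k [measurable]: "k \<in> borel_measurable borel" and ki: "integrable (P x) (\<lambda>\<omega>. k (X (a + u) \<omega>))"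
    for k :: "real \<Rightarrow> real"
  proof -
    define n where "n \<omega> = (\<integral>\<^sup>+y. dens u (X a \<omega>) y * ennreal (k y) \<partial>lborel)" for \<omega>
    have n_eq: "(\<integral>\<^sup>+\<omega>'. ennreal (k (X u \<omega>')) \<partial>P (X a \<omega>)) = n \<omega>" if "\<omega> \<in> space (P x)" for \<omega>
      unfolding n_def by (rule nn_integral_law) (use u XaI that in auto)
    have n [measurable]: "n \<in> borel_measurable (P x)"
      unfolding n_def by measurable
    have ni: "(\<integral>\<^sup>+\<omega>. n \<omega> * indicator A \<omega> \<partial>P x) = (\<integral>\<^sup>+\<omega>\<in>A. ennreal (k (X (a + u) \<omega>)) \<partial>P x)"
      by (subst Markov_nn_integral[OF x a A u]) (auto intro!: nn_integral_cong simp: n_eq)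
    also have "\<dots> \<le> (\<integral>\<^sup>+\<omega>. ennreal (k (X (a + u) \<omega>)) \<partial>P x)"
      by (intro nn_integral_mono) (auto simp: indicator_def)
    also have "\<dots> < \<infinity>"
      using ki unfolding real_integrable_def by (simp add: less_top)
    finally have fin: "(\<integral>\<^sup>+\<omega>. n \<omega> * indicator A \<omega> \<partial>P x) < \<infinity>" .
    then have "AE \<omega> in P x. n \<omega> * indicator A \<omega> \<noteq> \<infinity>"
      by (intro nn_integral_PInf_AE) (auto simp: less_top)
    then have AEn: "AE \<omega> in P x. \<omega> \<in> A \<longrightarrow> n \<omega> = ennreal (enn2real (n \<omega>))"
      by eventually_elim (auto simp: less_top)
    have nn: "(\<integral>\<^sup>+\<omega>. ennreal (indicator A \<omega> * enn2real (n \<omega>)) \<partial>P x) = (\<integral>\<^sup>+\<omega>. n \<omega> * indicator A \<omega> \<partial>P x)"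
      by (rule nn_integral_cong_AE, use AEn in eventually_elim) (auto simp: indicator_def)
    show ?thesis
    proof (rule exI[of _ "\<lambda>\<omega>. enn2real (n \<omega>)"], intro conjI allI)
      show "integrable (P x) (\<lambda>\<omega>. indicator A \<omega> * enn2real (n \<omega>))"
        by (rule integrableI_nonneg) (use nn fin in auto)
      show "(\<integral>\<omega>. indicator A \<omega> * enn2real (n \<omega>) \<partial>P x) = enn2real (\<integral>\<^sup>+\<omega>\<in>A. ennreal (k (X (a + u) \<omega>)) \<partial>P x)"
        by (subst integral_eq_nn_integral) (auto simp: nn ni)
      show "AE \<omega> in P x. \<omega> \<in> A \<longrightarrow> (\<integral>\<^sup>+\<omega>'. ennreal (k (X u \<omega>')) \<partial>P (X a \<omega>)) = ennreal (enn2real (n \<omega>))"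
        using AEn AE_space by eventually_elim (auto simp: n_eq)
    qed auto
  qed
  obtain p where p [measurable]: "p \<in> borel_measurable (P x)" and p0: "\<And>\<omega>. 0 \<le> p \<omega>"
    and pi: "integrable (P x) (\<lambda>\<omega>. indicator A \<omega> * p \<omega>)"
    and pe: "(\<integral>\<omega>. indicator A \<omega> * p \<omega> \<partial>P x) = enn2real (\<integral>\<^sup>+\<omega>\<in>A. ennreal (h (X (a + u) \<omega>)) \<partial>P x)"
    and pa: "AE \<omega> in P x. \<omega> \<in> A \<longrightarrow> (\<integral>\<^sup>+\<omega>'. ennreal (h (X u \<omega>')) \<partial>P (X a \<omega>)) = ennreal (p \<omega>)"
    using *[OF h int] by blast
  obtain m where m [measurable]: "m \<in> borel_measurable (P x)" and m0: "\<And>\<omega>. 0 \<le> m \<omega>"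
    and mi: "integrable (P x) (\<lambda>\<omega>. indicator A \<omega> * m \<omega>)"
    and me: "(\<integral>\<omega>. indicator A \<omega> * m \<omega> \<partial>P x) = enn2real (\<integral>\<^sup>+\<omega>\<in>A. ennreal (- h (X (a + u) \<omega>)) \<partial>P x)"
    and ma: "AE \<omega> in P x. \<omega> \<in> A \<longrightarrow> (\<integral>\<^sup>+\<omega>'. ennreal (- h (X u \<omega>')) \<partial>P (X a \<omega>)) = ennreal (m \<omega>)"
    using *[of "\<lambda>y. - h y"] int by auto
  have inner: "AE \<omega> in P x. \<omega> \<in> A \<longrightarrow> (\<integral>\<omega>'. h (X u \<omega>') \<partial>P (X a \<omega>)) = p \<omega> - m \<omega>"
    using pa ma AE_space
  proof eventually_elim
    case (elim \<omega>)
    show ?case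
    proof
      assume "\<omega> \<in> A"
      then have 1: "(\<integral>\<^sup>+\<omega>'. ennreal (h (X u \<omega>')) \<partial>P (X a \<omega>)) = ennreal (p \<omega>)"
        "(\<integral>\<^sup>+\<omega>'. ennreal (- h (X u \<omega>')) \<partial>P (X a \<omega>)) = ennreal (m \<omega>)"
        using elim by auto
      have [measurable]: "X u \<in> borel_measurable (P (X a \<omega>))"
        using measurable_X_P[OF XaI[OF elim(3)], of u] u by simp
      have "(\<lambda>\<omega>'. h (X u \<omega>')) \<in> borel_measurable (P (X a \<omega>))"
        by measurable
      then have "integrable (P (X a \<omega>)) (\<lambda>\<omega>'. h (X u \<omega>'))"
        using 1 by (simp add: real_integrable_def)
      then show "(\<integral>\<omega>'. h (X u \<omega>') \<partial>P (X a \<omega>)) = p \<omega> - m \<omega>"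
        by (simp add: real_lebesgue_integral_def 1 p0 m0)
    qed
  qed
  then have AEi: "AE \<omega> in P x. indicator A \<omega> * (\<integral>\<omega>'. h (X u \<omega>') \<partial>P (X a \<omega>)) =
      indicator A \<omega> * p \<omega> - indicator A \<omega> * m \<omega>"
    by eventually_elim (auto simp: indicator_def)
  \<comment> \<open>The family \<open>P\<close> is not a kernel in the formal sense; measurability
    in the starting point is read off the density representation.\<close>
  have meas: "(\<lambda>\<omega>. indicator A \<omega> * (\<integral>\<omega>'. h (X u \<omega>') \<partial>P (X a \<omega>))) \<in> borel_measurable (P x)"
  proof -
    have "(\<integral>\<omega>'. h (X u \<omega>') \<partial>P (X a \<omega>)) = (\<integral>y. h y * enn2real (dens u (X a \<omega>) y) \<partial>lborel)"
      if "\<omega> \<in> space (P x)" for \<omega>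
      using integral_law[OF u XaI[OF that]] by simp
    then show ?thesis by (simp cong: measurable_cong)
  qed
  show ?int
    using Bochner_Integration.integrable_diff[OF pi mi] meas AEi
    by (subst integrable_cong_AE) auto
  have ih: "integrable (P x) (\<lambda>\<omega>. indicator A \<omega> * h (X (a + u) \<omega>))"
    using integrable_mult_indicator[OF A' int] by simp
  have "(\<integral>\<omega>. indicator A \<omega> * h (X (a + u) \<omega>) \<partial>P x) =
      enn2real (\<integral>\<^sup>+\<omega>. ennreal (indicator A \<omega> * h (X (a + u) \<omega>)) \<partial>P x) -
      enn2real (\<integral>\<^sup>+\<omega>. ennreal (- (indicator A \<omega> * h (X (a + u) \<omega>))) \<partial>P x)"
    by (rule real_lebesgue_integral_def[OF ih])
  also have "(\<integral>\<^sup>+\<omega>. ennreal (indicator A \<omega> * h (X (a + u) \<omega>)) \<partial>P x) =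
      (\<integral>\<^sup>+\<omega>\<in>A. ennreal (h (X (a + u) \<omega>)) \<partial>P x)"
    by (intro nn_integral_cong) (auto simp: indicator_def)
  also have "(\<integral>\<^sup>+\<omega>. ennreal (- (indicator A \<omega> * h (X (a + u) \<omega>))) \<partial>P x) =
      (\<integral>\<^sup>+\<omega>\<in>A. ennreal (- h (X (a + u) \<omega>)) \<partial>P x)"
    by (intro nn_integral_cong) (auto simp: indicator_def)
  also have "enn2real (\<integral>\<^sup>+\<omega>\<in>A. ennreal (h (X (a + u) \<omega>)) \<partial>P x) -
      enn2real (\<integral>\<^sup>+\<omega>\<in>A. ennreal (- h (X (a + u) \<omega>)) \<partial>P x) =
      (\<integral>\<omega>. indicator A \<omega> * p \<omega> - indicator A \<omega> * m \<omega> \<partial>P x)"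
    by (simp add: pe me Bochner_Integration.integral_diff[OF pi mi])
  also have "\<dots> = (\<integral>\<omega>. indicator A \<omega> * (\<integral>\<omega>'. h (X u \<omega>') \<partial>P (X a \<omega>)) \<partial>P x)"
    by (rule integral_cong_AE) (use meas AEi in \<open>auto elim!: eventually_mono\<close>)
  finally show ?eq .
qed

section \<open>Dynkin's formula\<close>

text \<open>The product of \<open>\<rho>\<close> and the generator: unlike the generator it is continuous, since \<open>\<rho>\<close> is only
  assumed to be measurable.\<close>

definition psi :: "real \<Rightarrow> real \<Rightarrow> real \<Rightarrow> real" where
  "psi d1 d2 y = (d2 * deriv s y - d1 * deriv (deriv s) y) / (deriv s y)\<^sup>2"

section \<open>The generator on twice differentiable functions\<close>

lemma scale_derivs:
  shows "y \<in> interior I \<Longrightarrow> (deriv s has_real_derivative deriv (deriv s) y) (at y)"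
    and "continuous_on (interior I) (deriv s)"
    and "continuous_on (interior I) (deriv (deriv s))"
proof -
  obtain g' g'' where
    g': "\<And>x. x \<in> interior I \<Longrightarrow> (s has_real_derivative g' x) (at x)" and
    g'': "\<And>x. x \<in> interior I \<Longrightarrow> (g' has_real_derivative g'' x) (at x)" and
    c: "continuous_on (interior I) g'" "continuous_on (interior I) g''"
    using scale_C2 unfolding C2_on_def by (metis at_within_open open_interior)
  have 1: "deriv s x = g' x" if "x \<in> interior I" for x
    using g'[OF that] by (rule DERIV_imp_deriv)
  have 2: "(deriv s has_real_derivative g'' x) (at x)" if "x \<in> interior I" for x
    by (rule has_field_derivative_transform_within_open[OF g''[OF that] open_interior that])
      (simp add: 1)
  have 3: "deriv (deriv s) x = g'' x" if "x \<in> interior I" for x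
    using 2[OF that] by (rule DERIV_imp_deriv)
  show "y \<in> interior I \<Longrightarrow> (deriv s has_real_derivative deriv (deriv s) y) (at y)"
    using 2 3 by simp
  show "continuous_on (interior I) (deriv s)"
    using c(1) 1 by (simp cong: continuous_on_cong)
  show "continuous_on (interior I) (deriv (deriv s))"
    using c(2) 3 by (simp cong: continuous_on_cong)
qed

text \<open>\<open>psi\<close> is the quotient rule for \<open>g1 / deriv s\<close>. The open set
  \<open>S\<close> is needed because the generator differentiates \<open>deriv g\<close>, which must
  agree with \<open>g1\<close> near \<open>y\<close> and not only at \<open>y\<close>.\<close>

lemma generator_eq:
  assumes y: "y \<in> interior I" and S: "open S" "y \<in> S"
    and g: "\<And>z. z \<in> S \<Longrightarrow> (g has_real_derivative g1 z) (at z)"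
    and g1: "(g1 has_real_derivative d2) (at y)"
  shows "generator \<rho> s g y = psi (g1 y) d2 y / \<rho> y"
proof -
  have "((\<lambda>z. 1 / deriv s z * g1 z) has_real_derivative psi (g1 y) d2 y) (at y)"
    using scale_deriv_pos[OF y]
    by (auto intro!: derivative_eq_intros scale_derivs(1)[OF y] g1
        simp: psi_def field_simps power2_eq_square)
  then have "((\<lambda>z. 1 / deriv s z * deriv g z) has_real_derivative psi (g1 y) d2 y) (at y)"
    by (rule has_field_derivative_transform_within_open[OF _ S])
      (simp add: DERIV_imp_deriv[OF g])
  then show ?thesis
    unfolding generator_def by (simp add: DERIV_imp_deriv)
qed

lemma generator_zero:
  assumes S: "open S" "y \<in> S" and g: "\<And>z. z \<in> S \<Longrightarrow> g z = 0"
  shows "generator \<rho> s g y = 0"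
proof -
  have "(g has_real_derivative 0) (at z)" if "z \<in> S" for z
    by (rule has_field_derivative_transform_within_open[OF DERIV_const S(1) that]) (simp add: g)
  then have "deriv g z = 0" if "z \<in> S" for z
    using that by (simp add: DERIV_imp_deriv)
  then have "((\<lambda>z. 1 / deriv s z * deriv g z) has_real_derivative 0) (at y)"
    by (intro has_field_derivative_transform_within_open[OF DERIV_const S]) simp
  then show ?thesis
    unfolding generator_def by (simp add: DERIV_imp_deriv)
qed

text \<open>The density \<open>\<rho>\<close> may be arbitrarily close to zero on \<open>K\<close>; it cancels against the
  speed measure as soon as the time is bounded away from zero.\<close>

lemma inverse_speed_bound:
  assumes x: "x \<in> I" and a: "0 < a" and K: "compact K" "K \<subseteq> interior I"
  obtains B where "0 \<le> B"
    "\<And>v. v \<in> {a..b} \<Longrightarrow> (\<integral>\<^sup>+\<omega>. ennreal (indicator K (X v \<omega>) / rhoI (X v \<omega>)) \<partial>P x) \<le> ennreal B"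
proof -
  have "continuous_on ({a..b} \<times> {x} \<times> K) (\<lambda>(t, x, y). q t x y)"
    using K a x by (intro continuous_on_subset[OF q_continuous]) (auto dest: interior_subset_I)
  moreover have "compact ({a..b} \<times> {x} \<times> K)"
    by (intro compact_Times K) auto
  ultimately have "bounded ((\<lambda>(t, x, y). q t x y) ` ({a..b} \<times> {x} \<times> K))"
    by (intro compact_imp_bounded compact_continuous_image)
  then obtain C where C: "\<forall>z\<in>(\<lambda>(t, x, y). q t x y) ` ({a..b} \<times> {x} \<times> K). norm z \<le> C"
    unfolding bounded_iff by blast
  have qC: "q t x y \<le> max C 0" if "t \<in> {a..b}" "y \<in> K" for t y
  proof -
    have "q t x y \<in> (\<lambda>(t, x, y). q t x y) ` ({a..b} \<times> {x} \<times> K)"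
      using that by (auto intro!: image_eqI[of _ _ "(t, x, y)"])
    then show ?thesis using C by force
  qed
  have Kb [measurable]: "K \<in> sets borel" using K by (simp add: borel_compact)
  define L where "L = max C 0 * measure lborel K"
  show thesis
  proof (rule that[of L])
    show "0 \<le> L" by (simp add: L_def)
    fix v assume v: "v \<in> {a..b}"
    have "(\<integral>\<^sup>+\<omega>. ennreal (indicator K (X v \<omega>) / rhoI (X v \<omega>)) \<partial>P x) =
        (\<integral>\<^sup>+y. dens v x y * ennreal (indicator K y / rhoI y) \<partial>lborel)"
      by (rule nn_integral_law) (use v a x in auto)
    also have "\<dots> \<le> (\<integral>\<^sup>+y. ennreal (max C 0) * indicator K y \<partial>lborel)"
    proof (rule nn_integral_mono)
      fix y
      show "dens v x y * ennreal (indicator K y / rhoI y) \<le> ennreal (max C 0) * indicator K y"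
      proof (cases "y \<in> K")
        case True
        then have p: "0 < rhoI y" using K by (auto intro: rhoI_pos)
        have "dens v x y * ennreal (indicator K y / rhoI y) = ennreal (qI v x y)"
          using p True by (simp add: dens_def ennreal_mult'[symmetric] qI_nonneg mult.assoc)
        also have "\<dots> \<le> ennreal (max C 0)"
          using qC[OF v True] by (intro ennreal_leI) (auto simp: qI_def)
        finally show ?thesis using True by simp
      qed simp
    qed
    also have "\<dots> = ennreal (max C 0) * emeasure lborel K"
      by (subst nn_integral_cmult) auto
    also have "\<dots> = ennreal L"
      using emeasure_compact_finite[OF K(1)]
      by (simp add: L_def ennreal_mult' emeasure_eq_ennreal_measure less_top)
    finally show "(\<integral>\<^sup>+\<omega>. ennreal (indicator K (X v \<omega>) / rhoI (X v \<omega>)) \<partial>P x) \<le> ennreal L" .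
  qed
qed

lemma continuous_on_psi:
  assumes "S \<subseteq> T \<times> interior I" "continuous_on S (\<lambda>(v, y). d1 v y)" "continuous_on S (\<lambda>(v, y). d2 v y)"
  shows "continuous_on S (\<lambda>(v, y). psi (d1 v y) (d2 v y) y)"
proof -
  have c: "continuous_on S (\<lambda>p. h (snd p))" if "continuous_on (interior I) h" for h :: "real \<Rightarrow> real"
    using assms(1) by (intro continuous_on_compose2[OF that] continuous_intros) auto
  have "deriv s (snd p) \<noteq> 0" if "p \<in> S" for p
    using assms(1) that scale_deriv_pos[of "snd p"] by force
  then show ?thesis
    using assms(2,3) unfolding psi_def case_prod_beta
    by (intro continuous_intros c scale_derivs) auto
qed

text \<open>In the formula for the generator an integral up to time \<open>0\<close> that does not converge has the junk
  value \<open>0\<close>. Started at the distribution of \<open>X a\<close> with \<open>a > 0\<close>, Fubini's theorem rules this out for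
  almost every starting point.\<close>

lemma Dynkin_conditional:
  assumes x: "x \<in> I" and a: "0 < a" and ab: "a < b" and A: "A \<in> sets (natural_filtration M X a)"
    and K: "compact K" "K \<subseteq> interior I"
    and g1: "\<And>y. (g has_real_derivative g1 y) (at y)"
    and g2: "\<And>y. (g1 has_real_derivative g2 y) (at y)"
    and g2c: "continuous_on UNIV g2"
    and g0: "\<And>y. y \<notin> K \<Longrightarrow> g y = 0"
    and k_def: "k = (\<lambda>y. indicator K y * psi (g1 y) (g2 y) y / rhoI y)"
  shows "integrable lborel (\<lambda>v. indicator {a<..b} v * (\<integral>\<omega>. indicator A \<omega> * k (X v \<omega>) \<partial>P x))"
    and "(\<integral>\<omega>. indicator A \<omega> * (g (X b \<omega>) - g (X a \<omega>)) \<partial>P x) =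
      (\<integral>v. indicator {a<..b} v * (\<integral>\<omega>. indicator A \<omega> * k (X v \<omega>) \<partial>P x) \<partial>lborel)"
proof -
  interpret prob_space "P x" using prob_space_P x .
  have sf: "sigma_finite_measure (P x)" ..
  interpret pair_sigma_finite lborel "P x" ..
  have A' [measurable]: "A \<in> sets (P x)"
    using A natural_filtration_sub[of a] a sets_P[OF x] by auto
  have Xm [measurable]: "X v \<in> borel_measurable (P x)" if "0 \<le> v" for v
    using measurable_X_P x that by auto
  have XI: "X v \<omega> \<in> I" if "\<omega> \<in> space (P x)" "0 \<le> v" for \<omega> v
    using that X_in_I x by (simp add: space_P)
  have Kb [measurable]: "K \<in> sets borel" using K by (simp add: borel_compact)
  have gc: "continuous_on UNIV g" "continuous_on UNIV g1"
    using g1 g2 by (auto intro!: continuous_at_imp_continuous_on DERIV_isCont)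
  have gm [measurable]: "g \<in> borel_measurable borel"
    using gc by (simp add: borel_measurable_continuous_onI)
  have pc: "continuous_on K (\<lambda>y. psi (g1 y) (g2 y) y)"
  proof -
    have "continuous_on ((\<lambda>y. (0::real, y)) ` K) (\<lambda>(v, y). psi (g1 y) (g2 y) y)"
      using K gc g2c unfolding case_prod_beta
      by (intro continuous_on_psi[of _ UNIV "\<lambda>_. g1" "\<lambda>_. g2", unfolded case_prod_beta])
        (auto intro!: continuous_on_compose2[of UNIV _ _ snd] continuous_intros)
    then have "continuous_on K ((\<lambda>(v, y). psi (g1 y) (g2 y) y) \<circ> (\<lambda>y. (0::real, y)))"
      by (intro continuous_on_compose continuous_intros)
    then show ?thesis by (simp add: o_def)
  qed
  have pm [measurable]: "(\<lambda>y. indicator K y * psi (g1 y) (g2 y) y) \<in> borel_measurable borel"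
    using borel_measurable_continuous_on_indicator[OF Kb pc] by simp
  have km [measurable]: "k \<in> borel_measurable borel"
    unfolding k_def by measurable
  obtain C where C: "0 \<le> C" "\<And>y. y \<in> K \<Longrightarrow> \<bar>psi (g1 y) (g2 y) y\<bar> \<le> C"
    using compact_bounded_on[OF K(1) pc] by blast
  obtain G where G: "0 \<le> G" "\<And>y. \<bar>g y\<bar> \<le> G"
  proof -
    obtain G where "0 \<le> G" "\<And>y. y \<in> K \<Longrightarrow> \<bar>g y\<bar> \<le> G"
      using compact_bounded_on[OF K(1) continuous_on_subset[OF gc(1)]] by auto
    then show thesis using that g0 by (metis abs_zero)
  qed
  obtain B where B: "0 \<le> B" "\<And>v. v \<in> {a..b} \<Longrightarrow>
      (\<integral>\<^sup>+\<omega>. ennreal (indicator K (X v \<omega>) / rhoI (X v \<omega>)) \<partial>P x) \<le> ennreal B"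
    using inverse_speed_bound[OF x a K] by blast
  have kb: "\<bar>k y\<bar> \<le> C * (indicator K y / rhoI y)" for y
    using C(2)[of y] rhoI_pos[of y] K by (auto simp: k_def indicator_def field_simps abs_mult intro: divide_right_mono)
  have nk: "(\<integral>\<^sup>+\<omega>. ennreal \<bar>k (X v \<omega>)\<bar> \<partial>P x) \<le> ennreal (C * B)" if v: "v \<in> {a..b}" for v
  proof -
    have [measurable]: "X v \<in> borel_measurable (P x)" using v a by simp
    have "(\<integral>\<^sup>+\<omega>. ennreal \<bar>k (X v \<omega>)\<bar> \<partial>P x) \<le>
        (\<integral>\<^sup>+\<omega>. ennreal C * ennreal (indicator K (X v \<omega>) / rhoI (X v \<omega>)) \<partial>P x)"
      using kb C(1) by (intro nn_integral_mono) (simp add: ennreal_mult'[symmetric] ennreal_leI)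
    also have "\<dots> = ennreal C * (\<integral>\<^sup>+\<omega>. ennreal (indicator K (X v \<omega>) / rhoI (X v \<omega>)) \<partial>P x)"
      by (rule nn_integral_cmult) measurable
    also have "\<dots> \<le> ennreal C * ennreal B"
      by (intro mult_left_mono B v) simp
    finally show ?thesis by (simp add: ennreal_mult' C(1))
  qed
  have ki: "integrable (P x) (\<lambda>\<omega>. k (X v \<omega>))" if v: "v \<in> {a..b}" for v
  proof -
    have [measurable]: "X v \<in> borel_measurable (P x)" using v a by simp
    show ?thesis
      by (rule integrableI_bounded) (use nk[OF v] in \<open>auto simp: order.strict_trans1\<close>)
  qed
  have kabs: "(\<integral>\<omega>. \<bar>k (X v \<omega>)\<bar> \<partial>P x) \<le> C * B" if v: "v \<in> {a..b}" for v
  proof -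
    have [measurable]: "X v \<in> borel_measurable (P x)" using v a by simp
    have "(\<integral>\<omega>. \<bar>k (X v \<omega>)\<bar> \<partial>P x) = enn2real (\<integral>\<^sup>+\<omega>. ennreal \<bar>k (X v \<omega>)\<bar> \<partial>P x)"
      by (rule integral_eq_nn_integral) auto
    also have "\<dots> \<le> enn2real (ennreal (C * B))"
      by (intro enn2real_mono nk v) simp
    finally show ?thesis using C(1) B(1) by simp
  qed
  define F where "F r z = (\<integral>\<omega>. k (X r \<omega>) \<partial>P z)" for r z
  \<comment> \<open>The density form of \<open>F\<close> is jointly measurable in time and starting
    point, as Fubini's theorem requires. The two agree at positive times by
    \<open>FE\<close>.\<close>
  define E where "E r z = (\<integral>y. k y * enn2real (dens r z y) \<partial>lborel)" for r z
  have FE: "F r z = E r z" if "0 < r" "z \<in> I" for r z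
    unfolding F_def E_def using integral_law[OF that km] .
  have a0: "0 \<le> a" using a by simp
  have MF: "integrable (P x) (\<lambda>\<omega>. indicator A \<omega> * F r (X a \<omega>))"
    "(\<integral>\<omega>. indicator A \<omega> * k (X (a + r) \<omega>) \<partial>P x) = (\<integral>\<omega>. indicator A \<omega> * F r (X a \<omega>) \<partial>P x)"
    "(\<integral>\<omega>. \<bar>indicator A \<omega> * F r (X a \<omega>)\<bar> \<partial>P x) \<le> C * B"
    if r: "0 < r" "r \<le> b - a" for r
  proof -
    have i: "integrable (P x) (\<lambda>\<omega>. k (X (a + r) \<omega>))" using r by (intro ki) auto
    show MF1: "integrable (P x) (\<lambda>\<omega>. indicator A \<omega> * F r (X a \<omega>))"
      "(\<integral>\<omega>. indicator A \<omega> * k (X (a + r) \<omega>) \<partial>P x) = (\<integral>\<omega>. indicator A \<omega> * F r (X a \<omega>) \<partial>P x)"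
      unfolding F_def by (rule Markov_integral[OF x a0 A r(1) km i])+
    have am: "(\<lambda>y. \<bar>k y\<bar>) \<in> borel_measurable borel" by measurable
    have ai: "integrable (P x) (\<lambda>\<omega>. \<bar>k (X (a + r) \<omega>)\<bar>)" using i by (rule integrable_abs)
    \<comment> \<open>After the triangle inequality for the inner integral, the Markov property for
      the absolute value leads back to the law of \<open>X (a + r)\<close> under \<open>P x\<close>,
      for which \<open>kabs\<close> gives a bound independent of \<open>r\<close>.\<close>
    note AM = Markov_integral[OF x a0 A r(1) am ai]
    have "(\<integral>\<omega>. \<bar>indicator A \<omega> * F r (X a \<omega>)\<bar> \<partial>P x) \<le>
        (\<integral>\<omega>. indicator A \<omega> * (\<integral>\<omega>'. \<bar>k (X r \<omega>')\<bar> \<partial>P (X a \<omega>)) \<partial>P x)"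
      by (rule integral_mono[OF integrable_abs[OF MF1(1)] AM(1)])
        (auto simp: F_def abs_mult indicator_def)
    also have "\<dots> = (\<integral>\<omega>. indicator A \<omega> * \<bar>k (X (a + r) \<omega>)\<bar> \<partial>P x)"
      using AM(2) by simp
    also have "\<dots> \<le> (\<integral>\<omega>. \<bar>k (X (a + r) \<omega>)\<bar> \<partial>P x)"
      using integrable_mult_indicator[OF A' ai] ai
      by (intro integral_mono) (auto simp: indicator_def)
    also have "\<dots> \<le> C * B" using r by (intro kabs) auto
    finally show "(\<integral>\<omega>. \<bar>indicator A \<omega> * F r (X a \<omega>)\<bar> \<partial>P x) \<le> C * B" .
  qed
  define \<Phi> where "\<Phi> r \<omega> = indicator {0<..b - a} r * (indicator A \<omega> * F r (X a \<omega>))" for r \<omega>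
  have \<Phi>E: "\<Phi> r \<omega> = indicator {0<..b - a} r * (indicator A \<omega> * E r (X a \<omega>))" if "\<omega> \<in> space (P x)" for r \<omega>
    using FE[OF _ XI[OF that a0]] by (auto simp: \<Phi>_def indicator_def)
  have [measurable]: "X a \<in> borel_measurable (P x)" "X b \<in> borel_measurable (P x)" using a ab by auto
  have \<Phi>m: "case_prod \<Phi> \<in> borel_measurable (lborel \<Otimes>\<^sub>M P x)"
  proof -
    have "(\<lambda>(r, \<omega>). indicator {0<..b - a} r * (indicator A \<omega> * E r (X a \<omega>))) \<in> borel_measurable (lborel \<Otimes>\<^sub>M P x)"
      unfolding E_def by measurable
    then show ?thesis
      by (subst measurable_cong[where g="\<lambda>(r, \<omega>). indicator {0<..b - a} r * (indicator A \<omega> * E r (X a \<omega>))"])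
        (auto simp: \<Phi>E space_pair_measure)
  qed
  \<comment> \<open>The uniform bound \<open>MF(3)\<close> yields a constant majorant on a bounded
    time interval; it is available because \<open>a\<close> is positive.\<close>
  have \<Phi>i: "integrable (lborel \<Otimes>\<^sub>M P x) (case_prod \<Phi>)"
  proof (rule Fubini_integrable[OF \<Phi>m])
    have im: "(\<lambda>r. \<integral>\<omega>. norm (case (r, \<omega>) of (r, \<omega>) \<Rightarrow> \<Phi> r \<omega>) \<partial>P x) \<in> borel_measurable lborel"
      using \<Phi>m by (intro sigma_finite_measure.borel_measurable_lebesgue_integral[OF sf]) (simp add: case_prod_beta)
    show "integrable lborel (\<lambda>r. \<integral>\<omega>. norm (case (r, \<omega>) of (r, \<omega>) \<Rightarrow> \<Phi> r \<omega>) \<partial>P x)"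
    proof (rule Bochner_Integration.integrable_bound[OF _ im])
      show "integrable lborel (\<lambda>r. indicator {0<..b - a} r * (C * B))"
        using ab by (intro integrable_mult_left) (auto simp: integrable_indicator_iff)
      show "AE r in lborel. norm (\<integral>\<omega>. norm (case (r, \<omega>) of (r, \<omega>) \<Rightarrow> \<Phi> r \<omega>) \<partial>P x)
          \<le> norm (indicator {0<..b - a} r * (C * B))"
        using C(1) B(1) MF(3) by (auto simp: \<Phi>_def indicator_def)
    qed
    show "AE r in lborel. integrable (P x) (\<lambda>\<omega>. case (r, \<omega>) of (r, \<omega>) \<Rightarrow> \<Phi> r \<omega>)"
      using MF(1) by (auto simp: \<Phi>_def indicator_def)
  qed
  have \<Phi>1: "(\<integral>\<omega>. \<Phi> r \<omega> \<partial>P x) = indicator {0<..b - a} r * (\<integral>\<omega>. indicator A \<omega> * k (X (a + r) \<omega>) \<partial>P x)" for r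
    using MF(2)[of r] by (auto simp: \<Phi>_def indicator_def)
  have Li: "integrable lborel (\<lambda>r. indicator {0<..b - a} r * (\<integral>\<omega>. indicator A \<omega> * k (X (a + r) \<omega>) \<partial>P x))"
    using integrable_fst'[OF \<Phi>i] by (simp add: \<Phi>1)
  \<comment> \<open>The same integrand in absolute instead of elapsed time; the factor
    \<open>1\<close> in \<open>Ls\<close> is the slope in the affine substitution rule.\<close>
  define L where "L v = indicator {a<..b} v * (\<integral>\<omega>. indicator A \<omega> * k (X v \<omega>) \<partial>P x)" for v
  have Ls: "L (a + 1 * r) = indicator {0<..b - a} r * (\<integral>\<omega>. indicator A \<omega> * k (X (a + r) \<omega>) \<partial>P x)" for r
    by (auto simp: L_def indicator_def)
  have "integrable lborel L"
    using Li lborel_integrable_real_affine_iff[of 1 L a] unfolding Ls by simp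
  then show "integrable lborel (\<lambda>v. indicator {a<..b} v * (\<integral>\<omega>. indicator A \<omega> * k (X v \<omega>) \<partial>P x))"
    by (simp add: L_def[abs_def])
  have LI: "(\<integral>v. L v \<partial>lborel) = (\<integral>r. (\<integral>\<omega>. \<Phi> r \<omega> \<partial>P x) \<partial>lborel)"
    using lborel_integral_real_affine[of 1 L a] unfolding Ls \<Phi>1 by simp
  have gX: "integrable (P x) (\<lambda>\<omega>. g (X v \<omega>))" if "0 \<le> v" for v
  proof -
    have [measurable]: "X v \<in> borel_measurable (P x)" using that by simp
    show ?thesis by (rule integrable_const_bound[of _ G]) (use G in auto)
  qed
  \<comment> \<open>Off \<open>K\<close> the function vanishes on an open set. This case also covers
    an end point belonging to \<open>I\<close>, where \<open>generator_eq\<close> does not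
    apply.\<close>
  have gen: "generator \<rho> s g y = k y" if y: "y \<in> I" for y
  proof (cases "y \<in> K")
    case True
    then have yi: "y \<in> interior I" using K by auto
    show ?thesis
      by (subst generator_eq[OF yi open_UNIV UNIV_I g1 g2]) (use True y in \<open>simp add: k_def rhoI_def\<close>)
  next
    case False
    have "generator \<rho> s g y = 0"
      by (rule generator_zero[of "- K"]) (use K False g0 in \<open>auto simp: compact_imp_closed\<close>)
    then show ?thesis using False by (simp add: k_def)
  qed
  have C2: "C2_on UNIV g"
    unfolding C2_on_def using g1 g2 gc g2c by (intro exI[of _ g1] exI[of _ g2]) auto
  have inner: "(\<integral>\<omega>'. g (X (b - a) \<omega>') \<partial>P z) = g z + (\<integral>r. indicator {0<..b - a} r * F r z \<partial>lborel)"
    if z: "z \<in> I" for z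
  proof -
    have "(\<integral>\<omega>'. g (X (b - a) \<omega>') \<partial>P z) =
      g z + (LINT r:{0..b - a}|lborel. (\<integral>\<omega>. generator \<rho> s g (X r \<omega>) \<partial>P z))"
      by (rule generator[OF z _ C2 K]) (use ab g0 in auto)
    also have "(LINT r:{0..b - a}|lborel. (\<integral>\<omega>. generator \<rho> s g (X r \<omega>) \<partial>P z)) =
        (\<integral>r. indicator {0..b - a} r * F r z \<partial>lborel)"
      unfolding set_lebesgue_integral_def F_def
    proof (intro Bochner_Integration.integral_cong refl)
      fix r
      have "(\<integral>\<omega>. generator \<rho> s g (X r \<omega>) \<partial>P z) = (\<integral>\<omega>. k (X r \<omega>) \<partial>P z)" if "0 \<le> r"
        using that z by (intro Bochner_Integration.integral_cong refl gen X_in_I) (auto simp: space_P)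
      then show "indicat_real {0..b - a} r *\<^sub>R (\<integral>\<omega>. generator \<rho> s g (X r \<omega>) \<partial>P z) =
          indicat_real {0..b - a} r * (\<integral>\<omega>. k (X r \<omega>) \<partial>P z)"
        by (auto simp: indicator_def)
    qed
    \<comment> \<open>Time 0 has to be removed because \<open>FE\<close> says nothing there; one
      point does not affect the integral, whether or not it converges.\<close>
    also have "(\<integral>r. indicator {0..b - a} r * F r z \<partial>lborel) = (\<integral>r. indicator {0<..b - a} r * F r z \<partial>lborel)"
    proof -
      have *: "(\<integral>r. indicator {0<..b - a} r * F r z \<partial>lborel) = (\<integral>r. indicator {0<..b - a} r * E r z \<partial>lborel)"
        using FE z by (intro Bochner_Integration.integral_cong) (auto simp: indicator_def)
      have Em: "(\<lambda>r. indicator {0<..b - a} r * E r z) \<in> borel_measurable lborel"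
        unfolding E_def by measurable
      have eq: "indicator {0..b - a} r * F r z = indicator {0<..b - a} r * E r z + indicator {0} r * F 0 z" for r
        using FE[of r z] z ab by (auto simp: indicator_def)
      have "(\<integral>r. indicator {0..b - a} r * F r z \<partial>lborel) = (\<integral>r. indicator {0<..b - a} r * E r z \<partial>lborel)"
      proof (rule integral_cong_AE[OF _ Em])
        show "(\<lambda>r. indicator {0..b - a} r * F r z) \<in> borel_measurable lborel"
          unfolding eq using Em by measurable
        show "AE r in lborel. indicator {0..b - a} r * F r z = indicator {0<..b - a} r * E r z"
          using AE_lborel_singleton[of 0] by eventually_elim (simp add: eq)
      qed
      then show ?thesis using * by simp
    qed
    finally show ?thesis .
  qed
  have ba: "0 < b - a" using ab by simp
  have "(\<integral>\<omega>. indicator A \<omega> * g (X b \<omega>) \<partial>P x) =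
      (\<integral>\<omega>. indicator A \<omega> * (\<integral>\<omega>'. g (X (b - a) \<omega>') \<partial>P (X a \<omega>)) \<partial>P x)"
    using Markov_integral(2)[OF x a0 A ba gm] gX[of b] a ab by simp
  also have "\<dots> = (\<integral>\<omega>. indicator A \<omega> * g (X a \<omega>) + (\<integral>r. \<Phi> r \<omega> \<partial>lborel) \<partial>P x)"
    by (intro Bochner_Integration.integral_cong refl) (auto simp: inner XI a0 \<Phi>_def indicator_def)
  also have "\<dots> = (\<integral>\<omega>. indicator A \<omega> * g (X a \<omega>) \<partial>P x) + (\<integral>\<omega>. (\<integral>r. \<Phi> r \<omega> \<partial>lborel) \<partial>P x)"
    using integrable_mult_indicator[OF A' gX[OF a0]] integrable_snd[OF \<Phi>i]
    by (intro Bochner_Integration.integral_add) auto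
  also have "(\<integral>\<omega>. (\<integral>r. \<Phi> r \<omega> \<partial>lborel) \<partial>P x) = (\<integral>v. L v \<partial>lborel)"
    unfolding LI by (rule Fubini_integral[OF \<Phi>i])
  finally show "(\<integral>\<omega>. indicator A \<omega> * (g (X b \<omega>) - g (X a \<omega>)) \<partial>P x) =
      (\<integral>v. indicator {a<..b} v * (\<integral>\<omega>. indicator A \<omega> * k (X v \<omega>) \<partial>P x) \<partial>lborel)"
    using integrable_mult_indicator[OF A' gX[OF a0]] integrable_mult_indicator[OF A' gX[of b]] a ab
    by (simp add: L_def[abs_def] right_diff_distrib Bochner_Integration.integral_diff)
qed

section \<open>Increments of functions of time and position\<close>

lemma path_continuous: "\<omega> \<in> space M \<Longrightarrow> 0 \<le> a \<Longrightarrow> continuous_on {a..b} (\<lambda>v. X v \<omega>)"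
  by (rule continuous_on_subset[OF continuous_paths]) auto

text \<open>For a function of time and position supported in \<open>K\<close>, with space
  derivatives \<open>d1\<close> and \<open>d2\<close>, this is the generator of its section at time
  \<open>v\<close>. That time is kept separate from the time at which the path is evaluated, since
  on a grid cell the function is frozen while the path moves.\<close>

definition kernel ::
    "real set \<Rightarrow> (real \<Rightarrow> real \<Rightarrow> real) \<Rightarrow> (real \<Rightarrow> real \<Rightarrow> real) \<Rightarrow> real \<Rightarrow> real \<Rightarrow> real" where
  "kernel K d1 d2 v y = indicator K y * psi (d1 v y) (d2 v y) y / rhoI y"

text \<open>The increment passes through the intermediate value
  \<open>\<phi> u (X u' \<omega>)\<close>. The change of the function at the fixed position
  \<open>X u' \<omega>\<close> is the integral of \<open>\<phi>t\<close>, by the fundamental theorem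
  of calculus and Fubini; the move of the path under the fixed function \<open>\<phi> u\<close> is
  \<open>Dynkin_conditional\<close>. Hence the final position appears in one term and the initial
  time in the other.\<close>

lemma Dynkin_step:
  assumes x: "x \<in> I" and a: "0 < a" and u: "u \<in> {a..b}" "u' \<in> {a..b}" "u < u'"
    and A: "A \<in> sets (natural_filtration M X u)"
    and K: "compact K" "K \<subseteq> interior I"
    and \<phi>t: "\<And>v y. v \<in> {a..b} \<Longrightarrow> ((\<lambda>r. \<phi> r y) has_real_derivative \<phi>t v y) (at v within {a..b})"
    and \<phi>y: "\<And>v y. v \<in> {a..b} \<Longrightarrow> (\<phi> v has_real_derivative \<phi>y v y) (at y)"
    and \<phi>yy: "\<And>v y. v \<in> {a..b} \<Longrightarrow> (\<phi>y v has_real_derivative \<phi>yy v y) (at y)"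
    and ct: "continuous_on ({a..b} \<times> UNIV) (\<lambda>(v, y). \<phi>t v y)"
    and cyy: "continuous_on ({a..b} \<times> UNIV) (\<lambda>(v, y). \<phi>yy v y)"
    and z: "\<And>v y. v \<in> {a..b} \<Longrightarrow> y \<notin> K \<Longrightarrow> \<phi> v y = 0"
    and Ct: "\<And>v y. v \<in> {a..b} \<Longrightarrow> \<bar>\<phi>t v y\<bar> \<le> Ct"
    and C0: "\<And>v y. v \<in> {a..b} \<Longrightarrow> \<bar>\<phi> v y\<bar> \<le> C0"
    and ki: "\<And>v. v \<in> {a..b} \<Longrightarrow> integrable (P x) (\<lambda>\<omega>. kernel K \<phi>y \<phi>yy u (X v \<omega>))"
  shows "integrable lborel (\<lambda>v. indicator {u<..u'} v *
      (\<integral>\<omega>. indicator A \<omega> * (\<phi>t v (X u' \<omega>) + kernel K \<phi>y \<phi>yy u (X v \<omega>)) \<partial>P x))"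
    and "(\<integral>\<omega>. indicator A \<omega> * (\<phi> u' (X u' \<omega>) - \<phi> u (X u \<omega>)) \<partial>P x) =
      (\<integral>v. indicator {u<..u'} v *
        (\<integral>\<omega>. indicator A \<omega> * (\<phi>t v (X u' \<omega>) + kernel K \<phi>y \<phi>yy u (X v \<omega>)) \<partial>P x) \<partial>lborel)"
proof -
  interpret prob_space "P x" using prob_space_P x .
  have sf: "sigma_finite_measure (P x)" ..
  interpret pair_sigma_finite lborel "P x" ..
  have u0: "0 < u" "0 < u'" "0 \<le> u" "0 \<le> u'" using a u by auto
  have A' [measurable]: "A \<in> sets (P x)"
    using A natural_filtration_sub[of u] u0 sets_P[OF x] by auto
  have [measurable]: "X u \<in> borel_measurable (P x)" "X u' \<in> borel_measurable (P x)"
    using measurable_X_P x u0 by auto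
  have cyyu: "continuous_on UNIV (\<phi>yy v)" if "v \<in> {a..b}" for v
    using that by (intro continuous_on_compose2[OF cyy, of UNIV "\<lambda>y. (v, y)", simplified] continuous_intros) auto
  have "\<phi> v \<in> borel_measurable borel" if "v \<in> {a..b}" for v
    using DERIV_isCont[OF \<phi>y[OF that]]
    by (intro borel_measurable_continuous_onI continuous_at_imp_continuous_on) blast
  then have [measurable]: "\<phi> u \<in> borel_measurable borel" "\<phi> u' \<in> borel_measurable borel"
    using u by auto
  have i\<phi>: "integrable (P x) (\<lambda>\<omega>. \<phi> u' (X u' \<omega>))" "integrable (P x) (\<lambda>\<omega>. \<phi> u (X u' \<omega>))"
    "integrable (P x) (\<lambda>\<omega>. \<phi> u (X u \<omega>))"
    by (rule integrable_const_bound[of _ C0]; use C0 u in auto)+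
  have iA: "integrable (P x) (\<lambda>\<omega>. indicator A \<omega> * h \<omega>)" if "integrable (P x) h" for h :: "_ \<Rightarrow> real"
    using integrable_mult_indicator[OF A' that] by simp
  have tm: "(\<lambda>p. indicator ({a..b} \<times> UNIV) p * (case p of (v, y) \<Rightarrow> \<phi>t v y)) \<in> borel_measurable borel"
    using borel_measurable_continuous_on_indicator[OF _ ct] by (simp add: borel_closed closed_Times)
  define \<Theta> where "\<Theta> v \<omega> = indicator {u<..u'} v * (indicator A \<omega> * \<phi>t v (X u' \<omega>))" for v \<omega>
  have \<Theta>m: "case_prod \<Theta> \<in> borel_measurable (lborel \<Otimes>\<^sub>M P x)"
  proof -
    have "(\<lambda>p. (fst p, X u' (snd p))) \<in> lborel \<Otimes>\<^sub>M P x \<rightarrow>\<^sub>M borel"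
      by (intro borel_measurable_Pair) measurable
    from measurable_compose[OF this tm]
    have [measurable]: "(\<lambda>p. indicator ({a..b} \<times> UNIV) (fst p, X u' (snd p)) * \<phi>t (fst p) (X u' (snd p)))
        \<in> borel_measurable (lborel \<Otimes>\<^sub>M P x)" by simp
    have "case_prod \<Theta> = (\<lambda>p. indicator {u<..u'} (fst p) * (indicator A (snd p) *
        (indicator ({a..b} \<times> UNIV) (fst p, X u' (snd p)) * \<phi>t (fst p) (X u' (snd p)))))"
      using u by (auto simp: \<Theta>_def fun_eq_iff indicator_def)
    also have "\<dots> \<in> borel_measurable (lborel \<Otimes>\<^sub>M P x)" by measurable
    finally show ?thesis .
  qed
  have \<phi>tm: "(\<lambda>\<omega>. \<phi>t v (X u' \<omega>)) \<in> borel_measurable (P x)" if "v \<in> {a..b}" for v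
  proof -
    have "(\<lambda>\<omega>. (v, X u' \<omega>)) \<in> P x \<rightarrow>\<^sub>M borel" by (intro borel_measurable_Pair) measurable
    from measurable_compose[OF this tm] show ?thesis using that by simp
  qed
  have \<phi>ti: "integrable (P x) (\<lambda>\<omega>. \<phi>t v (X u' \<omega>))" if "v \<in> {a..b}" for v
    by (rule integrable_const_bound[of _ Ct]) (use Ct \<phi>tm that in auto)
  have \<Theta>i: "integrable (lborel \<Otimes>\<^sub>M P x) (case_prod \<Theta>)"
  proof (rule Fubini_integrable[OF \<Theta>m])
    have im: "(\<lambda>v. \<integral>\<omega>. norm (case (v, \<omega>) of (v, \<omega>) \<Rightarrow> \<Theta> v \<omega>) \<partial>P x) \<in> borel_measurable lborel"
      using \<Theta>m by (intro sigma_finite_measure.borel_measurable_lebesgue_integral[OF sf]) (simp add: case_prod_beta)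
    have Ct0: "0 \<le> Ct" using Ct[OF u(1), of 0] by (rule order.trans[OF abs_ge_zero])
    show "integrable lborel (\<lambda>v. \<integral>\<omega>. norm (case (v, \<omega>) of (v, \<omega>) \<Rightarrow> \<Theta> v \<omega>) \<partial>P x)"
    proof (rule Bochner_Integration.integrable_bound[OF _ im])
      show "integrable lborel (\<lambda>v. indicator {u<..u'} v * Ct)"
        using u by (intro integrable_mult_left) (auto simp: integrable_indicator_iff)
      have "(\<integral>\<omega>. \<bar>\<Theta> v \<omega>\<bar> \<partial>P x) \<le> (\<integral>\<omega>. indicator {u<..u'} v * Ct \<partial>P x)" for v
      proof (cases "v \<in> {u<..u'}")
        case True
        then have v: "v \<in> {a..b}" using u by auto
        show ?thesis
          using integrable_abs[OF iA[OF \<phi>ti[OF v]]] Ct[OF v] Ct0 True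
          by (intro integral_mono) (auto simp: \<Theta>_def abs_mult indicator_def)
      qed (simp add: \<Theta>_def)
      then show "AE v in lborel. norm (\<integral>\<omega>. norm (case (v, \<omega>) of (v, \<omega>) \<Rightarrow> \<Theta> v \<omega>) \<partial>P x)
          \<le> norm (indicator {u<..u'} v * Ct)"
        using Ct0 by (simp add: prob_space)
    qed
    show "AE v in lborel. integrable (P x) (\<lambda>\<omega>. case (v, \<omega>) of (v, \<omega>) \<Rightarrow> \<Theta> v \<omega>)"
    proof (intro AE_I2)
      fix v show "integrable (P x) (\<lambda>\<omega>. case (v, \<omega>) of (v, \<omega>) \<Rightarrow> \<Theta> v \<omega>)"
        using iA[OF \<phi>ti[of v]] u by (cases "v \<in> {u<..u'}") (auto simp: \<Theta>_def)
    qed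
  qed
  have T1: "(\<integral>\<omega>. \<Theta> v \<omega> \<partial>P x) = indicator {u<..u'} v * (\<integral>\<omega>. indicator A \<omega> * \<phi>t v (X u' \<omega>) \<partial>P x)" for v
    by (simp add: \<Theta>_def)
  have ftc: "(\<integral>v. indicator {u<..u'} v * \<phi>t v y \<partial>lborel) = \<phi> u' y - \<phi> u y" for y
  proof -
    have cy: "continuous_on {u..u'} (\<lambda>v. \<phi>t v y)"
      using u by (intro continuous_on_compose2[OF ct, of "{u..u'}" "\<lambda>v. (v, y)", simplified] continuous_intros) auto
    have "(\<integral>v. indicator {u..u'} v *\<^sub>R \<phi>t v y \<partial>lborel) = \<phi> u' y - \<phi> u y"
    proof (rule integral_FTC_Icc[where F="\<lambda>v. \<phi> v y"])
      fix v assume "u \<le> v" "v \<le> u'"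
      then have "((\<lambda>r. \<phi> r y) has_real_derivative \<phi>t v y) (at v within {u..u'})"
        using u by (intro DERIV_subset[OF \<phi>t]) auto
      then show "((\<lambda>r. \<phi> r y) has_vector_derivative \<phi>t v y) (at v within {u..u'})"
        by (simp add: has_real_derivative_iff_has_vector_derivative)
    qed (use u cy in auto)
    moreover have "(\<integral>v. indicator {u<..u'} v * \<phi>t v y \<partial>lborel) = (\<integral>v. indicator {u..u'} v *\<^sub>R \<phi>t v y \<partial>lborel)"
    proof (rule integral_cong_AE)
      have *: "(\<lambda>v. indicator {u..u'} v *\<^sub>R \<phi>t v y) \<in> borel_measurable lborel"
        using borel_measurable_continuous_on_indicator[OF _ cy] by simp
      then show "(\<lambda>v. indicator {u..u'} v *\<^sub>R \<phi>t v y) \<in> borel_measurable lborel" .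
      have "(\<lambda>v. indicator {u<..u'} v * (indicator {u..u'} v *\<^sub>R \<phi>t v y)) \<in> borel_measurable lborel"
        using * by measurable
      also have "(\<lambda>v. indicator {u<..u'} v * (indicator {u..u'} v *\<^sub>R \<phi>t v y)) = (\<lambda>v. indicator {u<..u'} v * \<phi>t v y)"
        by (auto simp: fun_eq_iff indicator_def)
      finally show "(\<lambda>v. indicator {u<..u'} v * \<phi>t v y) \<in> borel_measurable lborel" .
      show "AE v in lborel. indicator {u<..u'} v * \<phi>t v y = indicator {u..u'} v *\<^sub>R \<phi>t v y"
        using AE_lborel_singleton[of u] by eventually_elim (auto simp: indicator_def)
    qed
    ultimately show ?thesis by simp
  qed
  have T2: "(\<integral>v. \<Theta> v \<omega> \<partial>lborel) = indicator A \<omega> * (\<phi> u' (X u' \<omega>) - \<phi> u (X u' \<omega>))" for \<omega>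
    using ftc[of "X u' \<omega>"] by (auto simp: \<Theta>_def indicator_def)
  have time: "(\<integral>\<omega>. indicator A \<omega> * (\<phi> u' (X u' \<omega>) - \<phi> u (X u' \<omega>)) \<partial>P x) =
      (\<integral>v. indicator {u<..u'} v * (\<integral>\<omega>. indicator A \<omega> * \<phi>t v (X u' \<omega>) \<partial>P x) \<partial>lborel)"
    using Fubini_integral[OF \<Theta>i] by (simp add: T1 T2)
  have timei: "integrable lborel (\<lambda>v. indicator {u<..u'} v * (\<integral>\<omega>. indicator A \<omega> * \<phi>t v (X u' \<omega>) \<partial>P x))"
    using integrable_fst'[OF \<Theta>i] by (simp add: T1)
  have kdef: "kernel K \<phi>y \<phi>yy u = (\<lambda>y. indicator K y * psi (\<phi>y u y) (\<phi>yy u y) y / rhoI y)"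
    by (simp add: kernel_def fun_eq_iff)
  note D = Dynkin_conditional[OF x u0(1) u(3) A K \<phi>y[OF u(1)] \<phi>yy[OF u(1)] cyyu[OF u(1)] z[OF u(1)] kdef]
  have split: "indicator {u<..u'} v * (\<integral>\<omega>. indicator A \<omega> * (\<phi>t v (X u' \<omega>) + kernel K \<phi>y \<phi>yy u (X v \<omega>)) \<partial>P x) =
      indicator {u<..u'} v * (\<integral>\<omega>. indicator A \<omega> * \<phi>t v (X u' \<omega>) \<partial>P x) +
      indicator {u<..u'} v * (\<integral>\<omega>. indicator A \<omega> * kernel K \<phi>y \<phi>yy u (X v \<omega>) \<partial>P x)" for v
  proof (cases "v \<in> {u<..u'}")
    case True
    then have v: "v \<in> {a..b}" using u by auto
    show ?thesis
      using iA[OF \<phi>ti[OF v]] iA[OF ki[OF v]]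
      by (simp add: distrib_left Bochner_Integration.integral_add)
  qed simp
  show "integrable lborel (\<lambda>v. indicator {u<..u'} v *
      (\<integral>\<omega>. indicator A \<omega> * (\<phi>t v (X u' \<omega>) + kernel K \<phi>y \<phi>yy u (X v \<omega>)) \<partial>P x))"
    unfolding split by (intro Bochner_Integration.integrable_add timei D(1))
  have "(\<integral>\<omega>. indicator A \<omega> * (\<phi> u' (X u' \<omega>) - \<phi> u (X u \<omega>)) \<partial>P x) =
      (\<integral>\<omega>. indicator A \<omega> * (\<phi> u' (X u' \<omega>) - \<phi> u (X u' \<omega>)) + indicator A \<omega> * (\<phi> u (X u' \<omega>) - \<phi> u (X u \<omega>)) \<partial>P x)"
    by (intro Bochner_Integration.integral_cong) (auto simp: algebra_simps)
  also have "\<dots> = (\<integral>\<omega>. indicator A \<omega> * (\<phi> u' (X u' \<omega>) - \<phi> u (X u' \<omega>)) \<partial>P x) +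
      (\<integral>\<omega>. indicator A \<omega> * (\<phi> u (X u' \<omega>) - \<phi> u (X u \<omega>)) \<partial>P x)"
    by (intro Bochner_Integration.integral_add iA Bochner_Integration.integrable_diff i\<phi>)
  also have "\<dots> = (\<integral>v. indicator {u<..u'} v *
        (\<integral>\<omega>. indicator A \<omega> * (\<phi>t v (X u' \<omega>) + kernel K \<phi>y \<phi>yy u (X v \<omega>)) \<partial>P x) \<partial>lborel)"
    using D(2) by (simp add: time split Bochner_Integration.integral_add[OF timei D(1)])
  finally show "(\<integral>\<omega>. indicator A \<omega> * (\<phi> u' (X u' \<omega>) - \<phi> u (X u \<omega>)) \<partial>P x) =
      (\<integral>v. indicator {u<..u'} v *
        (\<integral>\<omega>. indicator A \<omega> * (\<phi>t v (X u' \<omega>) + kernel K \<phi>y \<phi>yy u (X v \<omega>)) \<partial>P x) \<partial>lborel)" .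
qed

end

section \<open>Exit times along grids\<close>

text \<open>Inserting \<open>b\<close> caps the exit time at \<open>b\<close> and keeps the infimum
  away from the empty set.\<close>

definition exit_time :: "(real \<times> real) set \<Rightarrow> (real \<Rightarrow> real) \<Rightarrow> real \<Rightarrow> real \<Rightarrow> real" where
  "exit_time C w a b = Inf (insert b {u\<in>{a..b}. (u, w u) \<notin> C})"

text \<open>For \<open>N = 0\<close> the division by zero makes every grid point equal to
  \<open>a\<close>, hence the positivity conditions on \<open>N\<close> below.\<close>

definition grid :: "real \<Rightarrow> real \<Rightarrow> nat \<Rightarrow> nat \<Rightarrow> real" where
  "grid a b N k = a + (b - a) * real k / real N"

lemma grid_0 [simp]: "grid a b N 0 = a"
  by (simp add: grid_def)

lemma grid_N: "0 < N \<Longrightarrow> grid a b N N = b"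
  by (simp add: grid_def)

lemma grid_mono: "a < b \<Longrightarrow> i \<le> j \<Longrightarrow> grid a b N i \<le> grid a b N j"
  unfolding grid_def by (intro add_left_mono divide_right_mono mult_left_mono) auto

lemma grid_less: "a < b \<Longrightarrow> 0 < N \<Longrightarrow> i < j \<Longrightarrow> grid a b N i < grid a b N j"
  unfolding grid_def by (intro add_strict_left_mono divide_strict_right_mono mult_strict_left_mono) auto

lemma grid_Suc: "grid a b N (Suc k) = grid a b N k + (b - a) / real N"
  by (simp add: grid_def distrib_left add_divide_distrib)

lemma grid_bounds:
  assumes "a < b" "k \<le> N" "0 < N"
  shows "a \<le> grid a b N k" "grid a b N k \<le> b"
  using grid_mono[OF assms(1), of 0 k N] grid_mono[OF assms(1), of k N N] assms
  by (auto simp: grid_N)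

lemma grid_index:
  assumes "a < b" "0 < N" "a < v" "v \<le> b"
  obtains k where "k < N" "grid a b N k < v" "v \<le> grid a b N (Suc k)"
proof -
  define k where "k = (LEAST k. v \<le> grid a b N k)"
  have N: "v \<le> grid a b N N" using assms by (simp add: grid_N)
  have k: "v \<le> grid a b N k" "k \<le> N" unfolding k_def using N by (auto intro: LeastI Least_le)
  have "k \<noteq> 0"
  proof
    assume "k = 0"
    then show False using k(1) assms(3) by simp
  qed
  then obtain j where j: "k = Suc j" by (cases k) auto
  have "\<not> v \<le> grid a b N j"
    using not_less_Least[of j "\<lambda>k. v \<le> grid a b N k"] j by (simp add: k_def)
  then show thesis using that[of j] k j by simp
qed

lemma grid_index_unique:
  assumes "a < b" "0 < N" "grid a b N k < v" "v \<le> grid a b N (Suc k)"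
    "grid a b N j < v" "v \<le> grid a b N (Suc j)"
  shows "j = k"
proof (rule ccontr)
  assume "j \<noteq> k"
  then have "Suc j \<le> k \<or> Suc k \<le> j" by arith
  then have "grid a b N (Suc j) \<le> grid a b N k \<or> grid a b N (Suc k) \<le> grid a b N j"
    using grid_mono[OF assms(1)] by blast
  then show False using assms by auto
qed

text \<open>The complement of \<open>C\<close> is open and the path is continuous. This is what lets
  finite grids detect an exit.\<close>

lemma path_off_closed:
  assumes w: "continuous_on {a..b} w" and C: "closed C" and e: "e \<in> {a..b}" "(e, w e) \<notin> C"
  obtains \<eta> :: real where "0 < \<eta>" "\<And>v. v \<in> {a..b} \<Longrightarrow> \<bar>v - e\<bar> < \<eta> \<Longrightarrow> (v, w v :: real) \<notin> C"
proof -
  have "continuous_on {a..b} (\<lambda>v. (v, w v))" by (intro continuous_intros w)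
  then have "((\<lambda>v. (v, w v)) \<longlongrightarrow> (e, w e)) (at e within {a..b})"
    using e by (auto simp: continuous_on_def)
  then have "\<forall>\<^sub>F v in at e within {a..b}. (v, w v) \<in> - C"
    using C e by (intro topological_tendstoD) auto
  then obtain \<eta> where "0 < \<eta>" "\<forall>v\<in>{a..b}. v \<noteq> e \<and> dist v e < \<eta> \<longrightarrow> (v, w v) \<in> - C"
    unfolding eventually_at by blast
  then show thesis using e by (intro that[of \<eta>]) (auto simp: dist_real_def)
qed

text \<open>The last grid point before \<open>e\<close> is at most one mesh width away, and the mesh
  tends to 0. Staying on the left of \<open>e\<close> matters when \<open>e\<close> is to be
  compared with a later time.\<close>

lemma grid_hits:
  assumes ab: "a < b" and e: "e \<in> {a..b}" and \<eta>: "0 < \<eta>"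
  shows "\<forall>\<^sub>F N in sequentially. \<exists>k\<le>N. 0 < N \<and> \<bar>grid a b N k - e\<bar> < \<eta> \<and> grid a b N k \<le> e"
proof -
  have "(\<lambda>N. (b - a) / real N) \<longlonglongrightarrow> 0"
    by (intro tendsto_divide_0[OF tendsto_const] filterlim_at_top_imp_at_infinity filterlim_real_sequentially)
  then have "\<forall>\<^sub>F N in sequentially. (b - a) / real N < \<eta>"
    using \<eta> by (rule order_tendstoD)
  then show ?thesis
    using eventually_gt_at_top[of 0]
  proof eventually_elim
    case (elim N)
    show ?case
    proof (cases "e = a")
      \<comment> \<open>\<open>grid_index\<close> needs a point strictly beyond \<open>a\<close>;
        for \<open>e = a\<close> the first grid point itself serves.\<close>
      case True
      then show ?thesis using \<eta> elim by (intro exI[of _ 0]) auto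
    next
      case False
      then obtain k where "k < N" "grid a b N k < e" "e \<le> grid a b N (Suc k)"
        using grid_index[OF ab elim(2), of e] e by auto
      then show ?thesis
        using elim by (intro exI[of _ k]) (auto simp: grid_Suc)
    qed
  qed
qed

section \<open>Exit times from closed sets\<close>

lemma exit_time_bounds:
  assumes "a \<le> b"
  shows "a \<le> exit_time C w a b" "exit_time C w a b \<le> b"
  unfolding exit_time_def
  by (rule cInf_greatest) (use assms in \<open>auto intro!: cInf_lower bdd_belowI[of _ a]\<close>)

lemma exit_time_le:
  assumes "u \<in> {a..b}" "(u, w u) \<notin> C"
  shows "exit_time C w a b \<le> u"
  unfolding exit_time_def by (rule cInf_lower) (use assms in \<open>auto intro!: bdd_belowI[of _ a]\<close>)

lemma before_exit_time:
  assumes "u \<in> {a..b}" "u < exit_time C w a b"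
  shows "(u, w u) \<in> C"
  using exit_time_le[of u a b w C] assms by auto

text \<open>Among the indices below \<open>N\<close>, the condition on all \<open>j \<le> k\<close>
  selects those before the first failure \<open>m\<close>, and what remains telescopes. Admitting
  \<open>N\<close> itself in the definition of \<open>m\<close> provides a value when there is no
  failure.\<close>

lemma stopped_sum_eq:
  fixes \<Psi> :: "nat \<Rightarrow> real" and G :: "nat \<Rightarrow> bool" and N :: nat
  defines "m \<equiv> LEAST k. N \<le> k \<or> \<not> G k"
  shows "(\<Sum>k<N. if \<forall>j\<le>k. G j then \<Psi> (Suc k) - \<Psi> k else 0) = \<Psi> (m) - \<Psi> 0"
    and "m \<le> N" and "m = N \<or> \<not> G (m)"
proof -
  show mN: "m \<le> N" unfolding m_def by (rule Least_le) simp
  have before: "G k" if "k < m" for k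
    using not_less_Least[of k "\<lambda>k. N \<le> k \<or> \<not> G k"] that by (auto simp: m_def)
  show at_m: "m = N \<or> \<not> G (m)"
    using LeastI[of "\<lambda>k. N \<le> k \<or> \<not> G k" N] mN by (auto simp: m_def)
  have "(\<Sum>k<N. if \<forall>j\<le>k. G j then \<Psi> (Suc k) - \<Psi> k else 0) = (\<Sum>k<m. \<Psi> (Suc k) - \<Psi> k)"
  proof (rule sum.mono_neutral_cong_right)
    show "\<forall>k\<in>{..<N} - {..<m}. (if \<forall>j\<le>k. G j then \<Psi> (Suc k) - \<Psi> k else 0) = 0"
      using at_m by auto
    fix k assume "k \<in> {..<m}"
    then have "\<forall>j\<le>k. G j" using before by auto
    then show "(if \<forall>j\<le>k. G j then \<Psi> (Suc k) - \<Psi> k else 0) = \<Psi> (Suc k) - \<Psi> k" by simp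
  qed (use mN in auto)
  then show "(\<Sum>k<N. if \<forall>j\<le>k. G j then \<Psi> (Suc k) - \<Psi> k else 0) = \<Psi> (m) - \<Psi> 0"
    by (simp add: sum_lessThan_telescope)
qed

text \<open>The sum stops at the first grid point outside \<open>C\<close>, which cannot precede the
  exit time. Conversely, each time outside \<open>C\<close> has a neighbourhood of such times, so a
  fine grid has a point outside \<open>C\<close> no later than it; such times exist arbitrarily
  close to the exit time unless the cap \<open>b\<close> is reached.\<close>

lemma stopped_sum_limit:
  fixes w :: "real \<Rightarrow> real" and \<Psi> :: "real \<Rightarrow> real"
  assumes ab: "a < b" and w: "continuous_on {a..b} w" and C: "closed C"
    and \<Psi>: "continuous_on {a..b} \<Psi>"
  shows "(\<lambda>N. \<Sum>k<N. if \<forall>j\<le>k. (grid a b N j, w (grid a b N j)) \<in> C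
      then \<Psi> (grid a b N (Suc k)) - \<Psi> (grid a b N k) else 0)
    \<longlonglongrightarrow> \<Psi> (exit_time C w a b) - \<Psi> a"
proof -
  define \<sigma> where "\<sigma> = exit_time C w a b"
  define G where "G v \<longleftrightarrow> (v, w v) \<in> C" for v
  define m where "m N = (LEAST k. N \<le> k \<or> \<not> G (grid a b N k))" for N
  have mN: "m N \<le> N" and at_m: "m N = N \<or> \<not> G (grid a b N (m N))" for N
    using stopped_sum_eq(2,3)[where N=N and G="\<lambda>k. G (grid a b N k)"] by (auto simp: m_def)
  have sum: "(\<Sum>k<N. if \<forall>j\<le>k. (grid a b N j, w (grid a b N j)) \<in> C
      then \<Psi> (grid a b N (Suc k)) - \<Psi> (grid a b N k) else 0) = \<Psi> (grid a b N (m N)) - \<Psi> a" for N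
    using stopped_sum_eq(1)[where N=N and G="\<lambda>k. G (grid a b N k)" and \<Psi>="\<lambda>k. \<Psi> (grid a b N k)"]
    by (simp add: m_def G_def)
  have lower: "\<sigma> \<le> grid a b N (m N)" if "0 < N" for N
    using at_m[of N]
  proof
    assume "m N = N"
    then show ?thesis using that exit_time_bounds(2)[of a b C w] ab by (simp add: grid_N \<sigma>_def)
  next
    assume "\<not> G (grid a b N (m N))"
    then show ?thesis unfolding \<sigma>_def
      using grid_bounds[OF ab mN that] by (intro exit_time_le) (auto simp: G_def)
  qed
  have lim: "(\<lambda>N. grid a b N (m N)) \<longlonglongrightarrow> \<sigma>"
  proof (rule order_tendstoI)
    fix c assume "c < \<sigma>"
    then show "\<forall>\<^sub>F N in sequentially. c < grid a b N (m N)"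
      using lower by (intro eventually_mono[OF eventually_gt_at_top[of 0]]) (auto intro: less_le_trans)
  next
    fix c assume "\<sigma> < c"
    \<comment> \<open>By definition of the infimum, something in the set defining the exit time lies
      below \<open>c\<close>: the cap or a time outside \<open>C\<close>.\<close>
    then obtain e where e: "e < c" "e = b \<or> e \<in> {a..b} \<and> \<not> G e"
      unfolding \<sigma>_def exit_time_def G_def
      by (subst (asm) cInf_less_iff) (auto intro!: bdd_belowI[of _ a] simp: ab less_imp_le)
    show "\<forall>\<^sub>F N in sequentially. grid a b N (m N) < c"
    proof (cases "e = b")
      case True
      then show ?thesis
        using e(1) grid_bounds(2)[OF ab mN]
        by (intro eventually_mono[OF eventually_gt_at_top[of 0]]) (auto intro: le_less_trans)
    next
      case False
      then have e': "e \<in> {a..b}" "\<not> G e" using e by auto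
      obtain \<eta> where \<eta>: "0 < \<eta>" "\<And>v. v \<in> {a..b} \<Longrightarrow> \<bar>v - e\<bar> < \<eta> \<Longrightarrow> \<not> G v"
        using path_off_closed[OF w C e'(1)] e'(2) by (auto simp: G_def)
      show ?thesis
        using grid_hits[OF ab e'(1) \<eta>(1)]
      proof eventually_elim
        case (elim N)
        then obtain k where k: "k \<le> N" "0 < N" "\<bar>grid a b N k - e\<bar> < \<eta>" "grid a b N k \<le> e" by blast
        then have "\<not> G (grid a b N k)" using grid_bounds[OF ab k(1,2)] \<eta>(2) by auto
        then have "m N \<le> k" unfolding m_def by (intro Least_le) simp
        then show ?case using grid_mono[OF ab, of "m N" k N] k(4) e(1) by linarith
      qed
    qed
  qed
  have "(\<lambda>N. \<Psi> (grid a b N (m N))) \<longlonglongrightarrow> \<Psi> \<sigma>"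
    by (rule continuous_on_tendsto_compose[OF \<Psi> lim])
      (use exit_time_bounds[of a b C w] ab grid_bounds[OF ab mN] in
        \<open>auto simp: \<sigma>_def intro!: eventually_mono[OF eventually_gt_at_top[of 0]]\<close>)
  then show ?thesis
    unfolding sum \<sigma>_def by (intro tendsto_intros)
qed

lemma grid_index_limit:
  assumes ab: "a < b" and v: "a < v" "v \<le> b"
    and \<kappa>: "\<And>N. 0 < N \<Longrightarrow> grid a b N (\<kappa> N) < v \<and> v \<le> grid a b N (Suc (\<kappa> N))"
  shows "(\<lambda>N. grid a b N (\<kappa> N)) \<longlonglongrightarrow> v" "(\<lambda>N. grid a b N (Suc (\<kappa> N))) \<longlonglongrightarrow> v"
proof -
  have h: "(\<lambda>N. (b - a) / real N) \<longlonglongrightarrow> 0"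
    by (intro tendsto_divide_0[OF tendsto_const] filterlim_at_top_imp_at_infinity filterlim_real_sequentially)
  have p: "\<forall>\<^sub>F N in sequentially. v - (b - a) / real N \<le> grid a b N (\<kappa> N)"
    "\<forall>\<^sub>F N in sequentially. grid a b N (\<kappa> N) \<le> v"
    using \<kappa> by (auto intro!: eventually_mono[OF eventually_gt_at_top[of 0]] simp: grid_Suc algebra_simps less_imp_le)
  show 1: "(\<lambda>N. grid a b N (\<kappa> N)) \<longlonglongrightarrow> v"
    by (rule tendsto_sandwich[OF p]) (use tendsto_diff[OF tendsto_const h, of v] in auto)
  show "(\<lambda>N. grid a b N (Suc (\<kappa> N))) \<longlonglongrightarrow> v"
    unfolding grid_Suc using tendsto_add[OF 1 h] by simp
qed

text \<open>If the path stays in \<open>C\<close> just after \<open>a\<close>, it is in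
  \<open>C\<close> at \<open>a\<close> as well because \<open>C\<close> is closed, and delaying the
  start slightly changes nothing. Otherwise the exit time is \<open>a\<close>, and times outside
  \<open>C\<close> arbitrarily close to \<open>a\<close> force the delayed exit times down to
  \<open>a\<close>.\<close>

lemma exit_time_limit:
  fixes w :: "real \<Rightarrow> real"
  assumes w: "continuous_on {a..b} w" and C: "closed C" and ab: "a < b"
    and \<alpha>: "\<alpha> \<longlonglongrightarrow> a" "\<And>n. a < \<alpha> n" "\<And>n. \<alpha> n \<le> (b :: real)"
  shows "(\<lambda>n. exit_time C w (\<alpha> n) b) \<longlonglongrightarrow> exit_time C w a b"
proof (cases "\<exists>\<eta>>a. \<forall>v\<in>{a<..<\<eta>} \<inter> {..b}. (v, w v) \<in> C")
  case True
  then obtain \<eta> where \<eta>: "a < \<eta>" "\<And>v. a < v \<Longrightarrow> v < \<eta> \<Longrightarrow> v \<le> b \<Longrightarrow> (v, w v) \<in> C" by auto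
  have aC: "(a, w a) \<in> C"
  proof (rule ccontr)
    assume "(a, w a) \<notin> C"
    then obtain \<epsilon> where \<epsilon>: "0 < \<epsilon>" "\<And>v. v \<in> {a..b} \<Longrightarrow> \<bar>v - a\<bar> < \<epsilon> \<Longrightarrow> (v, w v) \<notin> C"
      using path_off_closed[OF w C, of a] ab by auto
    obtain v where v: "a < v" "v < min (min \<eta> (a + \<epsilon>)) b"
      using dense[of a "min (min \<eta> (a + \<epsilon>)) b"] \<eta>(1) \<epsilon>(1) ab by auto
    then show False using \<eta>(2)[of v] \<epsilon>(2)[of v] by auto
  qed
  have "\<forall>\<^sub>F n in sequentially. \<alpha> n < \<eta>" using \<alpha>(1) \<eta>(1) by (rule order_tendstoD)
  then have "\<forall>\<^sub>F n in sequentially. exit_time C w (\<alpha> n) b = exit_time C w a b"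
  proof eventually_elim
    case (elim n)
    have "{u \<in> {\<alpha> n..b}. (u, w u) \<notin> C} = {u \<in> {a..b}. (u, w u) \<notin> C}"
      using \<eta>(2) aC elim \<alpha>(2)[of n] by (smt (verit) Collect_cong atLeastAtMost_iff)
    then show ?case by (simp add: exit_time_def)
  qed
  then show ?thesis by (rule tendsto_eventually)
next
  case False
  then have near: "\<exists>v. a < v \<and> v < \<eta> \<and> v \<le> b \<and> (v, w v) \<notin> C" if "a < \<eta>" for \<eta>
  proof -
    from False that obtain v where "v \<in> {a<..<\<eta>} \<inter> {..b}" "(v, w v) \<notin> C" by blast
    then show ?thesis by auto
  qed
  have "exit_time C w a b = a"
  proof (rule antisym)
    show "exit_time C w a b \<le> a"
    proof (rule field_le_epsilon)
      fix e :: real assume "0 < e"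
      then obtain v where "a < v" "v < a + e" "v \<le> b" "(v, w v) \<notin> C" using near[of "a + e"] by auto
      then show "exit_time C w a b \<le> a + e" using exit_time_le[of v a b w C] by auto
    qed
  qed (use exit_time_bounds ab in auto)
  moreover have "(\<lambda>n. exit_time C w (\<alpha> n) b) \<longlonglongrightarrow> a"
  proof (rule order_tendstoI)
    fix c assume "c < a"
    then show "\<forall>\<^sub>F n in sequentially. c < exit_time C w (\<alpha> n) b"
      using \<alpha>(2,3) exit_time_bounds(1)
      by (intro always_eventually allI) (meson less_le_trans less_trans)
  next
    fix c assume "a < c"
    then obtain v where v: "a < v" "v < c" "v \<le> b" "(v, w v) \<notin> C" using near[of c] by auto
    have "\<forall>\<^sub>F n in sequentially. \<alpha> n < v" using \<alpha>(1) v(1) by (rule order_tendstoD)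
    then show "\<forall>\<^sub>F n in sequentially. exit_time C w (\<alpha> n) b < c"
    proof eventually_elim
      case (elim n)
      then show ?case using exit_time_le[of v "\<alpha> n" b w C] v by auto
    qed
  qed
  ultimately show ?thesis by simp
qed

text \<open>An exit point outside the closed set would be preceded by other times outside it,
  against minimality; the exit cannot be at \<open>a\<close> in that case since the path starts
  inside.\<close>

lemma exit_in_closed:
  fixes w :: "real \<Rightarrow> real"
  assumes w: "continuous_on {a..b} w" and C: "closed C" and ab: "a \<le> b" and start: "(a, w a) \<in> C"
  shows "(exit_time C w a b, w (exit_time C w a b)) \<in> C"
proof (rule ccontr)
  define \<sigma> where "\<sigma> = exit_time C w a b"
  assume "(exit_time C w a b, w (exit_time C w a b)) \<notin> C"
  then have n: "(\<sigma>, w \<sigma>) \<notin> C" by (simp add: \<sigma>_def)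
  have \<sigma>: "\<sigma> \<in> {a..b}" using exit_time_bounds[OF ab] by (simp add: \<sigma>_def)
  obtain \<eta> where \<eta>: "0 < \<eta>" "\<And>v. v \<in> {a..b} \<Longrightarrow> \<bar>v - \<sigma>\<bar> < \<eta> \<Longrightarrow> (v, w v) \<notin> C"
    using path_off_closed[OF w C \<sigma> n] by blast
  \<comment> \<open>A time strictly before the exit, still in the interval and within the
    neighbourhood where the path is outside \<open>C\<close>.\<close>
  define v where "v = max a (\<sigma> - \<eta> / 2)"
  have "\<sigma> \<noteq> a" using n start by auto
  then have "a \<le> v" "v < \<sigma>" "\<bar>v - \<sigma>\<bar> < \<eta>" using \<sigma> \<eta>(1) by (auto simp: v_def)
  then show False
    using \<eta>(2)[of v] before_exit_time[of v a b C w] \<sigma> by (auto simp: \<sigma>_def)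
qed

section \<open>Stopping at exit times\<close>

context linear_diffusion
begin

text \<open>For a fixed time \<open>v\<close>, the integrand of the cell containing \<open>v\<close>
  tends to 0 along every path: if the path has been in \<open>C\<close> so far, its limit is the
  left-hand side of the equation at \<open>(v, X v \<omega>)\<close>; if the path has left
  \<open>C\<close>, the indicator of \<open>A\<close> is eventually 0. Dominated convergence is used
  over the paths for fixed \<open>v\<close>, and then over \<open>v\<close>.\<close>

lemma Dynkin_exit:
  assumes x: "x \<in> I" and a: "0 < a" and ab: "a < b"
    and K: "compact K" "K \<subseteq> interior I"
    and \<phi>t: "\<And>v y. v \<in> {a..b} \<Longrightarrow> ((\<lambda>r. \<phi> r y) has_real_derivative \<phi>t v y) (at v within {a..b})"
    and \<phi>y: "\<And>v y. v \<in> {a..b} \<Longrightarrow> (\<phi> v has_real_derivative \<phi>y v y) (at y)"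
    and \<phi>yy: "\<And>v y. v \<in> {a..b} \<Longrightarrow> (\<phi>y v has_real_derivative \<phi>yy v y) (at y)"
    and c: "continuous_on ({a..b} \<times> UNIV) (\<lambda>(v, y). \<phi> v y)"
    and ct: "continuous_on ({a..b} \<times> UNIV) (\<lambda>(v, y). \<phi>t v y)"
    and cy: "continuous_on ({a..b} \<times> UNIV) (\<lambda>(v, y). \<phi>y v y)"
    and cyy: "continuous_on ({a..b} \<times> UNIV) (\<lambda>(v, y). \<phi>yy v y)"
    and z: "\<And>v y. v \<in> {a..b} \<Longrightarrow> y \<notin> K \<Longrightarrow> \<phi> v y = 0"
    and zt: "\<And>v y. v \<in> {a..b} \<Longrightarrow> y \<notin> K \<Longrightarrow> \<phi>t v y = 0"
    and C: "closed C"
    and pde: "\<And>v y. v \<in> {a..b} \<Longrightarrow> (v, y) \<in> C \<Longrightarrow> y \<in> K \<Longrightarrow>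
      psi (\<phi>y v y) (\<phi>yy v y) y / rhoI y + \<phi>t v y = 0"
  shows "(\<lambda>\<omega>. \<phi> (exit_time C (\<lambda>v. X v \<omega>) a b) (X (exit_time C (\<lambda>v. X v \<omega>) a b) \<omega>)) \<in> borel_measurable (P x)"
    and "(\<integral>\<omega>. \<phi> (exit_time C (\<lambda>v. X v \<omega>) a b) (X (exit_time C (\<lambda>v. X v \<omega>) a b) \<omega>) \<partial>P x) =
      (\<integral>\<omega>. \<phi> a (X a \<omega>) \<partial>P x)"
proof -
  interpret prob_space "P x" using prob_space_P x .
  note [measurable_cong] = sets_P[OF x]
  have Xm: "X v \<in> borel_measurable (P x)" if "v \<in> {a..b}" for v
    using measurable_X_P x a that by auto
  have cK: "continuous_on ({a..b} \<times> K) h" if "continuous_on ({a..b} \<times> UNIV) h" for h :: "real \<times> real \<Rightarrow> real"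
    using that by (rule continuous_on_subset) auto
  have comp: "compact ({a..b} \<times> K)" by (intro compact_Times K) auto

  \<comment> \<open>Bounds uniform on the time interval\<close>
  obtain C0 where C0: "0 \<le> C0" "\<And>v y. v \<in> {a..b} \<Longrightarrow> \<bar>\<phi> v y\<bar> \<le> C0"
  proof -
    obtain B where "0 \<le> B" "\<And>p. p \<in> {a..b} \<times> K \<Longrightarrow> \<bar>case p of (v, y) \<Rightarrow> \<phi> v y\<bar> \<le> B"
      using compact_bounded_on[OF comp cK[OF c]] by blast
    then show thesis using z by (intro that[of B]) (metis SigmaI abs_zero case_prod_conv)+
  qed
  obtain Ct where Ct: "0 \<le> Ct" "\<And>v y. v \<in> {a..b} \<Longrightarrow> \<bar>\<phi>t v y\<bar> \<le> Ct"
  proof -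
    obtain B where "0 \<le> B" "\<And>p. p \<in> {a..b} \<times> K \<Longrightarrow> \<bar>case p of (v, y) \<Rightarrow> \<phi>t v y\<bar> \<le> B"
      using compact_bounded_on[OF comp cK[OF ct]] by blast
    then show thesis using zt by (intro that[of B]) (metis SigmaI abs_zero case_prod_conv)+
  qed
  have cpsi: "continuous_on ({a..b} \<times> K) (\<lambda>(v, y). psi (\<phi>y v y) (\<phi>yy v y) y)"
    using K by (intro continuous_on_psi[of _ UNIV] cK cy cyy) auto
  obtain C2 where C2: "0 \<le> C2" "\<And>v y. v \<in> {a..b} \<Longrightarrow> y \<in> K \<Longrightarrow> \<bar>psi (\<phi>y v y) (\<phi>yy v y) y\<bar> \<le> C2"
  proof -
    obtain B where "0 \<le> B" "\<And>p. p \<in> {a..b} \<times> K \<Longrightarrow> \<bar>case p of (v, y) \<Rightarrow> psi (\<phi>y v y) (\<phi>yy v y) y\<bar> \<le> B"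
      using compact_bounded_on[OF comp cpsi] by blast
    then show thesis by (intro that[of B]) force+
  qed
  obtain B where B: "0 \<le> B" "\<And>v. v \<in> {a..b} \<Longrightarrow>
      (\<integral>\<^sup>+\<omega>. ennreal (indicator K (X v \<omega>) / rhoI (X v \<omega>)) \<partial>P x) \<le> ennreal B"
    using inverse_speed_bound[OF x a K] by blast
  have Kb [measurable]: "K \<in> sets borel" using K by (simp add: borel_compact)
  \<comment> \<open>The majorant of all cell integrands at time \<open>v\<close>. It may be
    unbounded, because of the inverse speed density, but its expectation is at most
    \<open>Ct + C2 * B\<close> for every \<open>v\<close>.\<close>
  define dom where "dom v \<omega> = Ct + C2 * (indicator K (X v \<omega>) / rhoI (X v \<omega>))" for v \<omega>
  have dom0: "0 \<le> dom v \<omega>" for v \<omega>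
    unfolding dom_def using Ct(1) C2(1) rhoI_pos[of "X v \<omega>"] K
    by (intro add_nonneg_nonneg mult_nonneg_nonneg) (auto simp: indicator_def less_imp_le)
  have i1: "integrable (P x) (\<lambda>\<omega>. indicator K (X v \<omega>) / rhoI (X v \<omega>))"
    "(\<integral>\<omega>. indicator K (X v \<omega>) / rhoI (X v \<omega>) \<partial>P x) \<le> B" if v: "v \<in> {a..b}" for v
  proof -
    have [measurable]: "X v \<in> borel_measurable (P x)" using Xm v .
    have nn: "0 \<le> indicator K (X v \<omega>) / rhoI (X v \<omega>)" for \<omega>
      using rhoI_pos K by (auto simp: indicator_def intro: less_imp_le)
    show "integrable (P x) (\<lambda>\<omega>. indicator K (X v \<omega>) / rhoI (X v \<omega>))"
      by (rule integrableI_nonneg) (use nn le_less_trans[OF B(2)[OF v]] in auto)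
    have "(\<integral>\<omega>. indicator K (X v \<omega>) / rhoI (X v \<omega>) \<partial>P x) =
        enn2real (\<integral>\<^sup>+\<omega>. ennreal (indicator K (X v \<omega>) / rhoI (X v \<omega>)) \<partial>P x)"
      by (rule integral_eq_nn_integral) (use nn in auto)
    also have "\<dots> \<le> enn2real (ennreal B)" by (intro enn2real_mono B v) simp
    finally show "(\<integral>\<omega>. indicator K (X v \<omega>) / rhoI (X v \<omega>) \<partial>P x) \<le> B" using B by simp
  qed
  have idom: "integrable (P x) (dom v)" "(\<integral>\<omega>. dom v \<omega> \<partial>P x) \<le> Ct + C2 * B" if v: "v \<in> {a..b}" for v
  proof -
    have i2: "integrable (P x) (\<lambda>\<omega>. C2 * (indicator K (X v \<omega>) / rhoI (X v \<omega>)))"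
      by (rule integrable_mult_right[OF i1(1)[OF v]])
    show "integrable (P x) (dom v)"
      unfolding dom_def by (intro Bochner_Integration.integrable_add i2) simp
    have "(\<integral>\<omega>. dom v \<omega> \<partial>P x) = Ct + C2 * (\<integral>\<omega>. indicator K (X v \<omega>) / rhoI (X v \<omega>) \<partial>P x)"
      unfolding dom_def
      by (subst Bochner_Integration.integral_add[OF _ i2]) (simp_all add: prob_space del: times_divide_eq_right)
    then show "(\<integral>\<omega>. dom v \<omega> \<partial>P x) \<le> Ct + C2 * B"
      using mult_left_mono[OF i1(2)[OF v] C2(1)] by simp
  qed
  have kb: "\<bar>kernel K \<phi>y \<phi>yy u y\<bar> \<le> C2 * (indicator K y / rhoI y)" if "u \<in> {a..b}" for u y
  proof (cases "y \<in> K")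
    case True
    then have "0 < rhoI y" using K by (auto intro: rhoI_pos)
    then show ?thesis
      using C2(2)[OF that True] True by (simp add: kernel_def divide_right_mono)
  qed (simp add: kernel_def)
  have km: "kernel K \<phi>y \<phi>yy u \<in> borel_measurable borel" if "u \<in> {a..b}" for u
  proof -
    have "continuous_on K (\<lambda>y. psi (\<phi>y u y) (\<phi>yy u y) y)"
      using that by (intro continuous_on_compose2[OF cpsi, of K "\<lambda>y. (u, y)", simplified] continuous_intros) auto
    from borel_measurable_continuous_on_indicator[OF Kb this]
    have [measurable]: "(\<lambda>y. indicator K y * psi (\<phi>y u y) (\<phi>yy u y) y) \<in> borel_measurable borel" by simp
    show ?thesis unfolding kernel_def by measurable
  qed
  have ki: "integrable (P x) (\<lambda>\<omega>. kernel K \<phi>y \<phi>yy u (X v \<omega>))" if u: "u \<in> {a..b}" and v: "v \<in> {a..b}" for u v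
    by (rule Bochner_Integration.integrable_bound[OF integrable_mult_right[OF i1(1)[OF v], of C2]
          measurable_compose[OF Xm[OF v] km[OF u]]])
      (unfold real_norm_def, intro AE_I2 order.trans[OF kb[OF u] abs_ge_self])
  have \<phi>tm: "(\<lambda>\<omega>. \<phi>t v (X u \<omega>)) \<in> borel_measurable (P x)" if "v \<in> {a..b}" "u \<in> {a..b}" for u v
  proof -
    have "continuous_on UNIV (\<phi>t v)"
      using that by (intro continuous_on_compose2[OF ct, of UNIV "\<lambda>y. (v, y)", simplified] continuous_intros) auto
    from measurable_compose[OF Xm[OF that(2)] borel_measurable_continuous_onI[OF this]]
    show ?thesis .
  qed
  have \<phi>m: "(\<lambda>\<omega>. \<phi> v (X u \<omega>)) \<in> borel_measurable (P x)" if "v \<in> {a..b}" "u \<in> {a..b}" for u v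
  proof -
    have "continuous_on UNIV (\<phi> v)"
      using that by (intro continuous_on_compose2[OF c, of UNIV "\<lambda>y. (v, y)", simplified] continuous_intros) auto
    from measurable_compose[OF Xm[OF that(2)] borel_measurable_continuous_onI[OF this]]
    show ?thesis .
  qed

  \<comment> \<open>Telescoping along the grid\<close>
  let ?g = "grid a b"
  \<comment> \<open>The indices run up to \<open>k\<close> inclusive: the event is decided at the
    left end of the cell from \<open>k\<close> to \<open>Suc k\<close>, as
    \<open>Dynkin_step\<close> requires.\<close>
  define A where "A N k = {\<omega>\<in>space M. \<forall>j\<le>k. (?g N j, X (?g N j) \<omega>) \<in> C}" for N k
  have gI: "?g N k \<in> {a..b}" if "k \<le> N" "0 < N" for N k
    using grid_bounds[OF ab that] by simp
  have AF: "A N k \<in> sets (natural_filtration M X (?g N k))" if "k \<le> N" "0 < N" for N k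
  proof -
    have "{\<omega>\<in>space M. X (?g N j) \<omega> \<in> {y. (?g N j, y) \<in> C}} \<in> sets (natural_filtration M X (?g N k))"
      if j: "j \<le> k" for j
    proof (rule natural_filtration_X)
      show "0 \<le> ?g N j" using gI[of j N] j \<open>k \<le> N\<close> \<open>0 < N\<close> a by auto
      show "?g N j \<le> ?g N k" by (rule grid_mono[OF ab j])
      have "closed ((\<lambda>y. (?g N j, y)) -` C)"
        by (rule continuous_closed_vimage[OF C]) (auto intro!: continuous_intros)
      then show "{y. (?g N j, y) \<in> C} \<in> sets borel" by (simp add: vimage_def)
    qed
    then have "(\<Inter>j\<in>{..k}. {\<omega>\<in>space M. X (?g N j) \<omega> \<in> {y. (?g N j, y) \<in> C}}) \<in> sets (natural_filtration M X (?g N k))"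
      by (intro sets.finite_INT) auto
    also have "(\<Inter>j\<in>{..k}. {\<omega>\<in>space M. X (?g N j) \<omega> \<in> {y. (?g N j, y) \<in> C}}) = A N k"
      by (auto simp: A_def)
    finally show ?thesis .
  qed
  have A' : "A N k \<in> sets (P x)" if "k \<le> N" "0 < N" for N k
    using AF[OF that] natural_filtration_sub[of "?g N k"] gI[OF that] a sets_P[OF x] by auto
  \<comment> \<open>The time density of the contribution of cell \<open>k\<close>. At each
    \<open>v\<close> at most one summand of \<open>R\<close> differs from 0, because the cells are
    half-open and disjoint.\<close>
  define r where "r N k v = (\<integral>\<omega>. indicator (A N k) \<omega> *
      (\<phi>t v (X (?g N (Suc k)) \<omega>) + kernel K \<phi>y \<phi>yy (?g N k) (X v \<omega>)) \<partial>P x)" for N k v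
  define R where "R N v = (\<Sum>k<N. indicator {?g N k<..?g N (Suc k)} v * r N k v)" for N v
  define S where "S N \<omega> = (\<Sum>k<N. if \<forall>j\<le>k. (?g N j, X (?g N j) \<omega>) \<in> C
      then \<phi> (?g N (Suc k)) (X (?g N (Suc k)) \<omega>) - \<phi> (?g N k) (X (?g N k) \<omega>) else 0)" for N \<omega>
  define \<sigma> where "\<sigma> \<omega> = exit_time C (\<lambda>v. X v \<omega>) a b" for \<omega>
  have \<sigma>I: "\<sigma> \<omega> \<in> {a..b}" for \<omega>
    using exit_time_bounds[of a b C] ab by (simp add: \<sigma>_def)
  have SA: "S N \<omega> = (\<Sum>k<N. indicator (A N k) \<omega> * (\<phi> (?g N (Suc k)) (X (?g N (Suc k)) \<omega>) - \<phi> (?g N k) (X (?g N k) \<omega>)))"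
    if "\<omega> \<in> space M" for N \<omega>
    unfolding S_def using that by (intro sum.cong refl) (auto simp: A_def)
  have sumi: "integrable (P x) (\<lambda>\<omega>. indicator (A N k) \<omega> * (\<phi> (?g N (Suc k)) (X (?g N (Suc k)) \<omega>) - \<phi> (?g N k) (X (?g N k) \<omega>)))"
    if k: "k < N" for N k
  proof -
    have i: "integrable (P x) (\<lambda>\<omega>. \<phi> (?g N j) (X (?g N j) \<omega>))" if "j \<le> N" for j
      using that k gI[of j N] by (intro integrable_const_bound[of _ C0]) (auto intro!: \<phi>m C0 AE_I2)
    show ?thesis
      using integrable_mult_indicator[OF A'[of k N] Bochner_Integration.integrable_diff[OF i[of "Suc k"] i[of k]]] k
      by simp
  qed
  have step: "integrable lborel (\<lambda>v. indicator {?g N k<..?g N (Suc k)} v * r N k v)"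
    "(\<integral>\<omega>. indicator (A N k) \<omega> * (\<phi> (?g N (Suc k)) (X (?g N (Suc k)) \<omega>) - \<phi> (?g N k) (X (?g N k) \<omega>)) \<partial>P x) =
      (\<integral>v. indicator {?g N k<..?g N (Suc k)} v * r N k v \<partial>lborel)" if k: "k < N" for N k
    unfolding r_def
    by (rule Dynkin_step[OF x a _ _ _ AF K \<phi>t \<phi>y \<phi>yy ct cyy z Ct(2) C0(2) ki];
        use k gI[of k N] gI[of "Suc k" N] grid_less[OF ab, of N k "Suc k"] in auto)+
  have ES: "(\<integral>\<omega>. S N \<omega> \<partial>P x) = (\<integral>v. R N v \<partial>lborel)" for N
  proof -
    have "(\<integral>\<omega>. S N \<omega> \<partial>P x) = (\<integral>\<omega>. (\<Sum>k<N. indicator (A N k) \<omega> *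
        (\<phi> (?g N (Suc k)) (X (?g N (Suc k)) \<omega>) - \<phi> (?g N k) (X (?g N k) \<omega>))) \<partial>P x)"
      by (intro Bochner_Integration.integral_cong refl SA) (simp add: space_P x)
    also have "\<dots> = (\<Sum>k<N. (\<integral>\<omega>. indicator (A N k) \<omega> *
        (\<phi> (?g N (Suc k)) (X (?g N (Suc k)) \<omega>) - \<phi> (?g N k) (X (?g N k) \<omega>)) \<partial>P x))"
      by (intro Bochner_Integration.integral_sum sumi) auto
    also have "\<dots> = (\<Sum>k<N. (\<integral>v. indicator {?g N k<..?g N (Suc k)} v * r N k v \<partial>lborel))"
      by (intro sum.cong refl step) auto
    also have "\<dots> = (\<integral>v. R N v \<partial>lborel)"
      unfolding R_def by (intro Bochner_Integration.integral_sum[symmetric] step) auto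
    finally show ?thesis .
  qed
  have Sm: "S N \<in> borel_measurable (P x)" for N
  proof -
    have "(\<lambda>\<omega>. (\<Sum>k<N. indicator (A N k) \<omega> *
        (\<phi> (?g N (Suc k)) (X (?g N (Suc k)) \<omega>) - \<phi> (?g N k) (X (?g N k) \<omega>)))) \<in> borel_measurable (P x)"
      by (intro borel_measurable_sum borel_measurable_integrable[OF sumi]) auto
    then show ?thesis
      by (subst measurable_cong[OF SA]) (auto simp: space_P x)
  qed
  have Slim: "(\<lambda>N. S N \<omega>) \<longlonglongrightarrow> \<phi> (\<sigma> \<omega>) (X (\<sigma> \<omega>) \<omega>) - \<phi> a (X a \<omega>)" if \<omega>: "\<omega> \<in> space M" for \<omega>
  proof -
    have p: "continuous_on {a..b} (\<lambda>v. X v \<omega>)" by (rule path_continuous[OF \<omega>]) (use a in simp)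
    have "continuous_on {a..b} (\<lambda>v. \<phi> v (X v \<omega>))"
      by (intro continuous_on_compose2[OF c, of "{a..b}" "\<lambda>v. (v, X v \<omega>)", simplified] continuous_intros p) auto
    from stopped_sum_limit[OF ab p C this] show ?thesis
      by (simp add: S_def \<sigma>_def)
  qed
  have lm: "(\<lambda>\<omega>. \<phi> (\<sigma> \<omega>) (X (\<sigma> \<omega>) \<omega>) - \<phi> a (X a \<omega>)) \<in> borel_measurable (P x)"
    by (rule borel_measurable_LIMSEQ_real[OF _ Sm]) (use Slim in \<open>simp add: space_P x\<close>)
  have Sb: "\<bar>S N \<omega>\<bar> \<le> 2 * C0" for N \<omega>
  proof -
    define m where "m = (LEAST k. N \<le> k \<or> (?g N k, X (?g N k) \<omega>) \<notin> C)"
    have mN: "m \<le> N"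
      unfolding m_def by (rule stopped_sum_eq(2))
    have S: "S N \<omega> = \<phi> (?g N m) (X (?g N m) \<omega>) - \<phi> (?g N 0) (X (?g N 0) \<omega>)"
      using stopped_sum_eq(1)[where N=N and G="\<lambda>k. (?g N k, X (?g N k) \<omega>) \<in> C"
          and \<Psi>="\<lambda>k. \<phi> (?g N k) (X (?g N k) \<omega>)"]
      by (simp add: S_def m_def)
    show ?thesis
    proof (cases "N = 0")
      case True
      then show ?thesis using C0(1) by (simp add: S_def)
    next
      case False
      then show ?thesis
        unfolding S using C0(2)[OF gI[OF mN], of "X (?g N m) \<omega>"] C0(2)[OF gI[of 0 N], of "X (?g N 0) \<omega>"] by auto
    qed
  qed
  have lim1: "(\<lambda>N. \<integral>\<omega>. S N \<omega> \<partial>P x) \<longlonglongrightarrow> (\<integral>\<omega>. \<phi> (\<sigma> \<omega>) (X (\<sigma> \<omega>) \<omega>) - \<phi> a (X a \<omega>) \<partial>P x)"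
    by (rule integral_dominated_convergence[where w="\<lambda>_. 2 * C0"])
      (use lm Sm Sb Slim in \<open>auto simp: space_P x\<close>)

  \<comment> \<open>Limit of the time integral\<close>
  have rb: "\<bar>r N k v\<bar> \<le> Ct + C2 * B" if k: "k < N" and v: "v \<in> {a..b}" for N k v
  proof -
    have g: "?g N k \<in> {a..b}" "?g N (Suc k) \<in> {a..b}" using k gI[of k N] gI[of "Suc k" N] by auto
    have "norm (r N k v) \<le> (\<integral>\<omega>. dom v \<omega> \<partial>P x)"
      unfolding r_def
    proof (rule order.trans[OF integral_norm_bound integral_mono[OF integrable_norm idom(1)[OF v]]])
      have "integrable (P x) (\<lambda>\<omega>. \<phi>t v (X (?g N (Suc k)) \<omega>))"
        using v g by (intro integrable_const_bound[of _ Ct]) (auto intro!: \<phi>tm Ct AE_I2)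
      then have "integrable (P x) (\<lambda>\<omega>. \<phi>t v (X (?g N (Suc k)) \<omega>) + kernel K \<phi>y \<phi>yy (?g N k) (X v \<omega>))"
        by (intro Bochner_Integration.integrable_add ki g v)
      from integrable_mult_indicator[OF A'[of k N] this] k
      show "integrable (P x) (\<lambda>\<omega>. indicator (A N k) \<omega> *
        (\<phi>t v (X (?g N (Suc k)) \<omega>) + kernel K \<phi>y \<phi>yy (?g N k) (X v \<omega>)))" by simp
      fix \<omega>
      have "norm (\<phi>t v (X (?g N (Suc k)) \<omega>) + kernel K \<phi>y \<phi>yy (?g N k) (X v \<omega>)) \<le> dom v \<omega>"
        unfolding dom_def real_norm_def
        by (rule order.trans[OF abs_triangle_ineq]) (intro add_mono Ct kb v g)
      then show "norm (indicator (A N k) \<omega> *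
        (\<phi>t v (X (?g N (Suc k)) \<omega>) + kernel K \<phi>y \<phi>yy (?g N k) (X v \<omega>))) \<le> dom v \<omega>"
        by (auto simp: indicator_def dom0)
    qed
    then show ?thesis using idom(2)[OF v] by simp
  qed
  have Rk: "R N v = r N k v" if k: "k < N" "?g N k < v" "v \<le> ?g N (Suc k)" for N k v
  proof -
    have "R N v = (\<Sum>j\<in>{k}. indicator {?g N j<..?g N (Suc j)} v * r N j v)"
      unfolding R_def
    proof (rule sum.mono_neutral_right)
      show "\<forall>j\<in>{..<N} - {k}. indicator {?g N j<..?g N (Suc j)} v * r N j v = 0"
      proof
        fix j assume "j \<in> {..<N} - {k}"
        then have "v \<notin> {?g N j<..?g N (Suc j)}"
          using grid_index_unique[OF ab _ k(2,3), of j] k(1) by auto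
        then show "indicator {?g N j<..?g N (Suc j)} v * r N j v = 0" by simp
      qed
    qed (use k(1) in auto)
    then show ?thesis using k by simp
  qed
  have R0: "R N v = 0" if "v \<notin> {a<..b}" for N v
    unfolding R_def
  proof (intro sum.neutral ballI)
    fix k assume "k \<in> {..<N}"
    then have "a \<le> ?g N k" "?g N (Suc k) \<le> b" using gI[of k N] gI[of "Suc k" N] by auto
    then show "indicator {?g N k<..?g N (Suc k)} v * r N k v = 0"
      using that by (auto simp: indicator_def)
  qed
  have Rb: "\<bar>R N v\<bar> \<le> indicator {a<..b} v * (Ct + C2 * B)" for N v
  proof (cases "v \<in> {a<..b} \<and> 0 < N")
    case True
    then obtain k where "k < N" "?g N k < v" "v \<le> ?g N (Suc k)" using grid_index[OF ab, of N v] by auto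
    then show ?thesis using rb[of k N v] Rk[of k N v] True by auto
  next
    case False
    then show ?thesis using R0[of v N] Ct C2 B by (auto simp: R_def indicator_def)
  qed
  have Rlim: "(\<lambda>N. R N v) \<longlonglongrightarrow> 0" for v
  proof (cases "v \<in> {a<..b}")
    case False
    then show ?thesis using R0 by simp
  next
    case True
    then have v: "a < v" "v \<le> b" "v \<in> {a..b}" by auto
    have "\<forall>N. \<exists>k. 0 < N \<longrightarrow> k < N \<and> ?g N k < v \<and> v \<le> ?g N (Suc k)"
      using grid_index[OF ab _ v(1,2)] by metis
    then obtain \<kappa> where \<kappa>: "\<And>N. 0 < N \<Longrightarrow> \<kappa> N < N" "\<And>N. 0 < N \<Longrightarrow> ?g N (\<kappa> N) < v \<and> v \<le> ?g N (Suc (\<kappa> N))"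
      by metis
    note gl = grid_index_limit[OF ab v(1,2) \<kappa>(2)]
    have g\<kappa>: "?g N (\<kappa> N) \<in> {a..b}" "?g N (Suc (\<kappa> N)) \<in> {a..b}" if "0 < N" for N
      using gI[of "\<kappa> N" N] gI[of "Suc (\<kappa> N)" N] \<kappa>(1)[OF that] that by auto
    let ?s = "\<lambda>N \<omega>. \<phi>t v (X (?g N (Suc (\<kappa> N))) \<omega>) + kernel K \<phi>y \<phi>yy (?g N (\<kappa> N)) (X v \<omega>)"
    have pt: "(\<lambda>N. indicator (A N (\<kappa> N)) \<omega> * ?s N \<omega>) \<longlonglongrightarrow> 0" if \<omega>: "\<omega> \<in> space M" for \<omega>
    proof -
      have p: "continuous_on {a..b} (\<lambda>v. X v \<omega>)" by (rule path_continuous[OF \<omega>]) (use a in simp)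
      show ?thesis
      \<comment> \<open>Either the path left \<open>C\<close> strictly before \<open>v\<close>, and
        fine grids notice it at an index not exceeding \<open>\<kappa> N\<close>, or it was in
        \<open>C\<close> throughout and the equation is available at \<open>v\<close>.\<close>
      proof (cases "\<exists>e\<in>{a..<v}. (e, X e \<omega>) \<notin> C")
        case True
        then obtain e where e: "e \<in> {a..b}" "e < v" "(e, X e \<omega>) \<notin> C" using v by auto
        obtain \<eta> where \<eta>: "0 < \<eta>" "\<And>u. u \<in> {a..b} \<Longrightarrow> \<bar>u - e\<bar> < \<eta> \<Longrightarrow> (u, X u \<omega>) \<notin> C"
          using path_off_closed[OF p C e(1,3)] by blast
        have "\<forall>\<^sub>F N in sequentially. indicator (A N (\<kappa> N)) \<omega> * ?s N \<omega> = 0"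
          using grid_hits[OF ab e(1) \<eta>(1)]
        proof eventually_elim
          case (elim N)
          then obtain k where k: "k \<le> N" "0 < N" "\<bar>?g N k - e\<bar> < \<eta>" "?g N k \<le> e" by blast
          have "k \<le> \<kappa> N"
          proof (rule ccontr)
            assume "\<not> k \<le> \<kappa> N"
            then have "?g N (Suc (\<kappa> N)) \<le> ?g N k" by (intro grid_mono ab) auto
            then show False using \<kappa>(2)[OF k(2)] k(4) e(2) by linarith
          qed
          moreover have "(?g N k, X (?g N k) \<omega>) \<notin> C" using \<eta>(2) gI[OF k(1,2)] k(3) by blast
          ultimately have "\<omega> \<notin> A N (\<kappa> N)" by (auto simp: A_def)
          then show ?case by simp
        qed
        then show ?thesis by (rule tendsto_eventually)
      next
        case False
        \<comment> \<open>The path is in \<open>C\<close> on \<open>{a..<v}\<close>; closedness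
          carries this over to \<open>v\<close>.\<close>
        have inC: "(v, X v \<omega>) \<in> C"
        proof (rule ccontr)
          assume "(v, X v \<omega>) \<notin> C"
          then obtain \<eta> where \<eta>: "0 < \<eta>" "\<And>u. u \<in> {a..b} \<Longrightarrow> \<bar>u - v\<bar> < \<eta> \<Longrightarrow> (u, X u \<omega>) \<notin> C"
            using path_off_closed[OF p C v(3)] by blast
          have "max a (v - \<eta> / 2) \<in> {a..<v}" using v \<eta>(1) by auto
          moreover have "(max a (v - \<eta> / 2), X (max a (v - \<eta> / 2)) \<omega>) \<notin> C"
            using v \<eta>(1) by (intro \<eta>(2)) auto
          ultimately show False using False by blast
        qed
        have ev: "\<forall>\<^sub>F N in sequentially. ?g N (\<kappa> N) \<in> {a..b}"
          "\<forall>\<^sub>F N in sequentially. ?g N (Suc (\<kappa> N)) \<in> {a..b}"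
          using g\<kappa> by (auto intro!: eventually_mono[OF eventually_gt_at_top[of 0]])
        have l1: "(\<lambda>N. \<phi>t v (X (?g N (Suc (\<kappa> N))) \<omega>)) \<longlonglongrightarrow> \<phi>t v (X v \<omega>)"
        proof -
          have "continuous_on {a..b} (\<lambda>u. \<phi>t v (X u \<omega>))"
            using v(3) by (intro continuous_on_compose2[OF ct, of "{a..b}" "\<lambda>u. (v, X u \<omega>)", simplified]
                continuous_intros p) auto
          from continuous_on_tendsto_compose[OF this gl(2) v(3) ev(2)] show ?thesis .
        qed
        have l2: "(\<lambda>N. kernel K \<phi>y \<phi>yy (?g N (\<kappa> N)) (X v \<omega>)) \<longlonglongrightarrow> kernel K \<phi>y \<phi>yy v (X v \<omega>)"
        proof -
          have "(\<lambda>N. \<phi>y (?g N (\<kappa> N)) (X v \<omega>)) \<longlonglongrightarrow> \<phi>y v (X v \<omega>)"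
          proof -
            have "continuous_on {a..b} (\<lambda>u. \<phi>y u (X v \<omega>))"
              by (intro continuous_on_compose2[OF cy, of "{a..b}" "\<lambda>u. (u, X v \<omega>)", simplified] continuous_intros) auto
            from continuous_on_tendsto_compose[OF this gl(1) v(3) ev(1)] show ?thesis .
          qed
          moreover have "(\<lambda>N. \<phi>yy (?g N (\<kappa> N)) (X v \<omega>)) \<longlonglongrightarrow> \<phi>yy v (X v \<omega>)"
          proof -
            have "continuous_on {a..b} (\<lambda>u. \<phi>yy u (X v \<omega>))"
              by (intro continuous_on_compose2[OF cyy, of "{a..b}" "\<lambda>u. (u, X v \<omega>)", simplified] continuous_intros) auto
            from continuous_on_tendsto_compose[OF this gl(1) v(3) ev(1)] show ?thesis .
          qed
          ultimately show ?thesis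
            unfolding kernel_def psi_def divide_inverse by (intro tendsto_intros)
        qed
        \<comment> \<open>The equation is assumed on \<open>K\<close> only; elsewhere both terms are
          0.\<close>
        have "\<phi>t v (X v \<omega>) + kernel K \<phi>y \<phi>yy v (X v \<omega>) = 0"
          using pde[OF v(3) inC] zt[OF v(3)] by (cases "X v \<omega> \<in> K") (auto simp: kernel_def)
        then have "(\<lambda>N. ?s N \<omega>) \<longlonglongrightarrow> 0" using tendsto_add[OF l1 l2] by simp
        then show ?thesis
          by (rule Lim_null_comparison[rotated, OF tendsto_norm_zero])
            (auto simp: indicator_def)
      qed
    qed
    \<comment> \<open>The successor excludes \<open>N = 0\<close>, for which no cell contains
      \<open>v\<close>.\<close>
    have "(\<lambda>N. r (Suc N) (\<kappa> (Suc N)) v) \<longlonglongrightarrow> (\<integral>\<omega>. 0 \<partial>P x)"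
      unfolding r_def
    proof (rule integral_dominated_convergence[OF _ _ idom(1)[OF v(3)]])
      fix N
      have g: "?g (Suc N) (\<kappa> (Suc N)) \<in> {a..b}" "?g (Suc N) (Suc (\<kappa> (Suc N))) \<in> {a..b}"
        using g\<kappa> by auto
      have [measurable]: "A (Suc N) (\<kappa> (Suc N)) \<in> sets (P x)"
        using A'[of "\<kappa> (Suc N)" "Suc N"] \<kappa>(1)[of "Suc N"] by auto
      have [measurable]: "(\<lambda>\<omega>. ?s (Suc N) \<omega>) \<in> borel_measurable (P x)"
        using \<phi>tm[OF v(3) g(2)] measurable_compose[OF Xm[OF v(3)] km[OF g(1)]] by measurable
      show "(\<lambda>\<omega>. indicator (A (Suc N) (\<kappa> (Suc N))) \<omega> * ?s (Suc N) \<omega>) \<in> borel_measurable (P x)"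
        by measurable
      have "norm (?s (Suc N) \<omega>) \<le> dom v \<omega>" for \<omega>
        unfolding dom_def real_norm_def
        by (rule order.trans[OF abs_triangle_ineq]) (intro add_mono Ct kb v g)
      then show "AE \<omega> in P x. norm (indicator (A (Suc N) (\<kappa> (Suc N))) \<omega> * ?s (Suc N) \<omega>) \<le> dom v \<omega>"
        by (intro AE_I2) (auto simp: indicator_def dom0)
    next
      show "AE \<omega> in P x. (\<lambda>N. indicator (A (Suc N) (\<kappa> (Suc N))) \<omega> * ?s (Suc N) \<omega>) \<longlonglongrightarrow> 0"
        using pt by (intro AE_I2 LIMSEQ_Suc) (simp add: space_P x)
    qed simp
    then have "(\<lambda>N. R (Suc N) v) \<longlonglongrightarrow> 0"
      using Rk[of "\<kappa> (Suc N)" "Suc N" v for N] \<kappa> by simp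
    then show ?thesis by (rule LIMSEQ_imp_Suc)
  qed
  have "(\<lambda>N. \<integral>v. R N v \<partial>lborel) \<longlonglongrightarrow> (\<integral>v. 0 \<partial>(lborel :: real measure))"
  proof (rule integral_dominated_convergence[where w="\<lambda>v. indicator {a<..b} v * (Ct + C2 * B)"])
    show "R N \<in> borel_measurable lborel" for N
      unfolding R_def by (intro borel_measurable_sum borel_measurable_integrable[OF step(1)]) auto
    show "integrable lborel (\<lambda>v. indicator {a<..b} v * (Ct + C2 * B))"
      using ab by (intro integrable_mult_left) (auto simp: integrable_indicator_iff)
  qed (use Rlim Rb in auto)
  then have "(\<integral>\<omega>. \<phi> (\<sigma> \<omega>) (X (\<sigma> \<omega>) \<omega>) - \<phi> a (X a \<omega>) \<partial>P x) = 0"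
    using LIMSEQ_unique[OF lim1] by (simp add: ES)
  moreover have aI: "a \<in> {a..b}" using ab by simp
  moreover have \<phi>a: "(\<lambda>\<omega>. \<phi> a (X a \<omega>)) \<in> borel_measurable (P x)" by (rule \<phi>m[OF aI aI])
  moreover have m: "(\<lambda>\<omega>. \<phi> (\<sigma> \<omega>) (X (\<sigma> \<omega>) \<omega>)) \<in> borel_measurable (P x)"
    using borel_measurable_add[OF lm \<phi>a] by simp
  moreover have "integrable (P x) (\<lambda>\<omega>. \<phi> (\<sigma> \<omega>) (X (\<sigma> \<omega>) \<omega>))"
    by (rule integrable_const_bound[of _ C0]) (use m C0(2) \<sigma>I in auto)
  moreover have "integrable (P x) (\<lambda>\<omega>. \<phi> a (X a \<omega>))"
    by (rule integrable_const_bound[of _ C0]) (use \<phi>a C0(2) aI in auto)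
  ultimately show "(\<integral>\<omega>. \<phi> (exit_time C (\<lambda>v. X v \<omega>) a b) (X (exit_time C (\<lambda>v. X v \<omega>) a b) \<omega>) \<partial>P x) =
      (\<integral>\<omega>. \<phi> a (X a \<omega>) \<partial>P x)"
    by (simp add: Bochner_Integration.integral_diff \<sigma>_def)
  show "(\<lambda>\<omega>. \<phi> (exit_time C (\<lambda>v. X v \<omega>) a b) (X (exit_time C (\<lambda>v. X v \<omega>) a b) \<omega>)) \<in> borel_measurable (P x)"
    using m by (simp add: \<sigma>_def)
qed

text \<open>The bounds on the generator may explode as the starting time of the grid tends to 0, but
  they have already left the identity. Only the bound \<open>C0\<close> of \<open>\<phi>\<close> is
  needed for this last limit.\<close>

lemma Dynkin_exit_from_start:
  assumes x: "x \<in> I" and b: "0 < b"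
    and K: "compact K" "K \<subseteq> interior I"
    and \<phi>t: "\<And>v y. v \<in> {0..b} \<Longrightarrow> ((\<lambda>r. \<phi> r y) has_real_derivative \<phi>t v y) (at v within {0..b})"
    and \<phi>y: "\<And>v y. v \<in> {0..b} \<Longrightarrow> (\<phi> v has_real_derivative \<phi>y v y) (at y)"
    and \<phi>yy: "\<And>v y. v \<in> {0..b} \<Longrightarrow> (\<phi>y v has_real_derivative \<phi>yy v y) (at y)"
    and c: "continuous_on ({0..b} \<times> UNIV) (\<lambda>(v, y). \<phi> v y)"
    and ct: "continuous_on ({0..b} \<times> UNIV) (\<lambda>(v, y). \<phi>t v y)"
    and cy: "continuous_on ({0..b} \<times> UNIV) (\<lambda>(v, y). \<phi>y v y)"
    and cyy: "continuous_on ({0..b} \<times> UNIV) (\<lambda>(v, y). \<phi>yy v y)"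
    and z: "\<And>v y. v \<in> {0..b} \<Longrightarrow> y \<notin> K \<Longrightarrow> \<phi> v y = 0"
    and zt: "\<And>v y. v \<in> {0..b} \<Longrightarrow> y \<notin> K \<Longrightarrow> \<phi>t v y = 0"
    and C: "closed C"
    and pde: "\<And>v y. v \<in> {0..b} \<Longrightarrow> (v, y) \<in> C \<Longrightarrow> y \<in> K \<Longrightarrow>
      psi (\<phi>y v y) (\<phi>yy v y) y / rhoI y + \<phi>t v y = 0"
  shows "(\<lambda>\<omega>. \<phi> (exit_time C (\<lambda>v. X v \<omega>) 0 b) (X (exit_time C (\<lambda>v. X v \<omega>) 0 b) \<omega>)) \<in> borel_measurable (P x)"
    and "(\<integral>\<omega>. \<phi> (exit_time C (\<lambda>v. X v \<omega>) 0 b) (X (exit_time C (\<lambda>v. X v \<omega>) 0 b) \<omega>) \<partial>P x) = \<phi> 0 x"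
proof -
  interpret prob_space "P x" using prob_space_P x .
  obtain C0 where C0: "0 \<le> C0" "\<And>v y. v \<in> {0..b} \<Longrightarrow> \<bar>\<phi> v y\<bar> \<le> C0"
  proof -
    have "compact ({0..b} \<times> K)" by (intro compact_Times K) auto
    moreover have "continuous_on ({0..b} \<times> K) (\<lambda>(v, y). \<phi> v y)"
      using c by (rule continuous_on_subset) auto
    ultimately obtain B where "0 \<le> B" "\<And>p. p \<in> {0..b} \<times> K \<Longrightarrow> \<bar>case p of (v, y) \<Rightarrow> \<phi> v y\<bar> \<le> B"
      by (rule compact_bounded_on) blast
    then show thesis using z by (intro that[of B]) (metis SigmaI abs_zero case_prod_conv)+
  qed
  \<comment> \<open>With \<open>n + 2\<close> in the denominator the value is below \<open>b\<close>
    from \<open>n = 0\<close> on.\<close>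
  define \<alpha> where "\<alpha> n = b / real (n + 2)" for n
  have \<alpha>: "0 < \<alpha> n" "\<alpha> n < b" for n using b by (auto simp: \<alpha>_def field_simps intro!: add_pos_nonneg)
  have \<alpha>lim: "\<alpha> \<longlonglongrightarrow> 0"
    unfolding \<alpha>_def
    by (intro tendsto_divide_0[OF tendsto_const] filterlim_at_top_imp_at_infinity
        filterlim_compose[OF filterlim_real_sequentially] filterlim_add_const_nat_at_top)
  define \<Phi> where "\<Phi> a \<omega> = \<phi> (exit_time C (\<lambda>v. X v \<omega>) a b) (X (exit_time C (\<lambda>v. X v \<omega>) a b) \<omega>)" for a \<omega>
  have sub: "{\<alpha> n..b} \<subseteq> {0..b}" "{\<alpha> n..b} \<times> UNIV \<subseteq> {0..b} \<times> (UNIV :: real set)" for n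
    using \<alpha>(1)[of n] by auto
  have E: "\<Phi> (\<alpha> n) \<in> borel_measurable (P x)" "(\<integral>\<omega>. \<Phi> (\<alpha> n) \<omega> \<partial>P x) = (\<integral>\<omega>. \<phi> (\<alpha> n) (X (\<alpha> n) \<omega>) \<partial>P x)" for n
    unfolding \<Phi>_def
    by (rule Dynkin_exit[OF x \<alpha> K DERIV_subset[OF \<phi>t sub(1)] \<phi>y \<phi>yy continuous_on_subset[OF c sub(2)]
          continuous_on_subset[OF ct sub(2)] continuous_on_subset[OF cy sub(2)]
          continuous_on_subset[OF cyy sub(2)] z zt C pde]; use sub(1)[of n] in auto)+
  have path: "continuous_on {0..b} (\<lambda>v. X v \<omega>)" if "\<omega> \<in> space M" for \<omega>
    using path_continuous[OF that] by simp
  have cpath: "continuous_on {0..b} (\<lambda>v. \<phi> v (X v \<omega>))" if "\<omega> \<in> space M" for \<omega>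
    by (intro continuous_on_compose2[OF c, of "{0..b}" "\<lambda>v. (v, X v \<omega>)", simplified] continuous_intros path that) auto
  have lim: "(\<lambda>n. \<Phi> (\<alpha> n) \<omega>) \<longlonglongrightarrow> \<Phi> 0 \<omega>" if \<omega>: "\<omega> \<in> space M" for \<omega>
    unfolding \<Phi>_def
  proof (rule continuous_on_tendsto_compose[OF cpath[OF \<omega>]])
    show "(\<lambda>n. exit_time C (\<lambda>v. X v \<omega>) (\<alpha> n) b) \<longlonglongrightarrow> exit_time C (\<lambda>v. X v \<omega>) 0 b"
      by (rule exit_time_limit[OF path[OF \<omega>] C b \<alpha>lim]) (use \<alpha> in \<open>auto intro: less_imp_le\<close>)
    show "exit_time C (\<lambda>v. X v \<omega>) 0 b \<in> {0..b}"
      using exit_time_bounds[of 0 b] b by auto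
    show "\<forall>\<^sub>F n in sequentially. exit_time C (\<lambda>v. X v \<omega>) (\<alpha> n) b \<in> {0..b}"
    proof (intro always_eventually allI)
      fix n show "exit_time C (\<lambda>v. X v \<omega>) (\<alpha> n) b \<in> {0..b}"
        using exit_time_bounds[of "\<alpha> n" b C "\<lambda>v. X v \<omega>"] \<alpha>[of n] by auto
    qed
  qed
  show m: "(\<lambda>\<omega>. \<phi> (exit_time C (\<lambda>v. X v \<omega>) 0 b) (X (exit_time C (\<lambda>v. X v \<omega>) 0 b) \<omega>)) \<in> borel_measurable (P x)"
    by (rule borel_measurable_LIMSEQ_real[OF _ E(1)]) (use lim in \<open>simp add: space_P x \<Phi>_def\<close>)
  have \<Phi>b: "\<bar>\<Phi> a \<omega>\<bar> \<le> C0" if "0 \<le> a" "a \<le> b" for a \<omega>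
    unfolding \<Phi>_def using exit_time_bounds[OF that(2), of C "\<lambda>v. X v \<omega>"] that by (intro C0) auto
  have "(\<lambda>n. \<integral>\<omega>. \<Phi> (\<alpha> n) \<omega> \<partial>P x) \<longlonglongrightarrow> (\<integral>\<omega>. \<Phi> 0 \<omega> \<partial>P x)"
    by (rule integral_dominated_convergence[where w="\<lambda>_. C0"])
      (use m[folded \<Phi>_def] E(1) lim \<Phi>b \<alpha> in \<open>auto simp: space_P x less_imp_le\<close>)
  moreover have "(\<lambda>n. \<integral>\<omega>. \<phi> (\<alpha> n) (X (\<alpha> n) \<omega>) \<partial>P x) \<longlonglongrightarrow> (\<integral>\<omega>. \<phi> 0 x \<partial>P x)"
  proof (rule integral_dominated_convergence[where w="\<lambda>_. C0"])
    show "(\<lambda>\<omega>. \<phi> (\<alpha> n) (X (\<alpha> n) \<omega>)) \<in> borel_measurable (P x)" for n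
    proof -
      have "continuous_on UNIV (\<phi> (\<alpha> n))"
        using \<alpha>[of n] by (intro continuous_on_compose2[OF c, of UNIV "\<lambda>y. (\<alpha> n, y)", simplified] continuous_intros) auto
      from measurable_compose[OF measurable_X_P[OF x] borel_measurable_continuous_onI[OF this]]
      show ?thesis using \<alpha>(1)[of n] by simp
    qed
    show "AE \<omega> in P x. (\<lambda>n. \<phi> (\<alpha> n) (X (\<alpha> n) \<omega>)) \<longlonglongrightarrow> \<phi> 0 x"
      using start[OF x] AE_space
    proof eventually_elim
      case (elim \<omega>)
      then have \<omega>: "\<omega> \<in> space M" by (simp add: space_P x)
      have ev: "\<forall>\<^sub>F n in sequentially. \<alpha> n \<in> {0..b}"
        using \<alpha> by (intro always_eventually allI) (auto intro: less_imp_le)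
      have "0 \<in> {0..b}" using b by simp
      from continuous_on_tendsto_compose[OF cpath[OF \<omega>] \<alpha>lim this ev] show ?case
        using elim by simp
    qed
    show "AE \<omega> in P x. norm (\<phi> (\<alpha> n) (X (\<alpha> n) \<omega>)) \<le> C0" for n
      using \<alpha>[of n] by (auto intro!: AE_I2 C0)
  qed auto
  ultimately have "(\<integral>\<omega>. \<Phi> 0 \<omega> \<partial>P x) = (\<integral>\<omega>. \<phi> 0 x \<partial>P x)"
    unfolding E(2) by (rule LIMSEQ_unique)
  then show "(\<integral>\<omega>. \<phi> (exit_time C (\<lambda>v. X v \<omega>) 0 b) (X (exit_time C (\<lambda>v. X v \<omega>) 0 b) \<omega>) \<partial>P x) = \<phi> 0 x"
    by (simp add: \<Phi>_def prob_space)
qed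

end

section \<open>Cutoff functions\<close>

text \<open>The powers start at 2, so the difference quotient at 0 is
  \<open>max 0 h ^ Suc n\<close>, which tends to 0.\<close>

lemma DERIV_pos_part_power:
  "((\<lambda>z::real. max 0 z ^ Suc (Suc n)) has_real_derivative real (Suc (Suc n)) * max 0 z ^ Suc n) (at z)"
proof -
  consider "0 < z" | "z < 0" | "z = 0" by linarith
  then show ?thesis
  proof cases
    case 1
    have "((\<lambda>z::real. z ^ Suc (Suc n)) has_real_derivative real (Suc (Suc n)) * z ^ Suc n) (at z)"
      using DERIV_pow[of "Suc (Suc n)" z] by simp
    then have "((\<lambda>z::real. max 0 z ^ Suc (Suc n)) has_real_derivative real (Suc (Suc n)) * z ^ Suc n) (at z)"
      by (rule has_field_derivative_transform_within_open[where S="{0<..}"]) (use 1 in auto)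
    then show ?thesis using 1 by simp
  next
    case 2
    have "((\<lambda>z::real. max 0 z ^ Suc (Suc n)) has_real_derivative 0) (at z)"
      by (rule has_field_derivative_transform_within_open[where S="{..<0}", OF DERIV_const[of 0]]) (use 2 in auto)
    then show ?thesis using 2 by simp
  next
    case 3
    have "((\<lambda>h::real. max 0 h ^ Suc n) \<longlongrightarrow> max 0 0 ^ Suc n) (at 0)"
      by (intro tendsto_intros)
    then have "((\<lambda>h::real. max 0 h ^ Suc n) \<longlongrightarrow> 0) (at 0)" by simp
    moreover have "\<forall>\<^sub>F h in at (0::real). max 0 h ^ Suc n = (max 0 (0 + h) ^ Suc (Suc n) - max 0 0 ^ Suc (Suc n)) / h"
      by (auto simp: eventually_at_filter max_def)
    ultimately have "((\<lambda>h::real. (max 0 (0 + h) ^ Suc (Suc n) - max 0 0 ^ Suc (Suc n)) / h) \<longlongrightarrow> 0) (at 0)"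
      by (rule Lim_transform_eventually)
    then show ?thesis using 3 by (simp add: DERIV_def)
  qed
qed

text \<open>A step of class C2 from 0 on the negative axis to 1 beyond 1. The cube of the positive
  part is the lowest power that is C2; composing two of them joins the constant pieces both at 0 and
  at 1.\<close>

definition cutoff :: "real \<Rightarrow> real" where
  "cutoff z = 1 - max 0 (1 - max 0 z ^ 3) ^ 3"

definition cutoff1 :: "real \<Rightarrow> real" where
  "cutoff1 z = 9 * max 0 (1 - max 0 z ^ 3) ^ 2 * max 0 z ^ 2"

definition cutoff2 :: "real \<Rightarrow> real" where
  "cutoff2 z = 18 * max 0 (1 - max 0 z ^ 3) ^ 2 * max 0 z - 54 * max 0 (1 - max 0 z ^ 3) * max 0 z ^ 4"

lemma DERIV_pos_part: "((\<lambda>z::real. max 0 z ^ 3) has_real_derivative 3 * max 0 z ^ 2) (at z)"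
  "((\<lambda>z::real. max 0 z ^ 2) has_real_derivative 2 * max 0 z) (at z)"
  using DERIV_pos_part_power[of 1 z] DERIV_pos_part_power[of 0 z] by (simp_all add: numeral_eq_Suc)

lemma DERIV_cutoff: "(cutoff has_real_derivative cutoff1 z) (at z)"
  unfolding cutoff_def[abs_def]
  by (rule derivative_eq_intros DERIV_chain2[OF DERIV_pos_part(1)] DERIV_pos_part refl)+
    (simp add: cutoff1_def)

lemma DERIV_cutoff1: "(cutoff1 has_real_derivative cutoff2 z) (at z)"
  unfolding cutoff1_def[abs_def]
  by (rule derivative_eq_intros DERIV_chain2[OF DERIV_pos_part(2)] DERIV_pos_part refl)+
    (simp add: cutoff2_def algebra_simps power2_eq_square power4_eq_xxxx)

lemma continuous_cutoff:
  "continuous_on UNIV cutoff" "continuous_on UNIV cutoff1" "continuous_on UNIV cutoff2"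
  unfolding cutoff_def[abs_def] cutoff1_def[abs_def] cutoff2_def[abs_def]
  by (intro continuous_intros)+

lemma cutoff_nonpos:
  assumes "z \<le> 0"
  shows "cutoff z = 0" "cutoff1 z = 0" "cutoff2 z = 0"
  using assms by (simp_all add: cutoff_def cutoff1_def cutoff2_def)

lemma cutoff_ge_1:
  assumes "1 \<le> z"
  shows "cutoff z = 1" "cutoff1 z = 0" "cutoff2 z = 0"
proof -
  have "1 \<le> max 0 z ^ 3" using assms by (intro one_le_power) auto
  then have "max 0 (1 - max 0 z ^ 3) = 0" by simp
  then show "cutoff z = 1" "cutoff1 z = 0" "cutoff2 z = 0"
    by (simp_all add: cutoff_def cutoff1_def cutoff2_def)
qed

context linear_diffusion
begin

text \<open>As \<open>h\<close> is controlled on \<open>W\<close> only, it is multiplied by a cutoff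
  that equals 1 on the region of stopping. The product is defined on all positions, has compact
  support in the interior of \<open>I\<close>, and inherits the equation on that region. The random
  variable \<open>Z\<close> is the value of this product, since measurability of \<open>h\<close>
  off \<open>W\<close> is unknown.\<close>

lemma Dynkin_above_curve:
  assumes b: "0 < b" and \<delta>: "0 < \<delta>"
    and p: "\<And>v. (p has_real_derivative p' v) (at v)" and p': "continuous_on UNIV p'"
    and W: "open W" "W \<subseteq> UNIV \<times> interior I"
    and strip: "\<And>v y. 0 \<le> v \<Longrightarrow> v \<le> b \<Longrightarrow> p v \<le> y \<Longrightarrow> (v, y) \<in> W"
    and h: "\<And>v y. (v, y) \<in> W \<Longrightarrow> ((\<lambda>r. h r y) has_real_derivative ht v y) (at v)"
      "\<And>v y. (v, y) \<in> W \<Longrightarrow> (h v has_real_derivative hy v y) (at y)"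
      "\<And>v y. (v, y) \<in> W \<Longrightarrow> (hy v has_real_derivative hyy v y) (at y)"
    and hc: "continuous_on W (\<lambda>(v, y). h v y)" "continuous_on W (\<lambda>(v, y). ht v y)"
      "continuous_on W (\<lambda>(v, y). hy v y)" "continuous_on W (\<lambda>(v, y). hyy v y)"
    and pde: "\<And>v y. (v, y) \<in> W \<Longrightarrow> psi (hy v y) (hyy v y) y / rhoI y + ht v y = 0"
    and x: "p 0 + \<delta> \<le> x" "x \<le> d"
    and \<sigma>_def: "\<And>\<omega>. \<sigma> \<omega> = exit_time {(v, y). p v + \<delta> \<le> y \<and> y \<le> d} (\<lambda>v. X v \<omega>) 0 b"
  shows "\<exists>Z\<in>borel_measurable (P x). (AE \<omega> in P x. Z \<omega> = h (\<sigma> \<omega>) (X (\<sigma> \<omega>) \<omega>)) \<and> (\<integral>\<omega>. Z \<omega> \<partial>P x) = h 0 x"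
proof -
  let ?C = "{(v, y). p v + \<delta> \<le> y \<and> y \<le> d}"
  let ?l = "\<lambda>v y. (y - p v) / \<delta>" and ?u = "\<lambda>y. d + 1 - y"
  \<comment> \<open>The first factor rises from 0 to 1 between \<open>p v\<close> and
    \<open>p v + \<delta>\<close>, the second falls from 1 to 0 between \<open>d\<close> and
    \<open>d + 1\<close>.\<close>
  define c where "c v y = cutoff (?l v y) * cutoff (?u y)" for v y
  define ct where "ct v y = cutoff1 (?l v y) * (- p' v / \<delta>) * cutoff (?u y)" for v y
  define cy where "cy v y = cutoff1 (?l v y) / \<delta> * cutoff (?u y) - cutoff (?l v y) * cutoff1 (?u y)" for v y
  define cyy where "cyy v y = cutoff2 (?l v y) / \<delta>\<^sup>2 * cutoff (?u y)
    - 2 * (cutoff1 (?l v y) / \<delta> * cutoff1 (?u y)) + cutoff (?l v y) * cutoff2 (?u y)" for v y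
  have pc: "continuous_on UNIV p"
    using DERIV_isCont[OF p] by (intro continuous_at_imp_continuous_on) blast
  have dc: "((\<lambda>r. c r y) has_real_derivative ct v y) (at v)" for v y
    unfolding c_def ct_def using \<delta>
    by (auto intro!: derivative_eq_intros DERIV_chain2[OF DERIV_cutoff] p simp: field_simps)
  have dcy: "(c v has_real_derivative cy v y) (at y)" for v y
    unfolding c_def[abs_def] cy_def using \<delta>
    by (auto intro!: derivative_eq_intros DERIV_chain2[OF DERIV_cutoff] simp: field_simps)
  have dcyy: "(cy v has_real_derivative cyy v y) (at y)" for v y
    unfolding cyy_def cy_def[abs_def] using \<delta>
    by (auto intro!: derivative_eq_intros DERIV_chain2[OF DERIV_cutoff] DERIV_chain2[OF DERIV_cutoff1]
        simp: field_simps power2_eq_square)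
  have cc: "continuous_on S (\<lambda>(v, y). c v y)" "continuous_on S (\<lambda>(v, y). ct v y)"
    "continuous_on S (\<lambda>(v, y). cy v y)" "continuous_on S (\<lambda>(v, y). cyy v y)" for S
    unfolding c_def ct_def cy_def cyy_def case_prod_beta
    by (intro continuous_intros continuous_on_compose2[OF continuous_cutoff(1)]
        continuous_on_compose2[OF continuous_cutoff(2)] continuous_on_compose2[OF continuous_cutoff(3)]
        continuous_on_compose2[OF pc] continuous_on_compose2[OF p']; use \<delta> in simp)+
  have low: "c v y = 0" "ct v y = 0" "cy v y = 0" "cyy v y = 0" if "y \<le> p v" for v y
    using that \<delta> cutoff_nonpos[of "?l v y"]
    by (simp_all add: c_def ct_def cy_def cyy_def divide_le_0_iff)
  have high: "c v y = 0" "ct v y = 0" "cy v y = 0" "cyy v y = 0" if "d + 1 \<le> y" for v y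
    using that cutoff_nonpos[of "?u y"]
    by (simp_all add: c_def ct_def cy_def cyy_def)
  have mid: "c v y = 1" "ct v y = 0" "cy v y = 0" "cyy v y = 0" if "(v, y) \<in> ?C" for v y
  proof -
    have 1: "1 \<le> ?l v y" "1 \<le> ?u y" using that \<delta> by (auto simp: field_simps)
    show "c v y = 1" "ct v y = 0" "cy v y = 0" "cyy v y = 0"
      using cutoff_ge_1[OF 1(1)] cutoff_ge_1[OF 1(2)] by (simp_all add: c_def ct_def cy_def cyy_def)
  qed
  define \<phi> where "\<phi> v y = h v y * c v y" for v y
  define \<phi>t where "\<phi>t v y = ht v y * c v y + h v y * ct v y" for v y
  define \<phi>y where "\<phi>y v y = hy v y * c v y + h v y * cy v y" for v y
  define \<phi>yy where "\<phi>yy v y = hyy v y * c v y + 2 * (hy v y * cy v y) + h v y * cyy v y" for v y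
  have low': "\<phi> v y = 0" "\<phi>t v y = 0" "\<phi>y v y = 0" "\<phi>yy v y = 0" if "y \<le> p v \<or> d + 1 \<le> y" for v y
    using low[of y v] high[of y v] that by (auto simp: \<phi>_def \<phi>t_def \<phi>y_def \<phi>yy_def)
  have cover: "(v, y) \<in> W \<or> y < p v" if "v \<in> {0..b}" for v y
    using strip[of v y] that by force
  have Vopen: "open {(v, y). y < p v}"
  proof -
    have "open {q::real\<times>real. snd q < p (fst q)}"
      by (intro open_Collect_less continuous_intros continuous_on_compose2[OF pc]) auto
    also have "{q::real\<times>real. snd q < p (fst q)} = {(v, y). y < p v}" by auto
    finally show ?thesis .
  qed
  \<comment> \<open>By \<open>cover\<close>, the open set \<open>W\<close> and the open set below
    \<open>p\<close> together contain the whole strip, and the functions in question vanish on the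
    latter.\<close>
  have glue: "continuous_on ({0..b} \<times> UNIV) g"
    if "continuous_on W g" "\<And>v y. y \<le> p v \<Longrightarrow> g (v, y) = 0" for g :: "real \<times> real \<Rightarrow> real"
  proof -
    have "continuous_on {(v, y). y < p v} (\<lambda>_. 0 :: real)" by simp
    then have "continuous_on {(v, y). y < p v} g"
      by (rule continuous_on_eq) (use that(2) in auto)
    then have "continuous_on (W \<union> {(v, y). y < p v}) g"
      by (intro continuous_on_open_Un W Vopen that(1))
    then show ?thesis by (rule continuous_on_subset) (use cover in blast)
  qed
  have d1: "((\<lambda>r. \<phi> r y) has_real_derivative \<phi>t v y) (at v)" if v: "v \<in> {0..b}" for v y
    using cover[OF v, of y]
  proof
    assume "(v, y) \<in> W"
    then show ?thesis
      unfolding \<phi>_def \<phi>t_def by (auto intro!: derivative_eq_intros h dc)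
  next
    assume y: "y < p v"
    have o: "open {r. y < p r}" by (intro open_Collect_less continuous_intros pc)
    have "((\<lambda>r. \<phi> r y) has_real_derivative 0) (at v)"
      by (rule has_field_derivative_transform_within_open[OF DERIV_const[of 0] o]) (use y low'(1) in auto)
    then show ?thesis using low'(2)[of y v] y by simp
  qed
  have d2: "(\<phi> v has_real_derivative \<phi>y v y) (at y)" if v: "v \<in> {0..b}" for v y
    using cover[OF v, of y]
  proof
    assume "(v, y) \<in> W"
    then show ?thesis
      unfolding \<phi>_def[abs_def] \<phi>y_def by (auto intro!: derivative_eq_intros h dcy)
  next
    assume y: "y < p v"
    have "(\<phi> v has_real_derivative 0) (at y)"
      by (rule has_field_derivative_transform_within_open[OF DERIV_const[of 0] open_lessThan[of "p v"]])
        (use y low'(1) in auto)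
    then show ?thesis using low'(3)[of y v] y by simp
  qed
  have d3: "(\<phi>y v has_real_derivative \<phi>yy v y) (at y)" if v: "v \<in> {0..b}" for v y
    using cover[OF v, of y]
  proof
    assume "(v, y) \<in> W"
    then show ?thesis
      unfolding \<phi>y_def[abs_def] \<phi>yy_def by (auto intro!: derivative_eq_intros h dcy dcyy)
  next
    assume y: "y < p v"
    have "(\<phi>y v has_real_derivative 0) (at y)"
      by (rule has_field_derivative_transform_within_open[OF DERIV_const[of 0] open_lessThan[of "p v"]])
        (use y low'(3) in auto)
    then show ?thesis using low'(4)[of y v] y by simp
  qed
  have cont: "continuous_on ({0..b} \<times> UNIV) (\<lambda>(v, y). \<phi> v y)"
    "continuous_on ({0..b} \<times> UNIV) (\<lambda>(v, y). \<phi>t v y)"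
    "continuous_on ({0..b} \<times> UNIV) (\<lambda>(v, y). \<phi>y v y)"
    "continuous_on ({0..b} \<times> UNIV) (\<lambda>(v, y). \<phi>yy v y)"
    using hc cc[of W] low'
    by (intro glue; force simp: \<phi>_def \<phi>t_def \<phi>y_def \<phi>yy_def case_prod_beta intro!: continuous_intros)+
  \<comment> \<open>The lowest point of the curve on the time interval bounds the support from
    below; it belongs to the interior of \<open>I\<close> because \<open>W\<close> contains the
    curve.\<close>
  obtain v0 where v0: "v0 \<in> {0..b}" "\<And>v. v \<in> {0..b} \<Longrightarrow> p v0 \<le> p v"
    using continuous_attains_inf[of "{0..b}" p] continuous_on_subset[OF pc] b by auto
  define K where "K = {p v0..d + 1}"
  have K: "compact K" "K \<subseteq> interior I"
  proof -
    show "compact K" by (simp add: K_def)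
    have "p v0 \<in> interior I" using strip[of v0 "p v0"] v0(1) W(2) by auto
    then show "K \<subseteq> interior I"
      by (auto simp: K_def interior_I intro: less_le_trans)
  qed
  have zK: "\<phi> v y = 0" "\<phi>t v y = 0" if "v \<in> {0..b}" "y \<notin> K" for v y
    using low'(1,2)[of y v] v0(2)[OF that(1)] that(2) by (auto simp: K_def)
  have C: "closed ?C"
  proof -
    have "closed ({q::real\<times>real. p (fst q) + \<delta> \<le> snd q} \<inter> {q. snd q \<le> d})"
      by (intro closed_Int closed_Collect_le continuous_intros continuous_on_compose2[OF pc]) auto
    also have "{q::real\<times>real. p (fst q) + \<delta> \<le> snd q} \<inter> {q. snd q \<le> d} = ?C" by auto
    finally show ?thesis .
  qed
  have pde': "psi (\<phi>y v y) (\<phi>yy v y) y / rhoI y + \<phi>t v y = 0" if v: "v \<in> {0..b}" "(v, y) \<in> ?C" for v y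
  proof -
    have "(v, y) \<in> W" using v \<delta> by (intro strip) auto
    from pde[OF this] show ?thesis by (simp add: \<phi>t_def \<phi>y_def \<phi>yy_def mid[OF v(2)])
  qed
  have xC: "(0, x) \<in> ?C" using x by simp
  have "(0, x) \<in> W" using strip[of 0 x] b x \<delta> by simp
  then have xI: "x \<in> I" using W(2) interior_subset_I by auto
  define Z where "Z \<omega> = \<phi> (\<sigma> \<omega>) (X (\<sigma> \<omega>) \<omega>)" for \<omega>
  note D = Dynkin_exit_from_start[OF xI b K DERIV_subset[OF d1 subset_UNIV] d2 d3 cont zK C pde']
  show ?thesis
  proof (intro bexI conjI)
    show "Z \<in> borel_measurable (P x)" using D(1) by (simp add: Z_def[abs_def] \<sigma>_def)
    show "(\<integral>\<omega>. Z \<omega> \<partial>P x) = h 0 x"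
      using D(2) by (simp add: Z_def \<sigma>_def \<phi>_def mid[OF xC])
    \<comment> \<open>A path starting at \<open>x\<close> starts in the closed region, so its exit
      point is in that region too, where the cutoff is 1.\<close>
    show "AE \<omega> in P x. Z \<omega> = h (\<sigma> \<omega>) (X (\<sigma> \<omega>) \<omega>)"
      using start[OF xI] AE_space
    proof eventually_elim
      case (elim \<omega>)
      then have "\<omega> \<in> space M" by (simp add: space_P xI)
      then have "(\<sigma> \<omega>, X (\<sigma> \<omega>) \<omega>) \<in> ?C"
        unfolding \<sigma>_def using exit_in_closed[OF path_continuous C, of \<omega> 0 b] elim xC b by simp
      from mid(1)[OF this] show ?case by (simp add: Z_def \<phi>_def)
    qed
  qed
qed

end

section \<open>Curves and their life time\<close>

text \<open>A continuous function on a compact interval has a zero as soon as it takes arbitrarily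
  small values, and rational times suffice to see these. This turns the uncountable union over
  \<open>u\<close> into countable operations.\<close>

lemma sets_path_zero:
  fixes g :: "'w \<Rightarrow> real \<Rightarrow> real"
  assumes b: "0 < b" and c: "\<And>\<omega>. \<omega> \<in> space M \<Longrightarrow> continuous_on {0..b} (g \<omega>)"
    and m: "\<And>u. u \<in> {0..b} \<Longrightarrow> (\<lambda>\<omega>. g \<omega> u) \<in> borel_measurable M"
  shows "{\<omega>\<in>space M. \<exists>u\<in>{0..b}. g \<omega> u = 0} \<in> sets M"
proof -
  define D where "D = \<rat> \<inter> {0..b}"
  have D: "countable D" by (simp add: D_def countable_rat)
  have eq: "(\<exists>u\<in>{0..b}. g \<omega> u = 0) \<longleftrightarrow> (\<forall>n. \<exists>r\<in>D. \<bar>g \<omega> r\<bar> < 1 / real (Suc n))"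
    if \<omega>: "\<omega> \<in> space M" for \<omega>
  proof safe
    fix u n assume u: "u \<in> {0..b}" "g \<omega> u = 0"
    have "0 < 1 / real (Suc n)" by simp
    then obtain \<eta> where \<eta>: "0 < \<eta>" "\<And>r. r \<in> {0..b} \<Longrightarrow> dist r u < \<eta> \<Longrightarrow> dist (g \<omega> r) (g \<omega> u) < 1 / real (Suc n)"
      using c[OF \<omega>] u(1) unfolding continuous_on_iff by metis
    \<comment> \<open>A neighbourhood of \<open>u\<close> meets the open interval from 0 to
      \<open>b\<close> even if \<open>u\<close> is an end point; here \<open>0 < b\<close> is
      needed.\<close>
    have "max 0 (u - \<eta>) < min b (u + \<eta>)" using u(1) \<eta>(1) b by auto
    then obtain r where "r \<in> \<rat>" "max 0 (u - \<eta>) < r" "r < min b (u + \<eta>)"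
      using Rats_dense_in_real by blast
    then have "r \<in> D" "dist r u < \<eta>" by (auto simp: D_def dist_real_def)
    then show "\<exists>r\<in>D. \<bar>g \<omega> r\<bar> < 1 / real (Suc n)"
      using \<eta>(2)[of r] u(2) by (auto simp: D_def dist_real_def intro!: bexI[of _ r])
  next
    assume H: "\<forall>n. \<exists>r\<in>D. \<bar>g \<omega> r\<bar> < 1 / real (Suc n)"
    have "continuous_on {0..b} (\<lambda>u. \<bar>g \<omega> u\<bar>)" by (intro continuous_intros c \<omega>)
    then obtain u where u: "u \<in> {0..b}" "\<And>r. r \<in> {0..b} \<Longrightarrow> \<bar>g \<omega> u\<bar> \<le> \<bar>g \<omega> r\<bar>"
      using continuous_attains_inf[of "{0..b}" "\<lambda>u. \<bar>g \<omega> u\<bar>"] b by auto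
    have small: "\<bar>g \<omega> u\<bar> < 1 / real (Suc n)" for n
    proof -
      obtain r where "r \<in> D" "\<bar>g \<omega> r\<bar> < 1 / real (Suc n)" using H by blast
      then show ?thesis using u(2)[of r] by (auto simp: D_def)
    qed
    have "\<not> 0 < \<bar>g \<omega> u\<bar>"
    proof
      assume "0 < \<bar>g \<omega> u\<bar>"
      then obtain n where "1 / real (Suc n) < \<bar>g \<omega> u\<bar>" by (rule nat_approx_posE)
      then show False using small[of n] by simp
    qed
    then show "\<exists>u\<in>{0..b}. g \<omega> u = 0" using u(1) by auto
  qed
  have "{\<omega>\<in>space M. \<bar>g \<omega> r\<bar> < 1 / real (Suc n)} \<in> sets M" if "r \<in> D" for r n
  proof -
    have [measurable]: "(\<lambda>\<omega>. g \<omega> r) \<in> borel_measurable M" using m that by (simp add: D_def)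
    show ?thesis by measurable
  qed
  then have "{\<omega>\<in>space M. \<forall>n. \<exists>r\<in>D. \<bar>g \<omega> r\<bar> < 1 / real (Suc n)} \<in> sets M"
    by (intro sets.sets_Collect_countable_All sets.sets_Collect_countable_Ex' D)
  also have "{\<omega>\<in>space M. \<forall>n. \<exists>r\<in>D. \<bar>g \<omega> r\<bar> < 1 / real (Suc n)} = {\<omega>\<in>space M. \<exists>u\<in>{0..b}. g \<omega> u = 0}"
    using eq by blast
  finally show ?thesis .
qed

locale lower_curve =
  fixes l :: ereal and f :: "real \<Rightarrow> ereal"
  assumes f_range: "\<And>t. 0 \<le> t \<Longrightarrow> l \<le> f t \<and> f t < \<infinity>"
    and f_continuous: "continuous_on {0..} f"
begin

abbreviation "\<zeta> \<equiv> life_time l f"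

text \<open>Meant for times before \<open>\<zeta>\<close>, where \<open>f\<close> is finite;
  elsewhere \<open>real_of_ereal\<close> may return its default value 0.\<close>

definition F :: "real \<Rightarrow> real" where
  "F t = real_of_ereal (f t)"

lemma f_above:
  assumes "0 \<le> t" "ereal t < \<zeta>"
  shows "l < f t" "f t = ereal (F t)"
proof -
  have "f t \<noteq> l"
  proof
    assume "f t = l"
    then have "\<zeta> \<le> ereal t"
      unfolding life_time_def using assms(1) by (intro INF_lower) auto
    then show False using assms(2) by simp
  qed
  then show 1: "l < f t" using f_range[OF assms(1)] by (simp add: less_le)
  have "f t \<noteq> -\<infinity>" using 1 by auto
  moreover have "f t \<noteq> \<infinity>" using f_range[OF assms(1)] by auto
  ultimately show "f t = ereal (F t)" by (cases "f t") (auto simp: F_def)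
qed

lemma F_continuous: "continuous_on {t. 0 \<le> t \<and> ereal t < \<zeta>} F"
proof -
  have "continuous_on {t. 0 \<le> t \<and> ereal t < \<zeta>} (\<lambda>t. ereal (F t))"
    by (rule continuous_on_eq[OF continuous_on_subset[OF f_continuous]]) (auto simp: f_above)
  then show ?thesis
    by (simp add: continuous_on_def)
qed

lemma less_life_time_mono: "ereal t < \<zeta> \<Longrightarrow> s \<le> t \<Longrightarrow> ereal s < \<zeta>"
  by (rule le_less_trans[of _ "ereal t"]) auto

lemma above_curve_iff:
  "(t, y) \<in> above_curve l f \<longleftrightarrow> 0 < t \<and> ereal t < \<zeta> \<and> F t \<le> y"
  unfolding above_curve_def using f_above[of t] by (auto intro: less_le_trans)

lemma on_curve_iff:
  "(t, y) \<in> on_curve l f \<longleftrightarrow> 0 < t \<and> ereal t < \<zeta> \<and> y = F t"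
  unfolding on_curve_def using f_above[of t] by auto

lemma open_above: "open {(t, y). 0 < t \<and> ereal t < \<zeta> \<and> F t < y}"
proof -
  define T where "T = {t. 0 < t \<and> ereal t < \<zeta>}"
  have T: "open T"
  proof -
    have "open ({0<..} \<inter> {t. ereal t < \<zeta>})"
      by (intro open_Int open_greaterThan open_Collect_less continuous_on_ereal continuous_on_id continuous_on_const)
    also have "{0<..} \<inter> {t. ereal t < \<zeta>} = T" by (auto simp: T_def)
    finally show ?thesis .
  qed
  have "continuous_on (T \<times> UNIV) (\<lambda>p. snd p - F (fst p))"
    by (intro continuous_intros continuous_on_compose2[OF F_continuous]) (auto simp: T_def)
  then have "open ((T \<times> UNIV) \<inter> (\<lambda>p. snd p - F (fst p)) -` {0<..})"
    by (intro continuous_open_preimage open_Times T) auto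
  also have "(T \<times> UNIV) \<inter> (\<lambda>p. snd p - F (fst p)) -` {0<..} = {(t, y). 0 < t \<and> ereal t < \<zeta> \<and> F t < y}"
    by (auto simp: T_def)
  finally show ?thesis .
qed

lemma interior_above:
  assumes "0 < t" "ereal t < \<zeta>" "F t < y"
  shows "(t, y) \<in> interior (above_curve l f)"
  by (rule interiorI[OF open_above]) (use assms in \<open>auto simp: above_curve_iff\<close>)

text \<open>The infimum defining the life time is attained by continuity: otherwise \<open>f\<close>
  would stay above \<open>l\<close> up to a time beyond \<open>z\<close>.\<close>

lemma curve_at_life_time:
  assumes z: "\<zeta> = ereal z" "0 < z"
  shows "f z = l"
proof (rule ccontr)
  assume "f z \<noteq> l"
  then have "l < f z" using f_range[of z] z(2) by (simp add: less_le)
  moreover have "(f \<longlongrightarrow> f z) (at z within {0..})"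
    using f_continuous z(2) by (auto simp: continuous_on_def)
  ultimately have "\<forall>\<^sub>F t in at z within {0..}. l < f t"
    by (rule order_tendstoD[rotated])
  then obtain \<eta> where \<eta>: "0 < \<eta>" "\<And>t. t \<in> {0..} \<Longrightarrow> t \<noteq> z \<Longrightarrow> dist t z < \<eta> \<Longrightarrow> l < f t"
    unfolding eventually_at by blast
  have "ereal (z + \<eta>) \<le> \<zeta>"
    unfolding life_time_def
  proof (rule INF_greatest)
    fix t assume t: "t \<in> {t. 0 \<le> t \<and> f t = l}"
    then have "z \<le> t" using f_above(1)[of t] z(1) by force
    moreover have "t \<noteq> z" using t \<open>f z \<noteq> l\<close> by auto
    moreover have "\<not> dist t z < \<eta>" using \<eta>(2)[of t] t calculation by auto
    ultimately show "ereal (z + \<eta>) \<le> ereal t" by (auto simp: dist_real_def)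
  qed
  then show False using z(1) \<eta>(1) by simp
qed

text \<open>Since \<open>f\<close> reaches \<open>l\<close> at the life time, it finally drops below
  every level above \<open>l\<close>. This puts a fixed level into the domain of \<open>H\<close>
  for times near \<open>z\<close>.\<close>

lemma eventually_curve_below:
  assumes z: "\<zeta> = ereal z" "0 < z" and y: "l < ereal y"
  shows "\<forall>\<^sub>F t in at_left z. F t < y"
proof -
  have "(f \<longlongrightarrow> f z) (at z within {0..})"
    using f_continuous z(2) by (auto simp: continuous_on_def)
  then have "\<forall>\<^sub>F t in at z within {0..}. f t < ereal y"
    using y curve_at_life_time[OF z] by (intro order_tendstoD) auto
  then have "\<forall>\<^sub>F t in nhds z. t \<noteq> z \<longrightarrow> t \<in> {0..} \<longrightarrow> f t < ereal y"
    by (simp add: eventually_at_filter)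
  then have "\<forall>\<^sub>F t in at_left z. t \<noteq> z \<longrightarrow> t \<in> {0..} \<longrightarrow> f t < ereal y"
    by (rule filter_leD[OF at_within_le_nhds])
  moreover have "\<forall>\<^sub>F t in at_left z. t \<in> {0<..<z}"
    using z(2) by (auto simp: eventually_at_left_field)
  ultimately show ?thesis
    by eventually_elim (use f_above z(1) in \<open>auto simp: less_imp_le\<close>)
qed

text \<open>On the compact interval up to \<open>V\<close> the path keeps a positive distance from
  the curve and is bounded above. Once \<open>4 * \<epsilon> n\<close> is below that distance and
  \<open>d n\<close> above that bound, the path cannot leave the region before
  \<open>V\<close>.\<close>

lemma eventually_exit_after:
  assumes t: "0 < t" and V: "0 \<le> V" "ereal (t + V) < \<zeta>"
    and w: "continuous_on {0..V} w" "\<And>v. v \<in> {0..V} \<Longrightarrow> F (t + v) < w v"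
    and U: "\<forall>\<^sub>F n in sequentially. V \<le> U n"
    and \<epsilon>: "\<epsilon> \<longlonglongrightarrow> 0" and d: "filterlim d at_top sequentially"
    and p: "\<And>n v. v \<in> {0..U n} \<Longrightarrow> p n v + \<epsilon> n \<le> F (t + v) + 4 * \<epsilon> n"
  shows "\<forall>\<^sub>F n in sequentially. V \<le> exit_time {(v, y). p n v + \<epsilon> n \<le> y \<and> y \<le> d n} w 0 (U n)"
proof -
  have Fc: "continuous_on {0..V} (\<lambda>v. F (t + v))"
    by (intro continuous_on_compose2[OF F_continuous] continuous_intros)
      (use t V(2) in \<open>auto intro: less_life_time_mono\<close>)
  obtain v0 where v0: "v0 \<in> {0..V}" "\<And>v. v \<in> {0..V} \<Longrightarrow> w v0 - F (t + v0) \<le> w v - F (t + v)"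
    using continuous_attains_inf[OF _ _ continuous_on_diff[OF w(1) Fc]] V(1) by auto
  obtain v1 where v1: "v1 \<in> {0..V}" "\<And>v. v \<in> {0..V} \<Longrightarrow> w v \<le> w v1"
    using continuous_attains_sup[of "{0..V}" w] V(1) w(1) by auto
  \<comment> \<open>A quarter of the least distance, to match the term
    \<open>4 * \<epsilon> n\<close> in the bound on the lower edge.\<close>
  have "0 < (w v0 - F (t + v0)) / 4" using w(2)[OF v0(1)] by simp
  from order_tendstoD(2)[OF \<epsilon> this] d[unfolded filterlim_at_top, rule_format, of "w v1"] U
  show ?thesis
  proof eventually_elim
    case (elim n)
    show ?case
      unfolding exit_time_def
    proof (rule cInf_greatest)
      fix e assume e: "e \<in> insert (U n) {u \<in> {0..U n}. (u, w u) \<notin> {(v, y). p n v + \<epsilon> n \<le> y \<and> y \<le> d n}}"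
      show "V \<le> e"
      proof (rule ccontr)
        assume n: "\<not> V \<le> e"
        then have e': "e \<in> {0..V}" "e \<in> {0..U n}" "\<not> (p n e + \<epsilon> n \<le> w e \<and> w e \<le> d n)" using e elim(3) by auto
        show False using v0(2)[OF e'(1)] v1(2)[OF e'(1)] p[OF e'(2)] e'(3) elim(1,2) by auto
      qed
    qed simp
  qed
qed

lemma curve_hitting_time_finite_iff:
  assumes t: "0 < t"
  shows "curve_hitting_time X (shift t f) (\<zeta> - ereal t) \<omega> < \<infinity> \<longleftrightarrow>
    (\<exists>u\<ge>0. ereal (t + u) < \<zeta> \<and> X u \<omega> = F (t + u))"
proof -
  have le: "ereal u < \<zeta> - ereal t \<longleftrightarrow> ereal (t + u) < \<zeta>" for u
    by (cases \<zeta>) auto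
  have "curve_hitting_time X (shift t f) (\<zeta> - ereal t) \<omega> < \<infinity> \<longleftrightarrow>
      (\<exists>u\<ge>0. ereal (t + u) < \<zeta> \<and> ereal (X u \<omega>) = f (t + u))"
    by (auto simp: curve_hitting_time_def INF_less_iff le shift_def)
  also have "\<dots> \<longleftrightarrow> (\<exists>u\<ge>0. ereal (t + u) < \<zeta> \<and> X u \<omega> = F (t + u))"
    using f_above(2) t by (metis add_nonneg_nonneg ereal.inject less_imp_le)
  finally show ?thesis .
qed

lemma exhausting_times:
  assumes t: "0 < t" "ereal t < \<zeta>"
  obtains U :: "nat \<Rightarrow> real" where "\<And>n. 0 < U n" "\<And>n. ereal (t + U n) < \<zeta>"
    "\<And>V. 0 \<le> V \<Longrightarrow> ereal (t + V) < \<zeta> \<Longrightarrow> \<forall>\<^sub>F n in sequentially. V < U n"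
proof (cases \<zeta>)
  case (real z)
  \<comment> \<open>The denominator \<open>n + 2\<close> makes \<open>U n\<close> positive already
    for \<open>n = 0\<close>.\<close>
  define U where "U n = (z - t) - (z - t) / real (n + 2)" for n
  have zt: "0 < z - t" using t real by simp
  have lim: "U \<longlonglongrightarrow> (z - t) - 0"
    unfolding U_def
    by (intro tendsto_diff tendsto_const tendsto_divide_0[OF tendsto_const] filterlim_at_top_imp_at_infinity
        filterlim_compose[OF filterlim_real_sequentially] filterlim_add_const_nat_at_top)
  have "(z - t) / real (n + 2) < z - t" "0 < (z - t) / real (n + 2)" for n
    using zt by (simp_all add: divide_less_eq mult_less_cancel_left1 del: of_nat_add)
  then have "0 < U n" "U n < z - t" for n by (simp_all add: U_def)
  then show thesis
    using real order_tendstoD(1)[OF lim] by (intro that[of U]) (auto simp: algebra_simps)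
next
  case PInf
  show thesis
  proof (rule that[of "\<lambda>n. real n + 1"])
    show "\<forall>\<^sub>F n in sequentially. V < real n + 1" for V
      by (rule eventually_mono[OF eventually_ge_at_top[of "nat \<lceil>V\<rceil>"]]) linarith
  qed (use PInf in auto)
next
  case MInf
  then show thesis using t by simp
qed

text \<open>A Weierstrass polynomial within \<open>\<epsilon>\<close> of
  \<open>F + 2 * \<epsilon>\<close> is a differentiable curve that is strictly above
  \<open>F\<close> and converges to it with \<open>\<epsilon>\<close>.\<close>

lemma smooth_approximation:
  assumes t: "0 < t" and b: "ereal (t + b) < \<zeta>" and \<epsilon>: "0 < \<epsilon>"
  obtains p p' where "\<And>v. (p has_real_derivative p' v) (at v)" "continuous_on UNIV p'"
    "\<And>v. 0 \<le> v \<Longrightarrow> v \<le> b \<Longrightarrow> F (t + v) + \<epsilon> < p v \<and> p v < F (t + v) + 3 * \<epsilon>"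
proof -
  have "continuous_on {0..b} (\<lambda>v. F (t + v) + 2 * \<epsilon>)"
    by (intro continuous_intros continuous_on_compose2[OF F_continuous])
      (use t b in \<open>auto intro: less_life_time_mono\<close>)
  then obtain p where p: "real_polynomial_function p" "\<And>v. v \<in> {0..b} \<Longrightarrow> \<bar>F (t + v) + 2 * \<epsilon> - p v\<bar> < \<epsilon>"
    using Stone_Weierstrass_real_polynomial_function[of "{0..b}" _ \<epsilon>] \<epsilon> by (metis compact_Icc)
  obtain p' where p': "polynomial_function p'" "\<And>v. (p has_vector_derivative p' v) (at v)"
    using has_vector_derivative_polynomial_function[of p] p(1) by (auto simp: real_polynomial_function_eq)
  show thesis
  proof (rule that[of p p'])
    show "(p has_real_derivative p' v) (at v)" for v
      using p'(2) by (simp add: has_real_derivative_iff_has_vector_derivative)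
    show "continuous_on UNIV p'" by (rule continuous_on_polymonial_function[OF p'(1)])
    show "F (t + v) + \<epsilon> < p v \<and> p v < F (t + v) + 3 * \<epsilon>" if "0 \<le> v" "v \<le> b" for v
      using p(2)[of v] that by (auto simp: abs_less_iff)
  qed
qed

end

theorem lemma11:
  fixes l :: ereal
    and I :: "real set"
    and M :: "'w measure"
    and X :: "real \<Rightarrow> 'w \<Rightarrow> real"
    and P :: "real \<Rightarrow> 'w measure"
    and \<rho> s :: "real \<Rightarrow> real"
    and q :: "real \<Rightarrow> real \<Rightarrow> real \<Rightarrow> real"
    and f :: "real \<Rightarrow> ereal"
    and H :: "real \<Rightarrow> real \<Rightarrow> real"
  assumes diffusion: "linear_diffusion l I M X P \<rho> s q"
    and f_range: "\<And>t. 0 \<le> t \<Longrightarrow> l \<le> f t \<and> f t < \<infinity>"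
    and f_continuous: "continuous_on {0..} f"
    and life_time_pos: "0 < life_time l f"
    and X_to_infinity: "\<And>x. life_time l f = \<infinity> \<Longrightarrow> x \<in> I \<Longrightarrow>
      AE \<omega> in P x. filterlim (\<lambda>t. X t \<omega>) at_top at_top"
    and X_above_f: "\<And>x. life_time l f = \<infinity> \<Longrightarrow> x \<in> I \<Longrightarrow>
      AE \<omega> in P x. \<exists>L>0. ((\<lambda>t. ereal (X t \<omega>) - f t) \<longlongrightarrow> L) at_top"
    and H_range: "\<And>t y. (t, y) \<in> above_curve l f \<Longrightarrow> H t y \<in> {0..1}"
    and H_C12: "C12_on (above_curve l f) H"
    and H_pde: "\<And>t y. (t, y) \<in> interior (above_curve l f) \<Longrightarrow>
      generator \<rho> s (\<lambda>z. H t z) y + deriv (\<lambda>r. H r y) t = 0"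
    and H_boundary: "\<And>t y. (t, y) \<in> on_curve l f \<Longrightarrow> H t y = 1"
    and H_decreasing: "\<And>t y y'. (t, y) \<in> above_curve l f \<Longrightarrow> (t, y') \<in> above_curve l f \<Longrightarrow>
      y \<le> y' \<Longrightarrow> H t y' \<le> H t y"
    and H_limit_infinite: "life_time l f = \<infinity> \<Longrightarrow>
      ((\<lambda>(t, y). H t y) \<longlongrightarrow> 0) (inf (at_top \<times>\<^sub>F at_top) (principal (above_curve l f)))"
    and H_limit_finite: "\<And>y. life_time l f < \<infinity> \<Longrightarrow> l < ereal y \<Longrightarrow>
      ((\<lambda>t. H t y) \<longlongrightarrow> 0) (at_left (real_of_ereal (life_time l f)))"
  shows "\<forall>(t, y)\<in>above_curve l f.
    H t y = measure (P y)
      {\<omega>\<in>space M. curve_hitting_time X (shift t f) (life_time l f - ereal t) \<omega> < \<infinity>}"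
proof clarify
  fix t x assume "(t, x) \<in> above_curve l f"
  interpret linear_diffusion l I M X P \<rho> s q by (rule diffusion)
  interpret lower_curve l f by unfold_locales (rule f_range f_continuous; assumption)+
  have t: "0 < t" "ereal t < \<zeta>" "F t \<le> x"
    using \<open>(t, x) \<in> above_curve l f\<close> by (auto simp: above_curve_iff)
  have "l < ereal x"
    using \<open>(t, x) \<in> above_curve l f\<close> by (simp add: above_curve_def)
  then have xi: "x \<in> interior I" and xI: "x \<in> I" using interior_subset_I by (auto simp: interior_I)
  interpret prob_space "P x" using prob_space_P xI .
  define E where "E = {\<omega>\<in>space M. \<exists>u\<ge>0. ereal (t + u) < \<zeta> \<and> X u \<omega> = F (t + u)}"
  have E_eq: "{\<omega>\<in>space M. curve_hitting_time X (shift t f) (life_time l f - ereal t) \<omega> < \<infinity>} = E"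
    unfolding E_def curve_hitting_time_finite_iff[OF t(1)] ..
  obtain U where U: "\<And>n. 0 < U n" "\<And>n. ereal (t + U n) < \<zeta>"
    "\<And>V. 0 \<le> V \<Longrightarrow> ereal (t + V) < \<zeta> \<Longrightarrow> \<forall>\<^sub>F n in sequentially. V < U n"
    using exhausting_times[OF t(1,2)] by blast
  have Fc: "continuous_on {0..b} (\<lambda>v. F (t + v))" if "ereal (t + b) < \<zeta>" for b
    by (intro continuous_on_compose2[OF F_continuous] continuous_intros)
      (use t that in \<open>auto intro: less_life_time_mono\<close>)
  have E: "E \<in> sets M"
  proof -
    \<comment> \<open>The times before the life time form a half-open interval; the compact
      intervals up to \<open>U n\<close> exhaust it and bring \<open>sets_path_zero\<close> into
      play.\<close>
    have "E = (\<Union>n. {\<omega>\<in>space M. \<exists>u\<in>{0..U n}. X u \<omega> - F (t + u) = 0})" (is "_ = (\<Union>n. ?E n)")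
    proof (intro equalityI subsetI)
      fix \<omega> assume "\<omega> \<in> E"
      then obtain u where u: "\<omega> \<in> space M" "0 \<le> u" "ereal (t + u) < \<zeta>" "X u \<omega> = F (t + u)"
        by (auto simp: E_def)
      obtain n where "u < U n" using eventually_happens'[OF _ U(3)[OF u(2,3)]] by auto
      then show "\<omega> \<in> (\<Union>n. ?E n)" using u by (intro UN_I[of n]) (auto intro!: bexI[of _ u])
    next
      fix \<omega> assume "\<omega> \<in> (\<Union>n. ?E n)"
      then obtain n u where "\<omega> \<in> space M" "u \<in> {0..U n}" "X u \<omega> = F (t + u)" by auto
      then show "\<omega> \<in> E" using less_life_time_mono[OF U(2)[of n], of "t + u"] by (auto simp: E_def)
    qed
    moreover have "?E n \<in> sets M" for n
    proof (rule sets_path_zero[OF U(1)])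
      show "continuous_on {0..U n} (\<lambda>u. X u \<omega> - F (t + u))" if "\<omega> \<in> space M" for \<omega>
        by (intro continuous_on_diff path_continuous that Fc U(2)) simp
      show "(\<lambda>\<omega>. X u \<omega> - F (t + u)) \<in> borel_measurable M" if "u \<in> {0..U n}" for u
        using measurable_X[of u] that by (intro borel_measurable_diff) auto
    qed
    ultimately show ?thesis by auto
  qed
  then have EP: "E \<in> sets (P x)" by (simp add: sets_P xI)
  have "H t x = prob E"
  proof (cases "x = F t")
    case True
    \<comment> \<open>A start on the curve is itself a hit, with the witness
      \<open>u = 0\<close>.\<close>
    have "AE \<omega> in P x. \<omega> \<in> E"
      using start[OF xI] AE_space
      by eventually_elim (use True t space_P[OF xI] in \<open>auto simp: E_def intro!: exI[of _ 0]\<close>)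
    then have "prob E = 1" using EP by (simp add: prob_eq_1)
    moreover have "H t x = 1" using True t by (intro H_boundary) (simp add: on_curve_iff)
    ultimately show ?thesis by simp
  next
    case False
    then have gap: "0 < x - F t" using t(3) by simp

    \<comment> \<open>Optional stopping for the approximating regions\<close>
    obtain Ht Hy Hyy where HD: "\<And>r y. (r, y) \<in> interior (above_curve l f) \<Longrightarrow>
          ((\<lambda>r. H r y) has_real_derivative Ht r y) (at r) \<and>
          (H r has_real_derivative Hy r y) (at y) \<and>
          (Hy r has_real_derivative Hyy r y) (at y)"
      and HC: "continuous_on (above_curve l f) (\<lambda>(r, y). H r y)" "continuous_on (above_curve l f) (\<lambda>(r, y). Ht r y)"
        "continuous_on (above_curve l f) (\<lambda>(r, y). Hy r y)" "continuous_on (above_curve l f) (\<lambda>(r, y). Hyy r y)"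
      using H_C12 unfolding C12_on_def by fastforce
    \<comment> \<open>The factor 1/4 puts the starting point into every region: the lower edge at
      time 0 is below \<open>F t + 4 * \<epsilon> n\<close>, which is at most
      \<open>x\<close>.\<close>
    define \<epsilon> where "\<epsilon> n = (x - F t) / 4 * inverse (real (Suc n))" for n
    have \<epsilon>: "0 < \<epsilon> n" "4 * \<epsilon> n \<le> x - F t" for n
      using gap mult_left_le[of "inverse (real (Suc n))" "x - F t"]
      by (auto simp: \<epsilon>_def inverse_le_1_iff simp del: of_nat_Suc)
    have \<epsilon>lim: "\<epsilon> \<longlonglongrightarrow> 0"
    proof -
      have "(\<lambda>n. (x - F t) / 4 * inverse (real (Suc n))) \<longlonglongrightarrow> (x - F t) / 4 * 0"
        by (intro tendsto_intros LIMSEQ_inverse_real_of_nat)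
      then show ?thesis by (simp add: \<epsilon>_def[abs_def])
    qed
    have "\<exists>p p'. (\<forall>v. (p has_real_derivative p' v) (at v)) \<and> continuous_on UNIV p' \<and>
        (\<forall>v. 0 \<le> v \<longrightarrow> v \<le> U n \<longrightarrow> F (t + v) + \<epsilon> n < p v \<and> p v < F (t + v) + 3 * \<epsilon> n)" for n
      using smooth_approximation[OF t(1) U(2) \<epsilon>(1)] by metis
    then obtain p p' where p: "\<And>n v. (p n has_real_derivative p' n v) (at v)" "\<And>n. continuous_on UNIV (p' n)"
      "\<And>n v. 0 \<le> v \<Longrightarrow> v \<le> U n \<Longrightarrow> F (t + v) + \<epsilon> n < p n v \<and> p n v < F (t + v) + 3 * \<epsilon> n"
      by metis
    \<comment> \<open>The upper level must tend to infinity and may never be below the starting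
      point.\<close>
    define d where "d n = max x (real n)" for n
    have dlim: "filterlim d at_top sequentially"
      by (rule filterlim_at_top_mono[OF filterlim_real_sequentially]) (simp add: d_def)
    \<comment> \<open>The extra \<open>\<epsilon> n\<close> above \<open>p n\<close> leaves room for
      the cutoff to rise; the lower edge still stays below
      \<open>F (t + v) + 4 * \<epsilon> n\<close>.\<close>
    define C where "C n = {(v, y). p n v + \<epsilon> n \<le> y \<and> y \<le> d n}" for n
    define \<sigma> where "\<sigma> n \<omega> = exit_time (C n) (\<lambda>v. X v \<omega>) 0 (U n)" for n \<omega>
    \<comment> \<open>The open set strictly above the curve, with time shifted so that time 0 of the
      path corresponds to \<open>t\<close>. After the shift its points are interior to the domain of
      \<open>H\<close>, where the derivatives exist.\<close>
    define W where "W = {(v, y). 0 < t + v \<and> ereal (t + v) < \<zeta> \<and> F (t + v) < y}"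
    have W: "open W"
    proof -
      have "open ((\<lambda>q. (t + fst q, snd q)) -` {(t, y). 0 < t \<and> ereal t < \<zeta> \<and> F t < y})"
        by (intro open_vimage open_above continuous_intros)
      also have "(\<lambda>q. (t + fst q, snd q)) -` {(t, y). 0 < t \<and> ereal t < \<zeta> \<and> F t < y} = W"
        by (auto simp: W_def)
      finally show ?thesis .
    qed
    have Wint: "(t + v, y) \<in> interior (above_curve l f)" if "(v, y) \<in> W" for v y
      using that by (intro interior_above) (auto simp: W_def)
    have WI: "y \<in> interior I" if "(v, y) \<in> W" for v y
      using that f_above[of "t + v"] less_trans[of l "ereal (F (t + v))" "ereal y"]
      by (auto simp: W_def interior_I)
    have hc: "continuous_on W (\<lambda>(v, y). g (t + v) y)" if "continuous_on (above_curve l f) (\<lambda>(r, y). g r y)" for g :: "real \<Rightarrow> real \<Rightarrow> real"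
    proof -
      have "(\<lambda>q. (t + fst q, snd q)) ` W \<subseteq> above_curve l f"
        by (auto dest!: Wint intro: subsetD[OF interior_subset])
      then have "continuous_on W ((\<lambda>(r, y). g r y) \<circ> (\<lambda>q. (t + fst q, snd q)))"
        by (intro continuous_on_compose continuous_intros continuous_on_subset[OF that])
      then show ?thesis by (simp add: o_def case_prod_beta)
    qed
    have "\<exists>Z\<in>borel_measurable (P x). (AE \<omega> in P x. Z \<omega> = H (t + \<sigma> n \<omega>) (X (\<sigma> n \<omega>) \<omega>)) \<and> (\<integral>\<omega>. Z \<omega> \<partial>P x) = H (t + 0) x" for n
    proof (rule Dynkin_above_curve[OF U(1) \<epsilon>(1) p(1) p(2) W, where h="\<lambda>v. H (t + v)" and ht="\<lambda>v. Ht (t + v)"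
          and hy="\<lambda>v. Hy (t + v)" and hyy="\<lambda>v. Hyy (t + v)"])
      show "W \<subseteq> UNIV \<times> interior I" using WI by auto
      show "(v, y) \<in> W" if "0 \<le> v" "v \<le> U n" "p n v \<le> y" for v y
        using that p(3)[OF that(1,2)] \<epsilon>(1)[of n] t(1) less_life_time_mono[OF U(2)[of n], of "t + v"] by (auto simp: W_def)
      fix v y assume w: "(v, y) \<in> W"
      note D = HD[OF Wint[OF w]]
      show d1: "((\<lambda>r. H (t + r) y) has_real_derivative Ht (t + v) y) (at v)"
        using D DERIV_shift[of "\<lambda>r. H r y" "Ht (t + v) y" v t] by (simp add: add.commute)
      show "(H (t + v) has_real_derivative Hy (t + v) y) (at y)"
        "(Hy (t + v) has_real_derivative Hyy (t + v) y) (at y)" using D by auto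
      have g: "generator \<rho> s (H (t + v)) y = psi (Hy (t + v) y) (Hyy (t + v) y) y / \<rho> y"
        by (rule generator_eq[OF WI[OF w] open_greaterThan[of "F (t + v)"]])
          (use w D HD[OF Wint] in \<open>auto simp: W_def\<close>)
      have "deriv (\<lambda>r. H r y) (t + v) = Ht (t + v) y" using D by (blast intro: DERIV_imp_deriv)
      then show "psi (Hy (t + v) y) (Hyy (t + v) y) y / rhoI y + Ht (t + v) y = 0"
        using H_pde[OF Wint[OF w]] g interior_subset_I[OF WI[OF w]] by (simp add: rhoI_def)
    next
      show "p n 0 + \<epsilon> n \<le> x" using p(3)[of 0 n] U(1)[of n] \<epsilon>(2)[of n] by auto
      show "x \<le> d n" by (simp add: d_def)
      show "\<sigma> n \<omega> = exit_time {(v, y). p n v + \<epsilon> n \<le> y \<and> y \<le> d n} (\<lambda>v. X v \<omega>) 0 (U n)" for \<omega>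
        by (simp add: \<sigma>_def C_def)
    qed (rule hc HC)+
    then have "\<forall>n. \<exists>Z. Z \<in> borel_measurable (P x) \<and> (AE \<omega> in P x. Z \<omega> = H (t + \<sigma> n \<omega>) (X (\<sigma> n \<omega>) \<omega>)) \<and>
        (\<integral>\<omega>. Z \<omega> \<partial>P x) = H t x"
      unfolding Bex_def add_0_right by blast
    from choice[OF this] obtain Z where Z: "\<And>n. Z n \<in> borel_measurable (P x)"
      "\<And>n. AE \<omega> in P x. Z n \<omega> = H (t + \<sigma> n \<omega>) (X (\<sigma> n \<omega>) \<omega>)" "\<And>n. (\<integral>\<omega>. Z n \<omega> \<partial>P x) = H t x"
      by blast
    have pc: "continuous_on UNIV (p n)" for n
      using DERIV_isCont[OF p(1)] by (intro continuous_at_imp_continuous_on) blast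
    have Cc: "closed (C n)" for n
    proof -
      have "closed ({q::real\<times>real. p n (fst q) + \<epsilon> n \<le> snd q} \<inter> {q. snd q \<le> d n})"
        by (intro closed_Int closed_Collect_le continuous_intros continuous_on_compose2[OF pc]) auto
      also have "{q::real\<times>real. p n (fst q) + \<epsilon> n \<le> snd q} \<inter> {q. snd q \<le> d n} = C n"
        by (auto simp: C_def)
      finally show ?thesis .
    qed
    have C0: "(0, x) \<in> C n" for n
      using p(3)[of 0 n] U(1)[of n] \<epsilon>(2)[of n] by (auto simp: C_def d_def)
    have \<sigma>b: "0 \<le> \<sigma> n \<omega>" "\<sigma> n \<omega> \<le> U n" for n \<omega>
      using exit_time_bounds[of 0 "U n"] U(1)[of n] by (auto simp: \<sigma>_def less_imp_le)
    have above: "(t + \<sigma> n \<omega>, X (\<sigma> n \<omega>) \<omega>) \<in> above_curve l f" if \<omega>: "\<omega> \<in> space M" "X 0 \<omega> = x" for n \<omega>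
    proof -
      have "(\<sigma> n \<omega>, X (\<sigma> n \<omega>) \<omega>) \<in> C n"
        unfolding \<sigma>_def using exit_in_closed[OF path_continuous[OF \<omega>(1)] Cc, of 0 "U n" n] C0[of n] \<omega>(2) U(1)[of n]
        by simp
      then show ?thesis
        using p(3)[OF \<sigma>b, of n \<omega>] \<epsilon>(1)[of n] \<sigma>b[of n \<omega>] t(1) less_life_time_mono[OF U(2)[of n], of "t + \<sigma> n \<omega>"]
        by (auto simp: above_curve_iff C_def)
    qed
    have later: "\<forall>\<^sub>F n in sequentially. V \<le> \<sigma> n \<omega>"
      if \<omega>: "\<omega> \<in> space M" and V: "0 \<le> V" "ereal (t + V) < \<zeta>" and Fw: "\<And>v. v \<in> {0..V} \<Longrightarrow> F (t + v) < X v \<omega>" for \<omega> V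
      unfolding \<sigma>_def C_def
    proof (rule eventually_exit_after[OF t(1) V path_continuous[OF \<omega>] Fw _ \<epsilon>lim dlim])
      show "\<forall>\<^sub>F n in sequentially. V \<le> U n" using U(3)[OF V] by (auto elim: eventually_mono)
      show "p n v + \<epsilon> n \<le> F (t + v) + 4 * \<epsilon> n" if "v \<in> {0..U n}" for n v
        using p(3)[of v n] that by auto
    qed auto

    \<comment> \<open>Paths that hit the curve\<close>
    have hit: "(\<lambda>n. H (t + \<sigma> n \<omega>) (X (\<sigma> n \<omega>) \<omega>)) \<longlonglongrightarrow> 1" if \<omega>: "\<omega> \<in> E" "X 0 \<omega> = x" for \<omega>
    proof -
      have sp: "\<omega> \<in> space M" using \<omega> by (simp add: E_def)
      obtain v1 where v1: "0 \<le> v1" "ereal (t + v1) < \<zeta>" "X v1 \<omega> = F (t + v1)" using \<omega> by (auto simp: E_def)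
      have dc: "continuous_on {0..v1} (\<lambda>v. X v \<omega> - F (t + v))"
        by (intro continuous_on_diff path_continuous sp Fc v1(2)) simp
      \<comment> \<open>With \<open>\<le>\<close> in place of equality, minimality of the first
        element \<open>T\<close> gives at once that the path is strictly above the curve before
        \<open>T\<close>.\<close>
      define S where "S = {v\<in>{0..v1}. X v \<omega> - F (t + v) \<le> 0}"
      have "closed S" unfolding S_def
        by (rule continuous_on_closed_Collect_le[OF dc continuous_on_const]) simp
      moreover have "{0..v1} \<inter> S = S" by (auto simp: S_def)
      ultimately have "compact S"
        using compact_Int_closed[of "{0..v1}" S] by simp
      moreover have "v1 \<in> S" using v1 by (simp add: S_def)
      ultimately obtain T where T: "T \<in> S" "\<And>v. v \<in> S \<Longrightarrow> T \<le> v"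
        using compact_attains_inf[of S] by auto
      have T0: "0 < T" using T(1) \<omega>(2) gap by (cases "T = 0") (auto simp: S_def)
      have Tz: "ereal (t + T) < \<zeta>" using T(1) v1 by (intro less_life_time_mono[OF v1(2)]) (simp add: S_def)
      have before: "F (t + v) < X v \<omega>" if "0 \<le> v" "v < T" for v
        using T(2)[of v] that T(1) by (force simp: S_def)
      \<comment> \<open>Membership of \<open>T\<close> in \<open>S\<close> gives one inequality; the
        other is a limit from the left, possible because \<open>T\<close> is positive.\<close>
      have XT: "X T \<omega> = F (t + T)"
      proof (rule antisym)
        show "X T \<omega> \<le> F (t + T)" using T(1) by (simp add: S_def)
        have "continuous_on {0..T} (\<lambda>v. X v \<omega> - F (t + v))"
          using T(1) by (intro continuous_on_subset[OF dc]) (auto simp: S_def)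
        then have "((\<lambda>v. X v \<omega> - F (t + v)) \<longlongrightarrow> X T \<omega> - F (t + T)) (at T within {0..T})"
          using T0 by (simp add: continuous_on_def)
        then have "((\<lambda>v. X v \<omega> - F (t + v)) \<longlongrightarrow> X T \<omega> - F (t + T)) (at_left T)"
          using T0 by (simp add: at_within_Icc_at_left)
        moreover have "\<forall>\<^sub>F v in at_left T. 0 \<le> X v \<omega> - F (t + v)"
          using before T0 by (auto simp: eventually_at_left_field less_imp_le intro!: exI[of _ 0])
        ultimately have "0 \<le> X T \<omega> - F (t + T)"
          by (intro tendsto_lowerbound) auto
        then show "F (t + T) \<le> X T \<omega>" by simp
      qed
      have \<sigma>T: "(\<lambda>n. \<sigma> n \<omega>) \<longlonglongrightarrow> T"
      proof (rule order_tendstoI)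
        fix c assume c: "c < T"
        \<comment> \<open>A nonnegative time strictly between \<open>c\<close> and \<open>T\<close>,
          also when \<open>c\<close> is negative.\<close>
        define V where "V = (max 0 c + T) / 2"
        have V: "0 \<le> V" "c < V" "V < T" using c T0 by (auto simp: V_def)
        have "\<forall>\<^sub>F n in sequentially. V \<le> \<sigma> n \<omega>"
          by (rule later[OF sp V(1)]) (use V before less_life_time_mono[OF Tz, of "t + V"] in auto)
        then show "\<forall>\<^sub>F n in sequentially. c < \<sigma> n \<omega>" by eventually_elim (use V in auto)
      next
        fix c assume c: "T < c"
        have "\<forall>\<^sub>F n in sequentially. T < U n" using T0 Tz by (intro U(3)) auto
        then show "\<forall>\<^sub>F n in sequentially. \<sigma> n \<omega> < c"
        proof eventually_elim
          case (elim n)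
          \<comment> \<open>At time \<open>T\<close> the path is on the curve and so below
            \<open>p n\<close>; the exit therefore happens by time \<open>T\<close>, provided that
            \<open>T < U n\<close>.\<close>
          have "(T, X T \<omega>) \<notin> C n"
            using p(3)[of T n] T0 elim \<epsilon>(1)[of n] XT by (auto simp: C_def)
          then have "\<sigma> n \<omega> \<le> T" unfolding \<sigma>_def using T0 elim by (intro exit_time_le) auto
          then show ?case using c by simp
        qed
      qed
      have "(\<lambda>n. X (\<sigma> n \<omega>) \<omega>) \<longlonglongrightarrow> X T \<omega>"
        by (rule continuous_on_tendsto_compose[OF continuous_paths[OF sp] \<sigma>T]) (use T0 \<sigma>b in auto)
      then have "(\<lambda>n. (t + \<sigma> n \<omega>, X (\<sigma> n \<omega>) \<omega>)) \<longlonglongrightarrow> (t + T, F (t + T))"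
        unfolding XT by (intro tendsto_intros \<sigma>T)
      \<comment> \<open>Here \<open>H\<close> is used as a function continuous up to the curve; the
        exit points stay in its domain by \<open>above\<close>.\<close>
      from continuous_on_tendsto_compose[OF HC(1) this]
      have "(\<lambda>n. H (t + \<sigma> n \<omega>) (X (\<sigma> n \<omega>) \<omega>)) \<longlonglongrightarrow> H (t + T) (F (t + T))"
        using above[OF sp \<omega>(2)] t(1) T0 Tz by (simp add: above_curve_iff)
      moreover have "H (t + T) (F (t + T)) = 1"
        using t(1) T0 Tz by (intro H_boundary) (simp add: on_curve_iff)
      ultimately show ?thesis by simp
    qed

    \<comment> \<open>Paths that do not hit the curve\<close>
    have above_all: "F (t + v) < X v \<omega>" if \<omega>: "\<omega> \<in> space M" "\<omega> \<notin> E" "X 0 \<omega> = x" and v: "0 \<le> v" "ereal (t + v) < \<zeta>" for \<omega> v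
    proof (rule ccontr)
      assume n: "\<not> F (t + v) < X v \<omega>"
      have "continuous_on {0..v} (\<lambda>u. X u \<omega> - F (t + u))"
        by (intro continuous_on_diff path_continuous \<omega> Fc v(2)) simp
      then have "\<exists>u\<ge>0. u \<le> v \<and> X u \<omega> - F (t + u) = 0"
        by (rule IVT2'[rotated 3]) (use n gap \<omega>(3) v in auto)
      then obtain u where "0 \<le> u" "u \<le> v" "X u \<omega> = F (t + u)" by auto
      then show False using \<omega>(1,2) less_life_time_mono[OF v(2), of "t + u"] by (auto simp: E_def)
    qed
    have no_hit: "AE \<omega> in P x. \<omega> \<notin> E \<longrightarrow> (\<lambda>n. H (t + \<sigma> n \<omega>) (X (\<sigma> n \<omega>) \<omega>)) \<longlonglongrightarrow> 0"
    proof (cases \<zeta>)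
      case PInf
      show ?thesis
        using X_to_infinity[OF PInf xI] start[OF xI] AE_space
      proof eventually_elim
        case (elim \<omega>)
        have sp: "\<omega> \<in> space M" using elim by (simp add: space_P xI)
        show ?case
        proof
          assume nE: "\<omega> \<notin> E"
          have \<sigma>inf: "filterlim (\<lambda>n. \<sigma> n \<omega>) at_top sequentially"
            unfolding filterlim_at_top
          proof
            fix V :: real
            have "\<forall>\<^sub>F n in sequentially. max 0 V \<le> \<sigma> n \<omega>"
              by (rule later[OF sp]) (use above_all[OF sp nE elim(2)] PInf in auto)
            then show "\<forall>\<^sub>F n in sequentially. V \<le> \<sigma> n \<omega>" by eventually_elim simp
          qed
          have "filterlim (\<lambda>n. (t + \<sigma> n \<omega>, X (\<sigma> n \<omega>) \<omega>)) (inf (at_top \<times>\<^sub>F at_top) (principal (above_curve l f))) sequentially"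
            unfolding filterlim_inf filterlim_principal
          proof
            show "filterlim (\<lambda>n. (t + \<sigma> n \<omega>, X (\<sigma> n \<omega>) \<omega>)) (at_top \<times>\<^sub>F at_top) sequentially"
              by (intro filterlim_Pair filterlim_tendsto_add_at_top[OF tendsto_const \<sigma>inf]
                  filterlim_compose[OF elim(1) \<sigma>inf])
            show "\<forall>\<^sub>F n in sequentially. (t + \<sigma> n \<omega>, X (\<sigma> n \<omega>) \<omega>) \<in> above_curve l f"
              using above[OF sp elim(2)] by simp
          qed
          from filterlim_compose[OF H_limit_infinite[OF PInf] this]
          show "(\<lambda>n. H (t + \<sigma> n \<omega>) (X (\<sigma> n \<omega>) \<omega>)) \<longlonglongrightarrow> 0" by simp
        qed
      qed
    next
      case (real z)
      have tz: "t < z" using t(2) real by simp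
      then have z0: "0 < z" "0 < z - t" using t(1) by auto
      \<comment> \<open>At the end point \<open>l\<close> there would be no room for a level
        \<open>y0\<close> below the path; the positive time \<open>z - t\<close> excludes this
        almost surely.\<close>
      have "AE \<omega> in P x. X (z - t) \<omega> \<in> interior I" using AE_interior_I[OF z0(2) xI] .
      then show ?thesis
        using start[OF xI] AE_space
      proof eventually_elim
        case (elim \<omega>)
        have sp: "\<omega> \<in> space M" using elim by (simp add: space_P xI)
        show ?case
        proof
          assume nE: "\<omega> \<notin> E"
          have \<sigma>z: "\<sigma> n \<omega> < z - t" for n using \<sigma>b(2)[of n \<omega>] U(2)[of n] real by auto
          have \<sigma>lim: "(\<lambda>n. \<sigma> n \<omega>) \<longlonglongrightarrow> z - t"
          proof (rule order_tendstoI)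
            fix c assume c: "c < z - t"
            define V where "V = (max 0 c + (z - t)) / 2"
            have V: "0 \<le> V" "c < V" "V < z - t" using c z0 by (auto simp: V_def)
            have "\<forall>\<^sub>F n in sequentially. V \<le> \<sigma> n \<omega>"
              by (rule later[OF sp V(1)]) (use V above_all[OF sp nE elim(2)] real in auto)
            then show "\<forall>\<^sub>F n in sequentially. c < \<sigma> n \<omega>" by eventually_elim (use V in auto)
          next
            fix c assume "z - t < c"
            then show "\<forall>\<^sub>F n in sequentially. \<sigma> n \<omega> < c"
              by (intro always_eventually allI less_trans[OF \<sigma>z])
          qed
          have Xlim: "(\<lambda>n. X (\<sigma> n \<omega>) \<omega>) \<longlonglongrightarrow> X (z - t) \<omega>"
            by (rule continuous_on_tendsto_compose[OF continuous_paths[OF sp] \<sigma>lim]) (use z0 \<sigma>b in auto)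
          \<comment> \<open>The level depends on the path but not on \<open>n\<close>, so the limit
            condition at a fixed position applies.\<close>
          obtain y0 where y0: "l < ereal y0" "y0 < X (z - t) \<omega>"
            using elim(1) ereal_dense2[of l "ereal (X (z - t) \<omega>)"] by (auto simp: interior_I)
          have left: "filterlim (\<lambda>n. t + \<sigma> n \<omega>) (at_left z) sequentially"
          proof (rule tendsto_imp_filterlim_at_left)
            show "(\<lambda>n. t + \<sigma> n \<omega>) \<longlonglongrightarrow> z" using tendsto_add[OF tendsto_const \<sigma>lim, of t] by simp
            show "\<forall>\<^sub>F n in sequentially. t + \<sigma> n \<omega> < z" using \<sigma>z by (simp add: less_diff_eq add.commute)
          qed
          have H0: "(\<lambda>n. H (t + \<sigma> n \<omega>) y0) \<longlonglongrightarrow> 0"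
            using filterlim_compose[OF H_limit_finite[OF _ y0(1)]] left real by simp
          show "(\<lambda>n. H (t + \<sigma> n \<omega>) (X (\<sigma> n \<omega>) \<omega>)) \<longlonglongrightarrow> 0"
          proof (rule tendsto_sandwich[OF _ _ tendsto_const H0])
            show "\<forall>\<^sub>F n in sequentially. 0 \<le> H (t + \<sigma> n \<omega>) (X (\<sigma> n \<omega>) \<omega>)"
              using H_range[OF above[OF sp elim(2)]] by simp
            \<comment> \<open>Monotonicity of \<open>H\<close> may only be used between points of
              its domain, so \<open>y0\<close> has to be above the curve at the exit times.\<close>
            have "\<forall>\<^sub>F n in sequentially. F (t + \<sigma> n \<omega>) < y0"
              using eventually_curve_below[OF real z0(1) y0(1)] left by (rule eventually_compose_filterlim)
            with order_tendstoD(1)[OF Xlim y0(2)]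
            show "\<forall>\<^sub>F n in sequentially. H (t + \<sigma> n \<omega>) (X (\<sigma> n \<omega>) \<omega>) \<le> H (t + \<sigma> n \<omega>) y0"
            proof eventually_elim
              case (elim n)
              note ab = above[OF sp \<open>X 0 \<omega> = x\<close>, of n]
              show ?case
                by (rule H_decreasing[OF _ ab]) (use ab elim in \<open>auto simp: above_curve_iff\<close>)
            qed
          qed
        qed
      qed
    next
      case MInf
      then show ?thesis using t by simp
    qed

    \<comment> \<open>Passage to the limit\<close>
    have Z_eq: "AE \<omega> in P x. \<forall>n. Z n \<omega> = H (t + \<sigma> n \<omega>) (X (\<sigma> n \<omega>) \<omega>)"
      using Z(2) by (simp add: AE_all_countable)
    \<comment> \<open>The expectations on the left do not depend on \<open>n\<close>, by
      \<open>Z(3)\<close>; values of \<open>H\<close> in the unit interval supply the majorant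
      1.\<close>
    have "(\<lambda>n. \<integral>\<omega>. Z n \<omega> \<partial>P x) \<longlonglongrightarrow> (\<integral>\<omega>. indicator E \<omega> \<partial>P x)"
    proof (rule integral_dominated_convergence[where w="\<lambda>_. 1"])
      show "AE \<omega> in P x. (\<lambda>n. Z n \<omega>) \<longlonglongrightarrow> indicator E \<omega>"
        using Z_eq no_hit start[OF xI]
      proof eventually_elim
        case (elim \<omega>)
        then show ?case
          using hit[of \<omega>] by (cases "\<omega> \<in> E") simp_all
      qed
      show "AE \<omega> in P x. norm (Z n \<omega>) \<le> 1" for n
        using Z(2)[of n] start[OF xI] AE_space
      proof eventually_elim
        case (elim \<omega>)
        then show ?case
          using H_range[OF above[of \<omega> n]] by (simp add: space_P xI)
      qed
    qed (use Z(1) EP in auto)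
    then have "(\<lambda>n::nat. H t x) \<longlonglongrightarrow> prob E" using EP by (simp add: Z(3))
    then show ?thesis by (simp add: LIMSEQ_const_iff)
  qed
  then show "H t x = measure (P x) {\<omega>\<in>space M. curve_hitting_time X (shift t f) (life_time l f - ereal t) \<omega> < \<infinity>}"
    by (simp only: E_eq)
qed

end
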